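(* Let $\mathbf{P}:=(P_1,\dots,P_n)^T$ be a complex-adjoint invariant vector distributional operator with vector distributional Fourier transform $\hat{\mathbf{p}}:=(\hat p_1,\dots,\hat p_n)^T$ which is nonzero on $\mathbb{R}^d\setminus\{0\}$. Suppose that $x\mapsto\|\hat{\mathbf{p}}(x)\|_2^{-1}$ belongs to $\mathcal{SI}$ and that $\|\hat{\mathbf{p}}(x)\|_2=\Theta(\|x\|_2^m)$ as $\|x\|_2\to0$ for some $m\in\mathbb{N}_0$. Let $G\in\mathrm{Re}(\mathrm{C}(\mathbb{R}^d))\cap\mathcal{SI}$ be an even Green function with respect to $L=\mathbf{P}^{*T}\mathbf{P}=\sum_{j=1}^nP_j^*P_j$. If $\mathrm{H}_{\mathbf{P}}(\mathbb{R}^d)\subseteq \mathrm{L}_2(\mathbb{R}^d)$, then $G$ is positive definite and $$\mathcal{N}_G^m(\mathbb{R}^d)\equiv\mathrm{H}_{\mathbf{P}}(\mathbb{R}^d),$$ i.e., the native space of $G$ and the generalized Sobolev space coincide, with equal semi-inner products; moreover $m=0$.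
   Context: Function classes. $\mathrm{Re}(\mathcal{E})$ denotes the real-valued members of a function space $\mathcal{E}$. $\mathcal{SI}$ is the set of $f:\mathbb{R}^d\to\mathbb{C}$ (possibly defined only almost everywhere) such that $f(x)=\mathcal{O}(\|x\|_2^{k})$ as $\|x\|_2\to\infty$ for some $k\in\mathbb{N}_0$. $f=\Theta(g)$ means there are positive constants $M_1,M_2$ with $M_1|g|\le|f|\le M_2|g|$ (in the indicated limit). $\mathcal{FT}:=\{f\in \mathrm{C}^\infty(\mathbb{R}^d): D^\alpha f\in\mathcal{SI}\text{ for each }\alpha\in\mathbb{N}_0^d\}$. Distributions. $\mathcal{S}$ is the (complex-valued) Schwartz space on $\mathbb{R}^d$ with its usual Fréchet topology, $\mathcal{S}'$ the space of tempered distributions, $\langle T,\gamma\rangle:=T(\gamma)$ (bilinear pairing). Each $f\in \mathrm{L}_1^{loc}(\mathbb{R}^d)\cap\mathcal{SI}$ is identified with the tempered distribution $\gamma\mapsto\int f\gamma$ (so functions equal almost everywhere are identified). The Fourier transform on $\mathcal{S}$ is $\hat\gamma(x)=(2\pi)^{-d/2}\int\gamma(y)e^{-ix^Ty}\,dy$, and for $T\in\mathcal{S}'$, $\langle\hat T,\gamma\rangle:=\langle T,\hat\gamma\rangle$. $\delta_0$ is the Dirac distribution at the origin. Distributional operators. A linear operator $P:\mathcal{S}'\to\mathcal{S}'$ is a distributional operator, with (distributional) adjoint the linear operator $P^*:\mathcal{S}'\to\mathcal{S}'$, if $P|_{\mathcal{S}}$ and $P^*|_{\mathcal{S}}$ are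 continuous operators from $\mathcal{S}$ into $\mathcal{S}$ and $\langle PT,\gamma\rangle=\langle T,P^*\gamma\rangle$, $\langle P^*T,\gamma\rangle=\langle T,P\gamma\rangle$ for all $T\in\mathcal{S}'$, $\gamma\in\mathcal{S}$. $P$ is complex-adjoint invariant if $\overline{P\gamma}=P\overline{\gamma}$ for each $\gamma\in\mathcal{S}$. A function $\hat p\in\mathcal{FT}$ is the distributional Fourier transform of $P$ if $\langle\widehat{PT},\gamma\rangle=\langle\hat T,\hat p\gamma\rangle$ for all $T\in\mathcal{S}'$, $\gamma\in\mathcal{S}$. A vector distributional operator $\mathbf{P}=(P_1,\dots,P_n)^T$ is a vector of distributional operators; it is complex-adjoint invariant if each $P_j$ is, and its distributional Fourier transform is the vector of those of the $P_j$. $\mathbf{P}^*=(P_1^*,\dots,P_n^* )^T$. Green function. $G\in\mathcal{S}'$ is a (full-space) Green function with respect to a distributional operator $L$ if $LG=\delta_0$ in $\mathcal{S}'$. Generalized Sobolev space. For $\mathbf{P}=(P_1,\dots,P_n)^T$, $$\mathrm{H}_{\mathbf{P}}(\mathbb{R}^d):=\{f\in\mathrm{Re}(\mathrm{L}_1^{loc}(\mathbb{R}^d))\cap\mathcal{SI}: P_jf\in \mathrm{L}_2(\mathbb{R}^d),\ j=1,\dots,n\},$$ with semi-inner product $(f,g)_{\mathrm{H}_{\mathbf{P}}(\mathbb{R}^d)}:=\sum_{j=1}^n\int_{\mathbb{R}^d}P_jf(x)\overline{P_jg(x)}\,dx$. Conditional positive definiteness. $\pi_{m-1}(\mathbb{R}^d)$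 is the space of real polynomials on $\mathbb{R}^d$ of degree at most $m-1$, with $\pi_{-1}(\mathbb{R}^d):=\{0\}$. A continuous even function $\Phi:\mathbb{R}^d\to\mathbb{R}$ is conditionally positive definite of order $m\in\mathbb{N}_0$ if for all $N\in\mathbb{N}$, all pairwise distinct $x_1,\dots,x_N\in\mathbb{R}^d$ and all $c\in\mathbb{R}^N\setminus\{0\}$ with $\sum_j c_jp(x_j)=0$ for all $p\in\pi_{m-1}(\mathbb{R}^d)$, one has $\sum_{j,k}c_jc_k\Phi(x_j-x_k)>0$. In the case $m=0$, $\Phi$ is called positive definite. (In the paper, the stated hypotheses on $\mathbf{P}$ and $G$ are those under which $G$ is asserted to be conditionally positive definite of order $m$, so that its native space is defined.) Native space (Wendland). Let $\Phi$ be conditionally positive definite of order $m$. Let $F_\Phi$ be the space of functions $\sum_{j=1}^N\alpha_j\Phi(\cdot-x_j)$, $\alpha_j\in\mathbb{R}$, $x_j\in\mathbb{R}^d$, with $\sum_j\alpha_jp(x_j)=0$ for all $p\in\pi_{m-1}(\mathbb{R}^d)$, with inner product $\big(\sum_j\alpha_j\Phi(\cdot-x_j),\sum_k\beta_k\Phi(\cdot-y_k)\big)_\Phi:=\sum_{j,k}\alpha_j\beta_k\Phi(x_j-y_k)$, and let $\mathcal{F}_\Phi$ be its Hilbert space completion. Fix a $\pi_{m-1}(\mathbb{R}^d)$-unisolvent set $\{\xi_1,\dots,\xi_Q\}$, $Q=\dim\pi_{m-1}(\mathbb{R}^d)$, with Lagrange basis $q_1,\dots,q_Q$, and set $\Pi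 f:=\sum_kf(\xi_k)q_k$ and $R:\mathcal{F}_\Phi\to \mathrm{C}(\mathbb{R}^d)$, $R(f)(x):=\big(f,\Phi(\cdot-x)-\sum_kq_k(x)\Phi(\cdot-\xi_k)\big)_\Phi$ ($R$ is injective). The native space is $\mathcal{N}_\Phi^m(\mathbb{R}^d):=\pi_{m-1}(\mathbb{R}^d)+R(\mathcal{F}_\Phi)$ with semi-inner product $(f,g)_{\mathcal{N}_\Phi^m(\mathbb{R}^d)}:=\big(R^{-1}(f-\Pi f),R^{-1}(g-\Pi g)\big)_\Phi$; it does not depend on the choice of unisolvent set. *)

theory Defs
  imports "HOL-Analysis.Analysis" "HOL-Library.Landau_Symbols"
begin

subsection \<open>Function classes\<close>

text \<open>
  A monomial \<open>x\<^sup>\<alpha>\<close>; the multi-index \<open>\<alpha>\<close> is a function on the coordinates.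
\<close>
definition monomial :: "('d::finite \<Rightarrow> nat) \<Rightarrow> real^'d \<Rightarrow> real" where
  "monomial \<alpha> x = (\<Prod>i\<in>UNIV. x $ i ^ \<alpha> i)"

definition partial_derivative ::
    "'d::finite \<Rightarrow> (real^'d \<Rightarrow> complex) \<Rightarrow> real^'d \<Rightarrow> complex" where
  "partial_derivative i f x = vector_derivative (\<lambda>t. f (x + t *\<^sub>R axis i 1)) (at 0)"

text \<open>
  The derivatives \<open>D\<^sup>\<alpha>\<close> are indexed by lists of coordinates, the list recording the order of
  differentiation.  On smooth functions mixed partial derivatives commute, so that the
  functions \<open>iterated_partial is f\<close> are exactly the \<open>D\<^sup>\<alpha> f\<close> for the multi-indices \<open>\<alpha>\<close>.
\<close>
primrec iterated_partial ::
    "'d::finite list \<Rightarrow> (real^'d \<Rightarrow> complex) \<Rightarrow> real^'d \<Rightarrow> complex" where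
  "iterated_partial [] f = f"
| "iterated_partial (i # is) f = partial_derivative i (iterated_partial is f)"

definition smooth :: "(real^'d::finite \<Rightarrow> complex) \<Rightarrow> bool" where
  "smooth f \<longleftrightarrow>
     (\<forall>is. continuous_on UNIV (iterated_partial is f) \<and>
           (\<forall>i x. (\<lambda>t. iterated_partial is f (x + t *\<^sub>R axis i 1)) differentiable (at (0::real))))"

text \<open>
  Functions of at most polynomial growth.  Members may be defined only almost everywhere and
  functions equal almost everywhere are identified, hence the bound is required almost
  everywhere; for continuous functions this is the same as the pointwise bound.
\<close>
definition SI :: "(real^'d::finite \<Rightarrow> 'b::real_normed_vector) set" where
  "SI = {f. \<exists>k::nat. \<exists>C R. AE x in lebesgue. R \<le> norm x \<longrightarrow> norm (f x) \<le> C * norm x ^ k}"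

definition FT :: "(real^'d::finite \<Rightarrow> complex) set" where
  "FT = {f. smooth f \<and> (\<forall>is. iterated_partial is f \<in> SI)}"

definition L1loc :: "(real^'d::finite \<Rightarrow> 'b::{banach, second_countable_topology}) set" where
  "L1loc = {f. \<forall>K. compact K \<longrightarrow> set_integrable lebesgue K f}"

definition L2 :: "(real^'d::finite \<Rightarrow> 'b::{banach, second_countable_topology}) set" where
  "L2 = {f \<in> borel_measurable lebesgue. integrable lebesgue (\<lambda>x. (norm (f x))\<^sup>2)}"

subsection \<open>Schwartz space and tempered distributions\<close>

definition schwartz :: "(real^'d::finite \<Rightarrow> complex) set" where
  "schwartz =
     {f. smooth f \<and> (\<forall>\<beta> is. bounded (range (\<lambda>x. monomial \<beta> x *\<^sub>R iterated_partial is f x)))}"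

definition schwartz_seminorm ::
    "('d::finite \<Rightarrow> nat) \<Rightarrow> 'd list \<Rightarrow> (real^'d \<Rightarrow> complex) \<Rightarrow> real" where
  "schwartz_seminorm \<beta> is f = (SUP x. norm (monomial \<beta> x *\<^sub>R iterated_partial is f x))"

text \<open>The seminorm balls form a subbasis of the Frechet topology; its \<open>topspace\<close> is \<open>schwartz\<close>.\<close>
definition schwartz_topology :: "(real^'d::finite \<Rightarrow> complex) topology" where
  "schwartz_topology = topology_generated_by
     {{g \<in> schwartz. schwartz_seminorm \<beta> is (\<lambda>x. g x - f x) < e} | f \<beta> is e.
        f \<in> schwartz \<and> e > 0}"

type_synonym 'd distribution = "(real^'d \<Rightarrow> complex) \<Rightarrow> complex"

text \<open>
  Functionals are normalised to be \<open>undefined\<close> outside \<open>schwartz\<close>, so that HOL equality of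
  tempered distributions is equality of functionals on \<open>schwartz\<close>.
\<close>
definition tempered :: "'d::finite distribution set" where
  "tempered = {T \<in> extensional schwartz.
     (\<forall>a b. \<forall>\<gamma>\<in>schwartz. \<forall>\<eta>\<in>schwartz. T (\<lambda>x. a * \<gamma> x + b * \<eta> x) = a * T \<gamma> + b * T \<eta>) \<and>
     continuous_map schwartz_topology euclidean T}"

definition distr_of :: "(real^'d::finite \<Rightarrow> complex) \<Rightarrow> 'd distribution" where
  "distr_of f = (\<lambda>\<gamma>\<in>schwartz. LINT x|lebesgue. f x * \<gamma> x)"

definition dirac :: "'d::finite distribution" where
  "dirac = (\<lambda>\<gamma>\<in>schwartz. \<gamma> 0)"

definition fourier :: "(real^'d::finite \<Rightarrow> complex) \<Rightarrow> real^'d \<Rightarrow> complex" where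
  "fourier \<gamma> x = of_real ((2 * pi) powr (- (real CARD('d) / 2))) *
     (LINT y|lebesgue. \<gamma> y * exp (- \<i> * of_real (x \<bullet> y)))"

definition fourier_distr :: "'d::finite distribution \<Rightarrow> 'd distribution" where
  "fourier_distr T = (\<lambda>\<gamma>\<in>schwartz. T (fourier \<gamma>))"

subsection \<open>Distributional operators\<close>

type_synonym 'd distr_operator = "'d distribution \<Rightarrow> 'd distribution"

definition linear_distr_operator :: "'d::finite distr_operator \<Rightarrow> bool" where
  "linear_distr_operator P \<longleftrightarrow> P \<in> tempered \<rightarrow> tempered \<and>
     (\<forall>a b. \<forall>T\<in>tempered. \<forall>U\<in>tempered.
        P (\<lambda>\<gamma>\<in>schwartz. a * T \<gamma> + b * U \<gamma>) = (\<lambda>\<gamma>\<in>schwartz. a * P T \<gamma> + b * P U \<gamma>))"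

text \<open>
  The restriction \<open>P|\<^sub>S\<close>: \<open>distr_of\<close> is injective on \<open>schwartz\<close>, so if \<open>P\<close> maps the distribution of
  \<open>\<gamma>\<close> to the distribution of a Schwartz function, then that function is \<open>restrict_schwartz P \<gamma>\<close>.
\<close>
definition restrict_schwartz ::
    "'d::finite distr_operator \<Rightarrow> (real^'d \<Rightarrow> complex) \<Rightarrow> real^'d \<Rightarrow> complex" where
  "restrict_schwartz P \<gamma> = inv_into schwartz distr_of (P (distr_of \<gamma>))"

definition continuous_on_schwartz :: "'d::finite distr_operator \<Rightarrow> bool" where
  "continuous_on_schwartz P \<longleftrightarrow>
     (\<forall>\<gamma>\<in>schwartz. P (distr_of \<gamma>) \<in> distr_of ` schwartz) \<and>
     continuous_map schwartz_topology schwartz_topology (restrict_schwartz P)"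

text \<open>\<open>P\<close> is a distributional operator with adjoint \<open>P'\<close>.\<close>
definition distributional_operator ::
    "'d::finite distr_operator \<Rightarrow> 'd distr_operator \<Rightarrow> bool" where
  "distributional_operator P P' \<longleftrightarrow>
     linear_distr_operator P \<and> linear_distr_operator P' \<and>
     continuous_on_schwartz P \<and> continuous_on_schwartz P' \<and>
     (\<forall>T\<in>tempered. \<forall>\<gamma>\<in>schwartz.
        P T \<gamma> = T (restrict_schwartz P' \<gamma>) \<and> P' T \<gamma> = T (restrict_schwartz P \<gamma>))"

definition complex_adjoint_invariant :: "'d::finite distr_operator \<Rightarrow> bool" where
  "complex_adjoint_invariant P \<longleftrightarrow>
     (\<forall>\<gamma>\<in>schwartz. (\<lambda>x. cnj (restrict_schwartz P \<gamma> x)) = restrict_schwartz P (\<lambda>x. cnj (\<gamma> x)))"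

definition has_distr_fourier ::
    "'d::finite distr_operator \<Rightarrow> (real^'d \<Rightarrow> complex) \<Rightarrow> bool" where
  "has_distr_fourier P p \<longleftrightarrow> p \<in> FT \<and>
     (\<forall>T\<in>tempered. \<forall>\<gamma>\<in>schwartz.
        fourier_distr (P T) \<gamma> = fourier_distr T (\<lambda>x. p x * \<gamma> x))"

text \<open>The first argument is the vector of adjoints of the second.\<close>
definition normal_operator ::
    "('n::finite \<Rightarrow> 'd::finite distr_operator) \<Rightarrow> ('n \<Rightarrow> 'd distr_operator) \<Rightarrow> 'd distr_operator"
  where
  "normal_operator P' P T = (\<lambda>\<gamma>\<in>schwartz. \<Sum>j\<in>UNIV. P' j (P j T) \<gamma>)"

definition green_function :: "'d::finite distr_operator \<Rightarrow> 'd distribution \<Rightarrow> bool" where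
  "green_function L T \<longleftrightarrow> T \<in> tempered \<and> L T = dirac"

subsection \<open>Generalized Sobolev space\<close>

text \<open>
  The members are real functions, not classes; the set is closed under almost everywhere
  equality.
\<close>
definition sobolev_space ::
    "('n::finite \<Rightarrow> 'd::finite distr_operator) \<Rightarrow> (real^'d \<Rightarrow> real) set" where
  "sobolev_space P = {f \<in> L1loc \<inter> SI.
     \<forall>j. \<exists>h\<in>L2. P j (distr_of (\<lambda>x. of_real (f x))) = distr_of h}"

text \<open>A square-integrable function representing \<open>T\<close>; it is unique up to null sets.\<close>
definition L2_representative :: "'d::finite distribution \<Rightarrow> real^'d \<Rightarrow> complex" where
  "L2_representative T = (SOME h. h \<in> L2 \<and> T = distr_of h)"

definition sobolev_inner ::
    "('n::finite \<Rightarrow> 'd::finite distr_operator) \<Rightarrow> (real^'d \<Rightarrow> real) \<Rightarrow> (real^'d \<Rightarrow> real) \<Rightarrow> complex"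
  where
  "sobolev_inner P f g = (\<Sum>j\<in>UNIV. LINT x|lebesgue.
     L2_representative (P j (distr_of (\<lambda>y. of_real (f y)))) x *
     cnj (L2_representative (P j (distr_of (\<lambda>y. of_real (g y)))) x))"

subsection \<open>Conditional positive definiteness\<close>

text \<open>Real polynomials of degree less than \<open>m\<close>, i.e. at most \<open>m - 1\<close>; for \<open>m = 0\<close> only \<open>0\<close>.\<close>
definition poly_space :: "nat \<Rightarrow> (real^'d::finite \<Rightarrow> real) set" where
  "poly_space m =
     {p. \<exists>c. p = (\<lambda>x. \<Sum>\<alpha> | (\<Sum>i\<in>UNIV. \<alpha> i) < m. c \<alpha> * monomial \<alpha> x)}"

text \<open>Pairwise distinct points \<open>x\<^sub>1, \<dots>, x\<^sub>N\<close> are given as a finite set \<open>X\<close>, and coefficients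
  as a function on the points.\<close>
definition annihilates :: "nat \<Rightarrow> (real^'d::finite) set \<Rightarrow> (real^'d \<Rightarrow> real) \<Rightarrow> bool" where
  "annihilates m X c \<longleftrightarrow> (\<forall>p\<in>poly_space m. (\<Sum>x\<in>X. c x * p x) = 0)"

definition cond_pos_def :: "nat \<Rightarrow> (real^'d::finite \<Rightarrow> real) \<Rightarrow> bool" where
  "cond_pos_def m \<Phi> \<longleftrightarrow> continuous_on UNIV \<Phi> \<and> (\<forall>x. \<Phi> (- x) = \<Phi> x) \<and>
     (\<forall>X c. finite X \<and> (\<exists>x\<in>X. c x \<noteq> 0) \<and> annihilates m X c \<longrightarrow>
        (\<Sum>x\<in>X. \<Sum>y\<in>X. c x * c y * \<Phi> (x - y)) > 0)"

abbreviation pos_def :: "(real^'d::finite \<Rightarrow> real) \<Rightarrow> bool" where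
  "pos_def \<Phi> \<equiv> cond_pos_def 0 \<Phi>"

subsection \<open>Completion of a pre-Hilbert space\<close>

text \<open>
  The completion of a real inner product space with carrier \<open>V\<close> and inner product \<open>ip\<close>, as the
  set of Cauchy sequences modulo null sequences.
\<close>
definition cauchy_seqs :: "'v::minus set \<Rightarrow> ('v \<Rightarrow> 'v \<Rightarrow> real) \<Rightarrow> (nat \<Rightarrow> 'v) set" where
  "cauchy_seqs V ip = {u. (\<forall>n. u n \<in> V) \<and>
     (\<forall>e>0. \<exists>M. \<forall>k\<ge>M. \<forall>l\<ge>M. sqrt (ip (u k - u l) (u k - u l)) < e)}"

definition null_rel :: "'v::minus set \<Rightarrow> ('v \<Rightarrow> 'v \<Rightarrow> real) \<Rightarrow> ((nat \<Rightarrow> 'v) \<times> (nat \<Rightarrow> 'v)) set" where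
  "null_rel V ip = {(u, v). u \<in> cauchy_seqs V ip \<and> v \<in> cauchy_seqs V ip \<and>
     (\<lambda>n. sqrt (ip (u n - v n) (u n - v n))) \<longlonglongrightarrow> 0}"

definition completion :: "'v::minus set \<Rightarrow> ('v \<Rightarrow> 'v \<Rightarrow> real) \<Rightarrow> (nat \<Rightarrow> 'v) set set" where
  "completion V ip = cauchy_seqs V ip // null_rel V ip"

definition to_completion :: "'v::minus set \<Rightarrow> ('v \<Rightarrow> 'v \<Rightarrow> real) \<Rightarrow> 'v \<Rightarrow> (nat \<Rightarrow> 'v) set" where
  "to_completion V ip v = null_rel V ip `` {\<lambda>n. v}"

definition completion_inner ::
    "('v \<Rightarrow> 'v \<Rightarrow> real) \<Rightarrow> (nat \<Rightarrow> 'v) set \<Rightarrow> (nat \<Rightarrow> 'v) set \<Rightarrow> real" where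
  "completion_inner ip A B = (THE l. \<exists>u\<in>A. \<exists>v\<in>B. (\<lambda>n. ip (u n) (v n)) \<longlonglongrightarrow> l)"

subsection \<open>Native space\<close>

definition kernel_comb ::
    "(real^'d::finite \<Rightarrow> real) \<Rightarrow> (real^'d) set \<Rightarrow> (real^'d \<Rightarrow> real) \<Rightarrow> real^'d \<Rightarrow> real" where
  "kernel_comb \<Phi> X c = (\<lambda>y. \<Sum>x\<in>X. c x * \<Phi> (y - x))"

definition kernel_space :: "nat \<Rightarrow> (real^'d::finite \<Rightarrow> real) \<Rightarrow> (real^'d \<Rightarrow> real) set" where
  "kernel_space m \<Phi> = {kernel_comb \<Phi> X c | X c. finite X \<and> annihilates m X c}"

text \<open>
  For even \<open>\<Phi>\<close> the value does not depend on the representations of \<open>f\<close> and \<open>g\<close>, so that the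
  description is proper on \<open>kernel_space m \<Phi>\<close>.
\<close>
definition kernel_inner ::
    "nat \<Rightarrow> (real^'d::finite \<Rightarrow> real) \<Rightarrow> (real^'d \<Rightarrow> real) \<Rightarrow> (real^'d \<Rightarrow> real) \<Rightarrow> real" where
  "kernel_inner m \<Phi> f g = (THE r. \<exists>X a Y b.
     finite X \<and> annihilates m X a \<and> f = kernel_comb \<Phi> X a \<and>
     finite Y \<and> annihilates m Y b \<and> g = kernel_comb \<Phi> Y b \<and>
     r = (\<Sum>x\<in>X. \<Sum>y\<in>Y. a x * b y * \<Phi> (x - y)))"

text \<open>
  Unisolvent sets with exactly \<open>Q\<close> points, where \<open>Q\<close>, the dimension of \<open>poly_space m\<close>, is the
  number of monomials of degree less than \<open>m\<close>.
\<close>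
definition unisolvent :: "nat \<Rightarrow> (real^'d::finite) set \<Rightarrow> bool" where
  "unisolvent m \<Xi> \<longleftrightarrow> finite \<Xi> \<and>
     card \<Xi> = card {\<alpha> :: 'd \<Rightarrow> nat. (\<Sum>i\<in>UNIV. \<alpha> i) < m} \<and>
     (\<forall>p\<in>poly_space m. (\<forall>\<xi>\<in>\<Xi>. p \<xi> = 0) \<longrightarrow> p = (\<lambda>x. 0))"

definition lagrange :: "nat \<Rightarrow> (real^'d::finite) set \<Rightarrow> real^'d \<Rightarrow> real^'d \<Rightarrow> real" where
  "lagrange m \<Xi> \<xi> =
     (THE q. q \<in> poly_space m \<and> (\<forall>\<eta>\<in>\<Xi>. q \<eta> = (if \<eta> = \<xi> then 1 else 0)))"

definition interpolant ::
    "nat \<Rightarrow> (real^'d::finite) set \<Rightarrow> (real^'d \<Rightarrow> real) \<Rightarrow> real^'d \<Rightarrow> real" where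
  "interpolant m \<Xi> f = (\<lambda>x. \<Sum>\<xi>\<in>\<Xi>. f \<xi> * lagrange m \<Xi> \<xi> x)"

abbreviation kernel_completion ::
    "nat \<Rightarrow> (real^'d::finite \<Rightarrow> real) \<Rightarrow> (nat \<Rightarrow> real^'d \<Rightarrow> real) set set" where
  "kernel_completion m \<Phi> \<equiv> completion (kernel_space m \<Phi>) (kernel_inner m \<Phi>)"

definition native_map ::
    "nat \<Rightarrow> (real^'d::finite \<Rightarrow> real) \<Rightarrow> (real^'d) set \<Rightarrow> (nat \<Rightarrow> real^'d \<Rightarrow> real) set \<Rightarrow>
     real^'d \<Rightarrow> real" where
  "native_map m \<Phi> \<Xi> A = (\<lambda>x. completion_inner (kernel_inner m \<Phi>) A
     (to_completion (kernel_space m \<Phi>) (kernel_inner m \<Phi>)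
        (\<lambda>y. \<Phi> (y - x) - (\<Sum>\<xi>\<in>\<Xi>. lagrange m \<Xi> \<xi> x * \<Phi> (y - \<xi>)))))"

definition native_space ::
    "nat \<Rightarrow> (real^'d::finite \<Rightarrow> real) \<Rightarrow> (real^'d) set \<Rightarrow> (real^'d \<Rightarrow> real) set" where
  "native_space m \<Phi> \<Xi> =
     {(\<lambda>x. p x + native_map m \<Phi> \<Xi> A x) | p A. p \<in> poly_space m \<and> A \<in> kernel_completion m \<Phi>}"

definition native_inner ::
    "nat \<Rightarrow> (real^'d::finite \<Rightarrow> real) \<Rightarrow> (real^'d) set \<Rightarrow>
     (real^'d \<Rightarrow> real) \<Rightarrow> (real^'d \<Rightarrow> real) \<Rightarrow> real" where
  "native_inner m \<Phi> \<Xi> f g =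
     (let R_inv = inv_into (kernel_completion m \<Phi>) (native_map m \<Phi> \<Xi>)
      in completion_inner (kernel_inner m \<Phi>)
           (R_inv (f - interpolant m \<Xi> f)) (R_inv (g - interpolant m \<Xi> g)))"

definition ae_saturation :: "(real^'d::finite \<Rightarrow> real) set \<Rightarrow> (real^'d \<Rightarrow> real) set" where
  "ae_saturation A = {f. \<exists>g\<in>A. AE x in lebesgue. f x = g x}"

end

theory Submission
  imports Defs "HOL-Probability.Characteristic_Functions" "HOL-Probability.Sinc_Integral"
    "HOL-Real_Asymp.Real_Asymp"
begin

text \<open>
  On the Fourier side \<open>P\<^sub>j\<close> is multiplication by \<open>p\<^sub>j\<close>, and complex-adjoint invariance makes
  \<open>P\<^sub>j*\<close> multiplication by the conjugate of \<open>p\<^sub>j\<close>.  If \<open>m > 0\<close>, then \<open>p(0) = 0\<close>, so every \<open>P\<^sub>j\<close>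
  annihilates the constant \<open>1\<close>, which would have to be square-integrable; hence \<open>m = 0\<close> and \<open>p\<close> has no
  zeros.  Put \<open>q = 1 / norm p\<close>.  The Green function equation says that the Fourier transform of
  \<open>G\<close> is a constant multiple of \<open>q\<^sup>2\<close>; testing it on Gaussians shows that \<open>q\<^sup>2\<close> is integrable and
  that \<open>G(x - z)\<close> is the \<open>L\<^sup>2\<close> inner product of \<open>E\<^sub>x\<close> and \<open>E\<^sub>z\<close>, where \<open>E\<^sub>x(y)\<close> is a constant multiple
  of \<open>q(y) exp(-i x y)\<close>.  Thus an element of the completed kernel space is an \<open>L\<^sup>2\<close> limit \<open>\<Phi>\<close> of
  combinations of the \<open>E\<^sub>x\<close>, and the function it induces is the inverse Fourier transform of
  \<open>q \<Phi>\<close>.  By Plancherel, the functions of this form with \<open>\<Phi>\<close> in \<open>L\<^sup>2\<close> are exactly the members of the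
  Sobolev space, and projecting \<open>\<Phi>\<close> onto the closed span of the \<open>E\<^sub>x\<close> does not change the function.
\<close>

subsection \<open>Calculus of smooth functions\<close>

text \<open>Equality of the semi-inner products rests on the identity that the sum over j of |p_j
  q|^2 is 1: it makes Phi -> (p_j q Phi)_j an isometry into the n-fold L2 space, so both products
  equal the L2 inner product of the same functions Phi. Only q^2, the reciprocal of the sum of p_j
  cnj p_j, is used as a smooth multiplier of test functions; q itself enters as a continuous
  square-integrable function. Before q^2 is known to be integrable, G cannot be written as a Fourier
  integral, and characters are not Schwartz functions. Characters damped by a Gaussian replace them:
  their transforms concentrate at one point, where the continuity of G takes over. Each E_x carries
  one factor (2 pi)^(-d/2), since the Green equation contributes one such factor and the mass of the
  concentrating Gaussian another. Kernel combinations have real coefficients, so the projection goes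
  onto a real subspace and preserves only the real parts of the products with E_x; this suffices
  because members of the Sobolev space are real-valued.\<close>

definition has_partial ::
    "'d::finite \<Rightarrow> (real^'d \<Rightarrow> complex) \<Rightarrow> (real^'d \<Rightarrow> complex) \<Rightarrow> bool" where
  "has_partial i f f' \<longleftrightarrow>
     (\<forall>x. ((\<lambda>t. f (x + t *\<^sub>R axis i 1)) has_vector_derivative f' x) (at 0))"

text \<open>\<open>partial_derivative\<close> is total and has a junk value where the derivative
  fails to exist. \<open>has_partial\<close> carries existence along with the value, so the calculus
  rules below need no separate differentiability premises.\<close>

lemma has_partial_imp_partial_derivative:
  "has_partial i f f' \<Longrightarrow> partial_derivative i f = f'"
  by (auto simp: has_partial_def partial_derivative_def fun_eq_iff intro!: vector_derivative_at)

lemma has_partialI: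
  assumes "\<And>x. ((\<lambda>t. f (x + t *\<^sub>R axis i 1)) has_vector_derivative f' x) (at 0)"
  shows "has_partial i f f'"
  using assms by (simp add: has_partial_def)

text \<open>The definition speaks of the parameter 0 only; translating the base point along the line
  reaches every parameter, as differentiation under the integral sign requires.\<close>

lemma has_partial_at:
  assumes "has_partial i f f'"
  shows "((\<lambda>t. f (x + t *\<^sub>R axis i 1)) has_vector_derivative f' (x + s *\<^sub>R axis i 1)) (at s)"
proof -
  have "((\<lambda>t. f ((x + s *\<^sub>R axis i 1) + t *\<^sub>R axis i 1)) has_vector_derivative
      f' (x + s *\<^sub>R axis i 1)) (at (s - s))"
    using assms by (simp add: has_partial_def)
  moreover have "((\<lambda>t. t - s) has_real_derivative 1) (at s)"
    by (auto intro!: derivative_eq_intros)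
  ultimately have "(((\<lambda>t. f ((x + s *\<^sub>R axis i 1) + t *\<^sub>R axis i 1)) \<circ> (\<lambda>t. t - s))
      has_vector_derivative 1 *\<^sub>R f' (x + s *\<^sub>R axis i 1)) (at s)"
    by (intro vector_diff_chain_at) (auto simp: has_real_derivative_iff_has_vector_derivative)
  moreover have "((\<lambda>t. f ((x + s *\<^sub>R axis i 1) + t *\<^sub>R axis i 1)) \<circ> (\<lambda>t. t - s)) =
      (\<lambda>t. f (x + t *\<^sub>R axis i 1))"
    by (auto simp: fun_eq_iff algebra_simps)
  ultimately show ?thesis by simp
qed

lemma has_partial_add:
  "has_partial i f f' \<Longrightarrow> has_partial i g g' \<Longrightarrow> has_partial i (\<lambda>x. f x + g x) (\<lambda>x. f' x + g' x)"
  by (auto simp: has_partial_def intro!: has_vector_derivative_add)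

lemma has_partial_mult:
  assumes "has_partial i f f'" "has_partial i g g'"
  shows "has_partial i (\<lambda>x. f x * g x) (\<lambda>x. f x * g' x + f' x * g x)"
proof (rule has_partialI)
  fix x
  show "((\<lambda>t. f (x + t *\<^sub>R axis i 1) * g (x + t *\<^sub>R axis i 1)) has_vector_derivative
       f x * g' x + f' x * g x) (at 0)"
    using has_vector_derivative_mult[of "\<lambda>t. f (x + t *\<^sub>R axis i 1)" "f' x" 0 UNIV
        "\<lambda>t. g (x + t *\<^sub>R axis i 1)" "g' x"] assms
    by (simp add: has_partial_def)
qed

lemma has_partial_const: "has_partial i (\<lambda>x. c) (\<lambda>x. 0)"
  by (auto simp: has_partial_def)

lemma has_partial_chain:
  assumes "has_partial i f f'" "\<And>x. (h has_field_derivative h' (f x)) (at (f x))"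
  shows "has_partial i (\<lambda>x. h (f x)) (\<lambda>x. f' x * h' (f x))"
proof (rule has_partialI)
  fix x
  have "(h \<circ> (\<lambda>t. f (x + t *\<^sub>R axis i 1)) has_vector_derivative f' x * h' (f x)) (at 0)"
    using assms by (intro field_vector_diff_chain_at) (auto simp: has_partial_def)
  then show "((\<lambda>t. h (f (x + t *\<^sub>R axis i 1))) has_vector_derivative f' x * h' (f x)) (at 0)"
    by (simp add: o_def)
qed

lemma has_partial_coord:
  "has_partial i (\<lambda>x. complex_of_real (x $ j)) (\<lambda>x. of_bool (i = j))"
proof (rule has_partialI)
  fix x
  have "((\<lambda>t. x $ j + t * of_bool (i = j)) has_vector_derivative of_bool (i = j)) (at 0)"
    by (auto intro!: derivative_eq_intros simp flip: has_real_derivative_iff_has_vector_derivative)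
  then have "((\<lambda>t. complex_of_real (x $ j + t * of_bool (i = j))) has_vector_derivative
       complex_of_real (of_bool (i = j))) (at 0)"
    by (intro has_vector_derivative_of_real) (simp add: has_real_derivative_iff_has_vector_derivative)
  then show "((\<lambda>t. complex_of_real ((x + t *\<^sub>R axis i 1) $ j)) has_vector_derivative of_bool (i = j)) (at 0)"
    by (simp add: axis_def of_bool_def if_distrib cong: if_cong)
qed

lemma has_partial_cnj:
  "has_partial i f f' \<Longrightarrow> has_partial i (\<lambda>x. cnj (f x)) (\<lambda>x. cnj (f' x))"
  by (auto simp: has_partial_def intro!: has_vector_derivative_cnj)

lemma has_partial_reflect:
  assumes "has_partial i f f'"
  shows "has_partial i (\<lambda>x. f (- x)) (\<lambda>x. - f' (- x))"
proof (rule has_partialI)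
  fix x
  have "((uminus :: real \<Rightarrow> real) has_vector_derivative (-1)) (at 0)"
    by (auto intro!: derivative_eq_intros)
  then have "(((\<lambda>t. f (- x + t *\<^sub>R axis i 1)) \<circ> uminus) has_vector_derivative (-1) *\<^sub>R f' (- x)) (at 0)"
    using assms by (intro vector_diff_chain_at) (auto simp: has_partial_def simp del: add_uminus_conv_diff uminus_add_conv_diff)
  then show "((\<lambda>t. f (- (x + t *\<^sub>R axis i 1))) has_vector_derivative - f' (- x)) (at 0)"
    by (simp only: o_def scaleR_minus_left minus_add_distrib scaleR_one)
qed

lemma iterated_partial_append:
  "iterated_partial (is @ js) f = iterated_partial is (iterated_partial js f)"
  by (induction "is") auto

lemma iterated_partial_mem:
  assumes "\<And>f i. f \<in> A \<Longrightarrow> \<exists>f'\<in>A. has_partial i f f'" "f \<in> A"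
  shows "iterated_partial is f \<in> A"
proof (induction "is")
  case (Cons i "is")
  then obtain f' where "f' \<in> A" "has_partial i (iterated_partial is f) f'"
    using assms(1) by blast
  then show ?case by (simp add: has_partial_imp_partial_derivative)
qed (use assms(2) in auto)

text \<open>A class stable under first partials contains all iterated partials of its members, by
  induction on the list of coordinates. Smoothness thus reduces to finding a stable class of
  continuous functions, and no derivative of higher order is ever computed.\<close>

lemma smooth_coinduct:
  assumes "\<And>f i. f \<in> A \<Longrightarrow> \<exists>f'\<in>A. has_partial i f f'"
    and "\<And>f. f \<in> A \<Longrightarrow> continuous_on UNIV f" and "f \<in> A"
  shows "smooth f"
  unfolding smooth_def
proof (intro allI conjI)
  fix "is" i x
  have *: "iterated_partial is f \<in> A"
    using assms by (intro iterated_partial_mem) auto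
  then show "continuous_on UNIV (iterated_partial is f)"
    using assms(2) by blast
  obtain f' where "has_partial i (iterated_partial is f) f'"
    using assms(1) * by blast
  then show "(\<lambda>t. iterated_partial is f (x + t *\<^sub>R axis i 1)) differentiable at (0::real)"
    unfolding has_partial_def by (auto intro: differentiableI_vector)
qed

lemma smooth_imp_continuous: "smooth f \<Longrightarrow> continuous_on UNIV f"
  unfolding smooth_def by (metis iterated_partial.simps(1))

lemma smooth_has_partial: "smooth f \<Longrightarrow> has_partial i f (partial_derivative i f)"
  unfolding smooth_def has_partial_def partial_derivative_def
  by (metis iterated_partial.simps(1) vector_derivative_works)

lemma smooth_partial_derivative: "smooth f \<Longrightarrow> smooth (partial_derivative i f)"
  unfolding smooth_def
  by (metis iterated_partial_append iterated_partial.simps)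

subsection \<open>Polynomial growth and rapid decay\<close>

text \<open>Being at least 1 everywhere, this weight lets growth and decay be stated as global
  bounds, without a clause for large arguments and without trouble at the origin.\<close>

definition weight :: "real^'d::finite \<Rightarrow> real" where
  "weight x = 1 + (norm x)\<^sup>2"

lemma weight_ge_1 [simp]: "1 \<le> weight x" and weight_pos [simp]: "0 < weight x"
  and weight_nonneg [simp]: "0 \<le> weight x" and weight_nz [simp]: "weight x \<noteq> 0"
  unfolding weight_def by (auto simp: add_pos_nonneg add_nonneg_eq_0_iff)

lemma weight_power_ge_1 [simp]: "1 \<le> weight x ^ N"
  by (simp add: one_le_power)

lemma weight_uminus [simp]: "weight (- x) = weight x"
  by (simp add: weight_def)

lemma continuous_weight [continuous_intros]: "continuous_on A weight"
  unfolding weight_def by (intro continuous_intros)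

lemma norm_le_weight: "norm x \<le> weight x"
proof -
  have "2 * norm x \<le> (norm x)\<^sup>2 + 1"
    using zero_le_power2[of "norm x - 1"] by (simp add: power2_diff)
  then show ?thesis
    unfolding weight_def using norm_ge_zero[of x] by linarith
qed

lemma norm_power_le_weight: "norm x ^ k \<le> weight x ^ k"
  by (intro power_mono norm_le_weight) auto

lemma component_le_weight: "\<bar>x $ i\<bar> \<le> weight x"
  using component_le_norm_cart[of x i] norm_le_weight[of x] by linarith

definition poly_bounded :: "(real^'d::finite \<Rightarrow> 'b::real_normed_vector) \<Rightarrow> bool" where
  "poly_bounded f \<longleftrightarrow> (\<exists>N C. \<forall>x. norm (f x) \<le> C * weight x ^ N)"

definition rapid :: "(real^'d::finite \<Rightarrow> 'b::real_normed_vector) \<Rightarrow> bool" where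
  "rapid f \<longleftrightarrow> (\<forall>N. \<exists>C. \<forall>x. weight x ^ N * norm (f x) \<le> C)"

lemma poly_boundedE:
  assumes "poly_bounded f"
  obtains N C where "\<And>x. norm (f x) \<le> C * weight x ^ N" "0 \<le> C"
proof -
  obtain N C where *: "\<And>x. norm (f x) \<le> C * weight x ^ N"
    using assms unfolding poly_bounded_def by blast
  have "0 \<le> C"
    using order_trans[OF norm_ge_zero *[of 0]] by (simp add: weight_def)
  with * that show ?thesis by blast
qed

lemma poly_boundedI: "(\<And>x. norm (f x) \<le> C * weight x ^ N) \<Longrightarrow> poly_bounded f"
  unfolding poly_bounded_def by blast

lemma poly_bounded_const: "poly_bounded (\<lambda>x. c)"
  by (rule poly_boundedI[of _ "norm c" 0]) simp

lemma poly_bounded_add: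
  fixes f g :: "real^'d::finite \<Rightarrow> 'b::real_normed_vector"
  assumes "poly_bounded f" "poly_bounded g"
  shows "poly_bounded (\<lambda>x. f x + g x)"
proof -
  obtain N C where f: "\<And>x. norm (f x) \<le> C * weight x ^ N" "0 \<le> C"
    using assms(1) by (elim poly_boundedE) blast
  obtain M D where g: "\<And>x. norm (g x) \<le> D * weight x ^ M" "0 \<le> D"
    using assms(2) by (elim poly_boundedE) blast
  show ?thesis
  proof (rule poly_boundedI)
    fix x :: "real^'d"
    have "C * weight x ^ N \<le> C * weight x ^ (N + M)" "D * weight x ^ M \<le> D * weight x ^ (N + M)"
      using f g by (auto intro!: mult_left_mono power_increasing)
    then show "norm (f x + g x) \<le> (C + D) * weight x ^ (N + M)"
      using norm_triangle_ineq[of "f x" "g x"] f(1)[of x] g(1)[of x] by (simp add: algebra_simps)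
  qed
qed

lemma poly_bounded_mult:
  fixes f g :: "real^'d::finite \<Rightarrow> 'b::real_normed_algebra"
  assumes "poly_bounded f" "poly_bounded g"
  shows "poly_bounded (\<lambda>x. f x * g x)"
proof -
  obtain N C where f: "\<And>x. norm (f x) \<le> C * weight x ^ N" "0 \<le> C"
    using assms(1) by (elim poly_boundedE) blast
  obtain M D where g: "\<And>x. norm (g x) \<le> D * weight x ^ M" "0 \<le> D"
    using assms(2) by (elim poly_boundedE) blast
  show ?thesis
  proof (rule poly_boundedI)
    fix x
    have "norm (f x * g x) \<le> norm (f x) * norm (g x)"
      by (rule norm_mult_ineq)
    also have "\<dots> \<le> (C * weight x ^ N) * (D * weight x ^ M)"
      using f g by (intro mult_mono) auto
    finally show "norm (f x * g x) \<le> (C * D) * weight x ^ (N + M)"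
      by (simp add: power_add mult_ac)
  qed
qed

lemma rapid_add: "rapid f \<Longrightarrow> rapid g \<Longrightarrow> rapid (\<lambda>x. f x + g x)"
  unfolding rapid_def
proof
  fix N assume f: "\<forall>N. \<exists>C. \<forall>x. weight x ^ N * norm (f x) \<le> C"
    and g: "\<forall>N. \<exists>C. \<forall>x. weight x ^ N * norm (g x) \<le> C"
  obtain C D where C: "\<And>x. weight x ^ N * norm (f x) \<le> C" and D: "\<And>x. weight x ^ N * norm (g x) \<le> D"
    using f g by blast
  have "weight x ^ N * norm (f x + g x) \<le> C + D" for x
  proof -
    have "weight x ^ N * norm (f x + g x) \<le> weight x ^ N * (norm (f x) + norm (g x))"
      by (intro mult_left_mono norm_triangle_ineq) auto
    then show ?thesis using C[of x] D[of x] by (simp add: algebra_simps)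
  qed
  then show "\<exists>C. \<forall>x. weight x ^ N * norm (f x + g x) \<le> C" by blast
qed

lemma rapid_mult:
  fixes f g :: "real^'d::finite \<Rightarrow> 'b::real_normed_algebra"
  assumes "rapid f" "poly_bounded g"
  shows "rapid (\<lambda>x. f x * g x)"
  unfolding rapid_def
proof
  fix N
  obtain M D where g: "\<And>x. norm (g x) \<le> D * weight x ^ M" "0 \<le> D"
    using assms(2) by (elim poly_boundedE) blast
  obtain C where C: "\<And>x. weight x ^ (N + M) * norm (f x) \<le> C"
    using assms(1) unfolding rapid_def by blast
  have "weight x ^ N * norm (f x * g x) \<le> C * D" for x
  proof -
    have "weight x ^ N * norm (f x * g x) \<le> weight x ^ N * (norm (f x) * (D * weight x ^ M))"
      using g by (intro mult_left_mono order_trans[OF norm_mult_ineq]) auto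
    also have "\<dots> = (weight x ^ (N + M) * norm (f x)) * D" by (simp add: power_add)
    also have "\<dots> \<le> C * D" using C g by (intro mult_right_mono) auto
    finally show ?thesis .
  qed
  then show "\<exists>C. \<forall>x. weight x ^ N * norm (f x * g x) \<le> C" by blast
qed

lemma rapid_imp_poly_bounded: "rapid f \<Longrightarrow> poly_bounded f"
  unfolding rapid_def poly_bounded_def by (metis mult.right_neutral mult_1 power_0)

text \<open>Membership in \<open>SI\<close> gives a bound almost everywhere outside a ball. By
  continuity the set where the bound holds is closed, and a closed set containing almost every point
  of the open exterior contains all of it. Inside the ball, compactness gives a constant
  bound.\<close>

lemma SI_imp_poly_bounded:
  fixes f :: "real^'d::finite \<Rightarrow> 'b::real_normed_vector"
  assumes "f \<in> SI" "continuous_on UNIV f"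
  shows "poly_bounded f"
proof -
  obtain k C R where ae: "AE x in lebesgue. R \<le> norm x \<longrightarrow> norm (f x) \<le> C * norm x ^ k"
    using assms(1) unfolding SI_def by blast
  define K where "K = {x. norm (f x) \<le> \<bar>C\<bar> * weight x ^ k}"
  define S where "S = {x::real^'d. R < norm x}"
  have "closed K" unfolding K_def
    using assms(2) by (intro closed_Collect_le continuous_intros) auto
  have "open S" unfolding S_def by (intro open_Collect_less continuous_intros)
  have "AE x\<in>S in lebesgue. x \<in> K"
    using ae
  proof eventually_elim
    case (elim x)
    show ?case
    proof
      assume "x \<in> S"
      then have "norm (f x) \<le> C * norm x ^ k" using elim by (simp add: S_def)
      also have "\<dots> \<le> \<bar>C\<bar> * weight x ^ k"
        by (intro mult_mono norm_power_le_weight) auto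
      finally show "x \<in> K" by (simp add: K_def)
    qed
  qed
  then have out: "x \<in> K" if "x \<in> S" for x
    using mem_closed_if_AE_lebesgue_open \<open>open S\<close> \<open>closed K\<close> that by blast
  have "compact (f ` cball 0 R)"
    using assms(2) by (intro compact_continuous_image) (auto intro: continuous_on_subset)
  then obtain B where B: "\<And>x. x \<in> cball 0 R \<Longrightarrow> norm (f x) \<le> B"
    by (meson bounded_iff compact_imp_bounded imageI)
  show ?thesis
  proof (rule poly_boundedI)
    fix x
    show "norm (f x) \<le> (\<bar>B\<bar> + \<bar>C\<bar>) * weight x ^ k"
    proof (cases "x \<in> S")
      case True
      then show ?thesis using out[OF True] unfolding K_def
        by (simp add: algebra_simps add_increasing)
    next
      case False
      then have "norm (f x) \<le> \<bar>B\<bar> * 1" using B[of x] by (auto simp: S_def)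
      also have "\<dots> \<le> (\<bar>B\<bar> + \<bar>C\<bar>) * weight x ^ k"
        by (intro mult_mono) auto
      finally show ?thesis .
    qed
  qed
qed

lemma poly_bounded_imp_SI:
  fixes f :: "real^'d::finite \<Rightarrow> 'b::real_normed_vector"
  assumes "poly_bounded f"
  shows "f \<in> SI"
proof -
  obtain N C where f: "\<And>x. norm (f x) \<le> C * weight x ^ N" "0 \<le> C"
    using assms(1) by (elim poly_boundedE) blast
  have "norm (f x) \<le> (C * 2 ^ N) * norm x ^ (2 * N)" if "1 \<le> norm x" for x
  proof -
    have "weight x \<le> 2 * (norm x)\<^sup>2"
      using that by (simp add: weight_def)
    then have "weight x ^ N \<le> (2 * (norm x)\<^sup>2) ^ N"
      by (intro power_mono) auto
    then have "C * weight x ^ N \<le> C * (2 * (norm x)\<^sup>2) ^ N"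
      using f by (intro mult_left_mono) auto
    then show ?thesis
      using f(1)[of x] by (simp add: power_mult_distrib power_mult)
  qed
  then have "AE x in lebesgue. 1 \<le> norm x \<longrightarrow> norm (f x) \<le> (C * 2 ^ N) * norm x ^ (2 * N)"
    by auto
  then show ?thesis unfolding SI_def by blast
qed

section \<open>Monomials, weights and the seminorms of the Schwartz space\<close>

lemma FT_iff:
  "f \<in> FT \<longleftrightarrow> smooth f \<and> (\<forall>is. poly_bounded (iterated_partial is f))"
  unfolding FT_def mem_Collect_eq using SI_imp_poly_bounded poly_bounded_imp_SI
  by (metis smooth_def)

lemma monomial_le_weight: "\<bar>monomial \<beta> x\<bar> \<le> weight x ^ (\<Sum>i\<in>UNIV. \<beta> i)"
proof -
  have "\<bar>monomial \<beta> x\<bar> = (\<Prod>i\<in>UNIV. \<bar>x $ i\<bar> ^ \<beta> i)"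
    by (simp add: monomial_def abs_prod power_abs)
  also have "\<dots> \<le> (\<Prod>i\<in>UNIV. weight x ^ \<beta> i)"
    by (intro prod_mono conjI power_mono component_le_weight) auto
  finally show ?thesis by (simp add: power_sum)
qed

lemma monomial_upd:
  "monomial (\<beta>(i := \<beta> i + k)) x = x $ i ^ k * monomial \<beta> x"
proof -
  have "monomial (\<beta>(i := \<beta> i + k)) x = x $ i ^ (\<beta> i + k) * (\<Prod>j\<in>UNIV - {i}. x $ j ^ \<beta> j)"
    unfolding monomial_def by (subst prod.remove[of _ i]) (auto intro!: prod.cong)
  also have "\<dots> = x $ i ^ k * (x $ i ^ \<beta> i * (\<Prod>j\<in>UNIV - {i}. x $ j ^ \<beta> j))"
    by (simp add: power_add)
  also have "x $ i ^ \<beta> i * (\<Prod>j\<in>UNIV - {i}. x $ j ^ \<beta> j) = monomial \<beta> x"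
    using prod.remove[of UNIV i "\<lambda>j. x $ j ^ \<beta> j"] by (simp add: monomial_def)
  finally show ?thesis .
qed

text \<open>One factor \<open>weight x\<close> turns a monomial into itself plus the monomials with
  one exponent raised by 2, whence the induction on \<open>N\<close>. A list rather than a set of
  multi-indices keeps repetitions.\<close>

lemma weight_monomials:
  fixes \<beta> :: "'a::finite \<Rightarrow> nat"
  shows "\<exists>L. \<forall>x. weight x ^ N * \<bar>monomial \<beta> x\<bar> \<le> (\<Sum>\<beta>'\<leftarrow>L. \<bar>monomial \<beta>' x\<bar>)"
proof (induction N arbitrary: \<beta>)
  case 0
  show ?case by (intro exI[of _ "[\<beta>]"]) simp
next
  case (Suc N)
  define up where "up i = \<beta>(i := \<beta> i + 2)" for i
  have "\<forall>\<beta>. \<exists>L. \<forall>x::real^'a. weight x ^ N * \<bar>monomial \<beta> x\<bar> \<le> (\<Sum>\<beta>'\<leftarrow>L. \<bar>monomial \<beta>' x\<bar>)"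
    using Suc.IH by blast
  from choice[OF this] obtain L where L: "\<And>\<beta> (x::real^'a). weight x ^ N * \<bar>monomial \<beta> x\<bar> \<le> (\<Sum>\<beta>'\<leftarrow>L \<beta>. \<bar>monomial \<beta>' x\<bar>)"
    by blast
  obtain us :: "'a list" where us: "set us = UNIV" "distinct us"
    using finite_distinct_list[OF finite[of UNIV]] by blast
  have "weight x ^ Suc N * \<bar>monomial \<beta> x\<bar> \<le>
      (\<Sum>\<beta>'\<leftarrow>L \<beta> @ concat (map (\<lambda>i. L (up i)) us). \<bar>monomial \<beta>' x\<bar>)" for x :: "real^'a"
  proof -
    have "(norm x)\<^sup>2 = (\<Sum>i\<in>UNIV. (x $ i)\<^sup>2)"
      by (simp add: norm_vec_def L2_set_def sum_nonneg)
    moreover have "\<bar>monomial (up i) x\<bar> = (x $ i)\<^sup>2 * \<bar>monomial \<beta> x\<bar>" for i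
      by (simp only: up_def monomial_upd abs_mult abs_power2)
    ultimately have "weight x * \<bar>monomial \<beta> x\<bar> = \<bar>monomial \<beta> x\<bar> + (\<Sum>i\<in>UNIV. \<bar>monomial (up i) x\<bar>)"
      by (simp add: weight_def distrib_right sum_distrib_right)
    then have "weight x ^ Suc N * \<bar>monomial \<beta> x\<bar> =
        weight x ^ N * \<bar>monomial \<beta> x\<bar> + (\<Sum>i\<in>UNIV. weight x ^ N * \<bar>monomial (up i) x\<bar>)"
      by (simp only: power_Suc2 mult.assoc distrib_left sum_distrib_left)
    also have "\<dots> \<le> (\<Sum>\<beta>'\<leftarrow>L \<beta>. \<bar>monomial \<beta>' x\<bar>) + (\<Sum>i\<in>UNIV. (\<Sum>\<beta>'\<leftarrow>L (up i). \<bar>monomial \<beta>' x\<bar>))"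
      by (intro add_mono sum_mono L)
    also have "(\<Sum>i\<in>UNIV. (\<Sum>\<beta>'\<leftarrow>L (up i). \<bar>monomial \<beta>' x\<bar>)) =
        (\<Sum>i\<leftarrow>us. (\<Sum>\<beta>'\<leftarrow>L (up i). \<bar>monomial \<beta>' x\<bar>))"
      using us by (simp add: sum_list_distinct_conv_sum_set)
    also have "\<dots> = (\<Sum>\<beta>'\<leftarrow>concat (map (\<lambda>i. L (up i)) us). \<bar>monomial \<beta>' x\<bar>)"
      by (induction us) auto
    finally show ?thesis by simp
  qed
  then show ?case by blast
qed

lemma schwartz_bounded:
  "f \<in> schwartz \<Longrightarrow> bounded (range (\<lambda>x. monomial \<beta> x *\<^sub>R iterated_partial is f x))"
  unfolding schwartz_def by blast

lemma schwartz_seminorm_bound: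
  assumes "f \<in> schwartz"
  shows "\<bar>monomial \<beta> x\<bar> * norm (iterated_partial is f x) \<le> schwartz_seminorm \<beta> is f"
proof -
  have "bdd_above (range (\<lambda>x. norm (monomial \<beta> x *\<^sub>R iterated_partial is f x)))"
    using schwartz_bounded[OF assms, of \<beta> "is"] by (auto simp: bounded_iff bdd_above_def)
  then have "norm (monomial \<beta> x *\<^sub>R iterated_partial is f x) \<le> schwartz_seminorm \<beta> is f"
    unfolding schwartz_seminorm_def by (rule cSUP_upper[rotated]) simp
  then show ?thesis by simp
qed

text \<open>The list \<open>L\<close> does not depend on \<open>f\<close>. This uniformity is what
  later makes integration against a function a continuous functional on the Schwartz space.\<close>

lemma schwartz_weight_bound:
  "\<exists>L. \<forall>f\<in>schwartz. \<forall>x. weight x ^ N * norm (iterated_partial is f x) \<le>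
     (\<Sum>\<beta>\<leftarrow>L. schwartz_seminorm \<beta> is f)"
proof -
  obtain L where L: "\<And>x::real^'a. weight x ^ N * \<bar>monomial (\<lambda>_. 0) x\<bar> \<le> (\<Sum>\<beta>'\<leftarrow>L. \<bar>monomial \<beta>' x\<bar>)"
    using weight_monomials by blast
  have "weight x ^ N * norm (iterated_partial is f x) \<le> (\<Sum>\<beta>\<leftarrow>L. schwartz_seminorm \<beta> is f)"
    if f: "f \<in> schwartz" for f and x :: "real^'a"
  proof -
    have "weight x ^ N * norm (iterated_partial is f x) \<le>
        (\<Sum>\<beta>'\<leftarrow>L. \<bar>monomial \<beta>' x\<bar>) * norm (iterated_partial is f x)"
      using L[of x] by (intro mult_right_mono) (auto simp: monomial_def)
    also have "\<dots> = (\<Sum>\<beta>'\<leftarrow>L. \<bar>monomial \<beta>' x\<bar> * norm (iterated_partial is f x))"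
      by (simp add: sum_list_mult_const)
    also have "\<dots> \<le> (\<Sum>\<beta>\<leftarrow>L. schwartz_seminorm \<beta> is f)"
      by (intro sum_list_mono schwartz_seminorm_bound f)
    finally show ?thesis .
  qed
  then show ?thesis by blast
qed

lemma schwartz_iff:
  "f \<in> schwartz \<longleftrightarrow> smooth f \<and> (\<forall>is. rapid (iterated_partial is f))"
proof safe
  assume f: "f \<in> schwartz"
  then show "smooth f" by (simp add: schwartz_def)
  show "rapid (iterated_partial is f)" for "is"
    unfolding rapid_def using schwartz_weight_bound[of _ "is"] f by meson
next
  assume f: "smooth f" "\<forall>is. rapid (iterated_partial is f)"
  have "bounded (range (\<lambda>x. monomial \<beta> x *\<^sub>R iterated_partial is f x))" for \<beta> "is"
  proof -
    obtain C where C: "\<And>x. weight x ^ (\<Sum>i\<in>UNIV. \<beta> i) * norm (iterated_partial is f x) \<le> C"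
      using f(2) unfolding rapid_def by blast
    have "norm (monomial \<beta> x *\<^sub>R iterated_partial is f x) \<le> C" for x
      using mult_right_mono[OF monomial_le_weight norm_ge_zero] C[of x]
      by (auto intro: order_trans)
    then show ?thesis by (auto simp: bounded_iff)
  qed
  with f(1) show "f \<in> schwartz" by (simp add: schwartz_def)
qed

section \<open>Closure properties of \<open>FT\<close> and of the Schwartz space\<close>

lemma FT_coinduct:
  assumes "\<And>f i. f \<in> A \<Longrightarrow> \<exists>f'\<in>A. has_partial i f f'"
    and "\<And>f. f \<in> A \<Longrightarrow> continuous_on UNIV f" and "\<And>f. f \<in> A \<Longrightarrow> poly_bounded f"
  shows "A \<subseteq> FT"
  using iterated_partial_mem[of A, OF assms(1)] smooth_coinduct[of A, OF assms(1,2)] assms(3)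
  by (auto simp: FT_iff)

lemma schwartz_coinduct:
  assumes "\<And>f i. f \<in> A \<Longrightarrow> \<exists>f'\<in>A. has_partial i f f'"
    and "\<And>f. f \<in> A \<Longrightarrow> continuous_on UNIV f" and "\<And>f. f \<in> A \<Longrightarrow> rapid f"
  shows "A \<subseteq> schwartz"
  using iterated_partial_mem[of A, OF assms(1)] smooth_coinduct[of A, OF assms(1,2)] assms(3)
  by (auto simp: schwartz_iff)

lemma FT_continuous: "f \<in> FT \<Longrightarrow> continuous_on UNIV f"
  by (simp add: FT_iff smooth_imp_continuous)

lemma FT_poly_bounded: "f \<in> FT \<Longrightarrow> poly_bounded f"
  unfolding FT_iff by (metis iterated_partial.simps(1))

lemma FT_partial: "f \<in> FT \<Longrightarrow> partial_derivative i f \<in> FT"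
  unfolding FT_iff using iterated_partial_append[of _ "[i]" f]
  by (simp add: smooth_partial_derivative) metis

lemma FT_has_partial: "f \<in> FT \<Longrightarrow> has_partial i f (partial_derivative i f)"
  by (simp add: FT_iff smooth_has_partial)

lemma schwartz_continuous: "f \<in> schwartz \<Longrightarrow> continuous_on UNIV f"
  by (simp add: schwartz_iff smooth_imp_continuous)

lemma schwartz_rapid: "f \<in> schwartz \<Longrightarrow> rapid f"
  unfolding schwartz_iff by (metis iterated_partial.simps(1))

lemma schwartz_partial: "f \<in> schwartz \<Longrightarrow> partial_derivative i f \<in> schwartz"
  unfolding schwartz_iff using iterated_partial_append[of _ "[i]" f]
  by (simp add: smooth_partial_derivative) metis

lemma schwartz_has_partial: "f \<in> schwartz \<Longrightarrow> has_partial i f (partial_derivative i f)"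
  by (simp add: schwartz_iff smooth_has_partial)

lemma schwartz_subset_FT: "schwartz \<subseteq> FT"
  by (auto simp: schwartz_iff FT_iff intro!: rapid_imp_poly_bounded)

text \<open>The complex polynomial algebra over \<open>Q\<close>. A function such as 1/f or exp f is
  shown to be smooth by adjoining it to \<open>FT\<close>: its partials are polynomials in itself
  and in members of \<open>FT\<close>, so they stay in the algebra.\<close>

inductive_set generated :: "(real^'d::finite \<Rightarrow> complex) set \<Rightarrow> (real^'d \<Rightarrow> complex) set"
  for Q where
  base: "f \<in> Q \<Longrightarrow> f \<in> generated Q"
| const: "(\<lambda>x. c) \<in> generated Q"
| add: "f \<in> generated Q \<Longrightarrow> g \<in> generated Q \<Longrightarrow> (\<lambda>x. f x + g x) \<in> generated Q"
| mult: "f \<in> generated Q \<Longrightarrow> g \<in> generated Q \<Longrightarrow> (\<lambda>x. f x * g x) \<in> generated Q"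

text \<open>By the sum and Leibniz rules only the generators have to be differentiated, and their
  partials may lie anywhere in the generated algebra.\<close>

lemma generated_subset_FT:
  assumes "\<And>f. f \<in> Q \<Longrightarrow> continuous_on UNIV f" "\<And>f. f \<in> Q \<Longrightarrow> poly_bounded f"
    and "\<And>f i. f \<in> Q \<Longrightarrow> \<exists>f'\<in>generated Q. has_partial i f f'"
  shows "generated Q \<subseteq> FT"
proof (rule FT_coinduct)
  fix f i assume "f \<in> generated Q"
  then show "\<exists>f'\<in>generated Q. has_partial i f f'"
  proof induction
    case (const c)
    show ?case
      by (intro bexI[of _ "\<lambda>x. 0"] has_partial_const generated.const)
  next
    case (add f g)
    then obtain f' g' where "f' \<in> generated Q" "g' \<in> generated Q" "has_partial i f f'" "has_partial i g g'"
      by blast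
    then show ?case
      by (intro bexI[of _ "\<lambda>x. f' x + g' x"] has_partial_add generated.add)
  next
    case (mult f g)
    then obtain f' g' where "f' \<in> generated Q" "g' \<in> generated Q" "has_partial i f f'" "has_partial i g g'"
      by blast
    then show ?case using mult.hyps
      by (intro bexI[of _ "\<lambda>x. f x * g' x + f' x * g x"] has_partial_mult generated.add generated.mult)
  qed (use assms(3) in blast)
next
  fix f assume "f \<in> generated Q"
  then show "continuous_on UNIV f"
    by induction (simp_all add: assms(1) continuous_on_add continuous_on_mult)
next
  fix f assume "f \<in> generated Q"
  then show "poly_bounded f"
    by induction (simp_all add: assms(2) poly_bounded_add poly_bounded_mult poly_bounded_const)
qed

lemma generated_FT: "generated FT \<subseteq> FT"
  by (rule generated_subset_FT)
    (use FT_continuous FT_poly_bounded FT_has_partial FT_partial generated.base in blast)+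

lemma FT_const: "(\<lambda>x. c) \<in> FT"
  using generated_FT generated.const by blast

lemma FT_add: "f \<in> FT \<Longrightarrow> g \<in> FT \<Longrightarrow> (\<lambda>x. f x + g x) \<in> FT"
  using generated_FT generated.add generated.base by (metis subsetD)

lemma FT_mult: "f \<in> FT \<Longrightarrow> g \<in> FT \<Longrightarrow> (\<lambda>x. f x * g x) \<in> FT"
  using generated_FT generated.mult generated.base by (metis subsetD)

lemma FT_sum: "finite A \<Longrightarrow> (\<And>a. a \<in> A \<Longrightarrow> f a \<in> FT) \<Longrightarrow> (\<lambda>x. \<Sum>a\<in>A. f a x) \<in> FT"
  by (induction rule: finite_induct) (auto intro: FT_const FT_add)

lemma FT_prod: "finite A \<Longrightarrow> (\<And>a. a \<in> A \<Longrightarrow> f a \<in> FT) \<Longrightarrow> (\<lambda>x. \<Prod>a\<in>A. f a x) \<in> FT"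
  by (induction rule: finite_induct) (auto intro: FT_const FT_mult)

text \<open>The partials of 1/f are -(D f) (1/f)^2, polynomials in 1/f and members of
  \<open>FT\<close>. Growth of 1/f alone therefore controls all its derivatives.\<close>

lemma FT_inverse:
  assumes f: "f \<in> FT" and nz: "\<And>x. f x \<noteq> 0" and pb: "poly_bounded (\<lambda>x. inverse (f x))"
  shows "(\<lambda>x. inverse (f x)) \<in> FT"
proof -
  let ?q = "\<lambda>x. inverse (f x)"
  let ?Q = "insert ?q FT"
  have "generated ?Q \<subseteq> FT"
  proof (rule generated_subset_FT)
    fix g assume "g \<in> ?Q"
    then show "continuous_on UNIV g"
      using FT_continuous f nz by (auto intro!: continuous_intros)
    show "poly_bounded g" using \<open>g \<in> ?Q\<close> pb FT_poly_bounded by auto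
  next
    fix g i assume "g \<in> ?Q"
    then consider "g = ?q" | "g \<in> FT" by blast
    then show "\<exists>g'\<in>generated ?Q. has_partial i g g'"
    proof cases
      case 1
      have d: "(inverse has_field_derivative - (inverse (f x) * inverse (f x))) (at (f x))" for x
        using DERIV_inverse[of "f x"] nz by (simp add: power2_eq_square)
      have "has_partial i ?q (\<lambda>x. partial_derivative i f x * ((\<lambda>z. - (inverse z * inverse z)) (f x)))"
        using FT_has_partial[OF f] d by (intro has_partial_chain) auto
      moreover have "(\<lambda>x. partial_derivative i f x * ((-1) * (?q x * ?q x))) \<in> generated ?Q"
        using FT_partial[OF f] by (intro generated.intros) auto
      ultimately show ?thesis unfolding 1 by auto
    next
      case 2
      then show ?thesis
        by (intro bexI[of _ "partial_derivative i g"] FT_has_partial generated.base insertI2 FT_partial)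
    qed
  qed
  then show ?thesis using generated.base by blast
qed

lemma FT_coord: "(\<lambda>x. complex_of_real (x $ j)) \<in> FT"
proof -
  have "generated {\<lambda>x. complex_of_real (x $ j)} \<subseteq> FT"
  proof (rule generated_subset_FT; elim singletonE; clarify)
    show "continuous_on UNIV (\<lambda>x::real^'a. complex_of_real (x $ j))"
      by (intro continuous_intros)
    show "poly_bounded (\<lambda>x::real^'a. complex_of_real (x $ j))"
      using component_le_weight by (intro poly_boundedI[of _ 1 1]) auto
  qed (use has_partial_coord generated.const in blast)
  then show ?thesis using generated.base by blast
qed

lemma FT_inner: "(\<lambda>x. complex_of_real (a \<bullet> x)) \<in> FT"
proof -
  have "(\<lambda>x. \<Sum>i\<in>UNIV. complex_of_real (a $ i) * complex_of_real (x $ i)) \<in> FT"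
    by (intro FT_sum FT_mult FT_const FT_coord) auto
  then show ?thesis by (simp add: inner_vec_def)
qed

lemma FT_exp:
  assumes f: "f \<in> FT" and pb: "poly_bounded (\<lambda>x. exp (f x))"
  shows "(\<lambda>x. exp (f x)) \<in> FT"
proof -
  let ?q = "\<lambda>x. exp (f x)"
  let ?Q = "insert ?q FT"
  have "generated ?Q \<subseteq> FT"
  proof (rule generated_subset_FT)
    fix g assume "g \<in> ?Q"
    then show "continuous_on UNIV g"
      using FT_continuous f by (auto intro!: continuous_intros)
    show "poly_bounded g" using \<open>g \<in> ?Q\<close> pb FT_poly_bounded by auto
  next
    fix g i assume "g \<in> ?Q"
    then consider "g = ?q" | "g \<in> FT" by blast
    then show "\<exists>g'\<in>generated ?Q. has_partial i g g'"
    proof cases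
      case 1
      have "has_partial i ?q (\<lambda>x. partial_derivative i f x * exp (f x))"
        using FT_has_partial[OF f] by (intro has_partial_chain[of _ _ _ exp exp]) auto
      moreover have "(\<lambda>x. partial_derivative i f x * ?q x) \<in> generated ?Q"
        using FT_partial[OF f] by (intro generated.intros) auto
      ultimately show ?thesis unfolding 1 by auto
    next
      case 2
      then show ?thesis
        by (intro bexI[of _ "partial_derivative i g"] FT_has_partial generated.base insertI2 FT_partial)
    qed
  qed
  then show ?thesis using generated.base by blast
qed

lemma FT_cexp: "(\<lambda>x. exp (\<i> * complex_of_real (a \<bullet> x))) \<in> FT"
proof (rule FT_exp)
  show "(\<lambda>x. \<i> * complex_of_real (a \<bullet> x)) \<in> FT"
    by (intro FT_mult FT_const FT_inner)
  show "poly_bounded (\<lambda>x. exp (\<i> * complex_of_real (a \<bullet> x)))"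
    by (rule poly_boundedI[of _ 1 0]) simp
qed

lemma FT_cnj:
  fixes f :: "real^'a::finite \<Rightarrow> complex"
  assumes "f \<in> FT"
  shows "(\<lambda>x. cnj (f x)) \<in> FT"
proof -
  have "(\<lambda>f x. cnj (f x)) ` FT \<subseteq> (FT :: (real^'a \<Rightarrow> complex) set)"
  proof (rule FT_coinduct)
    fix g :: "real^'a \<Rightarrow> complex" and i assume "g \<in> (\<lambda>f x. cnj (f x)) ` FT"
    then show "\<exists>f'\<in>(\<lambda>f x. cnj (f x)) ` FT. has_partial i g f'"
      using has_partial_cnj[OF FT_has_partial] FT_partial by blast
  next
    fix g :: "real^'a \<Rightarrow> complex" assume "g \<in> (\<lambda>f x. cnj (f x)) ` FT"
    then obtain f where f: "f \<in> FT" "g = (\<lambda>x. cnj (f x))" by blast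
    show "continuous_on UNIV g"
      using FT_continuous[OF f(1)] f(2) by (auto intro!: continuous_intros)
    show "poly_bounded g"
      using FT_poly_bounded[OF f(1)] f(2) by (simp add: poly_bounded_def)
  qed
  then show ?thesis using assms by blast
qed

text \<open>Products by themselves are not stable under differentiation, since the Leibniz rule
  yields a sum of two products; the coinduction needs their additive closure.\<close>

inductive_set schwartz_ideal :: "(real^'d::finite \<Rightarrow> complex) set" where
  mult: "f \<in> schwartz \<Longrightarrow> g \<in> FT \<Longrightarrow> (\<lambda>x. f x * g x) \<in> schwartz_ideal"
| add: "f \<in> schwartz_ideal \<Longrightarrow> g \<in> schwartz_ideal \<Longrightarrow> (\<lambda>x. f x + g x) \<in> schwartz_ideal"

lemma schwartz_ideal_subset: "schwartz_ideal \<subseteq> schwartz"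
proof (rule schwartz_coinduct)
  fix f :: "real^'a \<Rightarrow> complex" and i assume "f \<in> schwartz_ideal"
  then show "\<exists>f'\<in>schwartz_ideal. has_partial i f f'"
  proof induction
    case (mult f g)
    then show ?case
      using has_partial_mult[OF schwartz_has_partial FT_has_partial, of f g i]
        schwartz_partial[of f i] FT_partial[of g i]
      by (intro bexI[of _ "\<lambda>x. f x * partial_derivative i g x + partial_derivative i f x * g x"]
          schwartz_ideal.intros) auto
  next
    case (add f g)
    then obtain f' g' where "f' \<in> schwartz_ideal" "g' \<in> schwartz_ideal"
      "has_partial i f f'" "has_partial i g g'"
      by blast
    then show ?case
      by (intro bexI[of _ "\<lambda>x. f' x + g' x"] has_partial_add schwartz_ideal.add)
  qed
next
  fix f :: "real^'a \<Rightarrow> complex" assume "f \<in> schwartz_ideal"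
  then show "continuous_on UNIV f"
    by induction (simp_all add: continuous_on_add continuous_on_mult schwartz_continuous FT_continuous)
  show "rapid f" using \<open>f \<in> schwartz_ideal\<close>
    by induction (simp_all add: rapid_mult rapid_add schwartz_rapid FT_poly_bounded)
qed

lemma schwartz_mult_FT: "f \<in> schwartz \<Longrightarrow> g \<in> FT \<Longrightarrow> (\<lambda>x. f x * g x) \<in> schwartz"
  using schwartz_ideal_subset schwartz_ideal.mult by blast

lemma FT_mult_schwartz: "f \<in> FT \<Longrightarrow> g \<in> schwartz \<Longrightarrow> (\<lambda>x. f x * g x) \<in> schwartz"
  using schwartz_mult_FT[of g f] by (simp add: mult.commute)

lemma schwartz_scale: "f \<in> schwartz \<Longrightarrow> (\<lambda>x. c * f x) \<in> schwartz"
  using FT_mult_schwartz FT_const by blast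

lemma schwartz_add:
  assumes "f \<in> schwartz" "g \<in> schwartz"
  shows "(\<lambda>x. f x + g x) \<in> schwartz"
proof -
  have "(\<lambda>x. f x * 1 + g x * 1) \<in> schwartz_ideal"
    using assms by (intro schwartz_ideal.intros FT_const)
  then show ?thesis using schwartz_ideal_subset by auto
qed

lemma schwartz_lincomb:
  "f \<in> schwartz \<Longrightarrow> g \<in> schwartz \<Longrightarrow> (\<lambda>x. a * f x + b * g x) \<in> schwartz"
  by (intro schwartz_add schwartz_scale)

lemma schwartz_diff: "f \<in> schwartz \<Longrightarrow> g \<in> schwartz \<Longrightarrow> (\<lambda>x. f x - g x) \<in> schwartz"
  using schwartz_lincomb[of f g 1 "-1"] by simp

lemma schwartz_zero: "(\<lambda>x. 0) \<in> schwartz"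
proof -
  have "{\<lambda>x::real^'a. 0::complex} \<subseteq> schwartz"
    by (rule schwartz_coinduct) (auto simp: has_partial_const rapid_def)
  then show ?thesis by blast
qed

lemma schwartz_cnj:
  fixes f :: "real^'a::finite \<Rightarrow> complex"
  assumes "f \<in> schwartz"
  shows "(\<lambda>x. cnj (f x)) \<in> schwartz"
proof -
  have "(\<lambda>f x. cnj (f x)) ` schwartz \<subseteq> (schwartz :: (real^'a \<Rightarrow> complex) set)"
  proof (rule schwartz_coinduct)
    fix g :: "real^'a \<Rightarrow> complex" and i assume "g \<in> (\<lambda>f x. cnj (f x)) ` schwartz"
    then show "\<exists>f'\<in>(\<lambda>f x. cnj (f x)) ` schwartz. has_partial i g f'"
      using has_partial_cnj[OF schwartz_has_partial] schwartz_partial by blast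
  next
    fix g :: "real^'a \<Rightarrow> complex" assume "g \<in> (\<lambda>f x. cnj (f x)) ` schwartz"
    then obtain f where f: "f \<in> schwartz" "g = (\<lambda>x. cnj (f x))" by blast
    show "continuous_on UNIV g"
      using schwartz_continuous[OF f(1)] f(2) by (auto intro!: continuous_intros)
    show "rapid g"
      using schwartz_rapid[OF f(1)] f(2) by (simp add: rapid_def)
  qed
  then show ?thesis using assms by blast
qed

lemma schwartz_reflect:
  fixes f :: "real^'a::finite \<Rightarrow> complex"
  assumes "f \<in> schwartz"
  shows "(\<lambda>x. f (- x)) \<in> schwartz"
proof -
  have "(\<lambda>f x. f (- x)) ` schwartz \<subseteq> (schwartz :: (real^'a \<Rightarrow> complex) set)"
  proof (rule schwartz_coinduct)
    fix g :: "real^'a \<Rightarrow> complex" and i assume "g \<in> (\<lambda>f x. f (- x)) ` schwartz"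
    then obtain f where f: "f \<in> schwartz" and g: "g = (\<lambda>x. f (- x))" by blast
    have *: "has_partial i (\<lambda>x. f (- x)) (\<lambda>x. (-1) * partial_derivative i f (- x))"
      using has_partial_reflect[OF schwartz_has_partial[OF f], of i] by simp
    show "\<exists>f'\<in>(\<lambda>f x. f (- x)) ` schwartz. has_partial i g f'"
      unfolding g
      by (rule bexI, rule *) (rule image_eqI[OF _ schwartz_scale[OF schwartz_partial[OF f], of "-1" i]], simp)
  next
    fix g :: "real^'a \<Rightarrow> complex" assume "g \<in> (\<lambda>f x. f (- x)) ` schwartz"
    then obtain f where f: "f \<in> schwartz" and g: "g = (\<lambda>x. f (- x))" by blast
    show "continuous_on UNIV g" unfolding g
      using continuous_on_compose2[OF schwartz_continuous[OF f] continuous_on_minus[OF continuous_on_id]]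
      by auto
    show "rapid g" unfolding g
      using schwartz_rapid[OF f] unfolding rapid_def by (metis weight_uminus)
  qed
  then show ?thesis using assms by blast
qed

section \<open>Gaussians\<close>

definition gaussian :: "real \<Rightarrow> real^'d::finite \<Rightarrow> real" where
  "gaussian c x = exp (- c * (norm x)\<^sup>2)"

lemma gaussian_pos [simp]: "0 < gaussian c x" and gaussian_nz [simp]: "gaussian c x \<noteq> 0"
  by (simp_all add: gaussian_def)

lemma gaussian_uminus [simp]: "gaussian c (- x) = gaussian c x"
  by (simp add: gaussian_def)

lemma continuous_gaussian [continuous_intros]: "continuous_on A (gaussian c)"
  unfolding gaussian_def by (intro continuous_intros)

text \<open>Up to the constant \<open>exp c\<close> the Gaussian is exp(-t) with t = c
  \<open>weight x\<close>, so the claim is the boundedness of t^N exp(-t) on the half-line.\<close>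

lemma rapid_gaussian:
  assumes "0 < c"
  shows "rapid (\<lambda>x. complex_of_real (gaussian c x))"
  unfolding rapid_def
proof
  fix N
  have "((\<lambda>t. (t ^ N / exp t)) \<longlongrightarrow> (0::real)) at_top"
    by (rule tendsto_power_div_exp_0)
  then obtain b where b: "\<And>t. t \<ge> b \<Longrightarrow> t ^ N / exp t < (1::real)"
    by (metis (no_types, lifting) eventually_at_top_linorder order_tendstoD(2) zero_less_one)
  have *: "t ^ N / exp t \<le> max 1 (\<bar>b\<bar> ^ N)" if "t \<ge> 0" for t :: real
  proof (cases "t \<ge> b")
    case True
    then show ?thesis using b[of t] by linarith
  next
    case False
    have "t ^ N / exp t \<le> t ^ N / 1" using that by (intro divide_left_mono) auto
    also have "\<dots> \<le> \<bar>b\<bar> ^ N" using False that by (auto intro!: power_mono)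
    finally show ?thesis by linarith
  qed
  have "weight x ^ N * norm (complex_of_real (gaussian c x)) \<le> exp c * max 1 (\<bar>b\<bar> ^ N) / c ^ N"
    for x :: "real^'a"
  proof -
    have "norm (complex_of_real (gaussian c x)) = gaussian c x"
      by (simp add: less_imp_le)
    also have "\<dots> = exp c / exp (c * weight x)"
      by (simp add: gaussian_def weight_def exp_minus exp_add field_simps)
    finally have "weight x ^ N * norm (complex_of_real (gaussian c x)) =
        weight x ^ N * (exp c / exp (c * weight x))" by simp
    also have "\<dots> = ((c * weight x) ^ N / exp (c * weight x)) * exp c / c ^ N"
      using assms by (simp add: power_mult_distrib field_simps)
    also have "\<dots> \<le> max 1 (\<bar>b\<bar> ^ N) * exp c / c ^ N"
      using assms by (intro divide_right_mono mult_right_mono *) auto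
    finally show ?thesis by (simp add: mult.commute)
  qed
  then show "\<exists>C. \<forall>x::real^'a. weight x ^ N * norm (complex_of_real (gaussian c x)) \<le> C" by blast
qed

text \<open>The stable class consists of the Gaussian times arbitrary members of \<open>FT\<close>:
  differentiating the Gaussian only produces a further factor from \<open>FT\<close>, and rapid
  decay survives multiplication by polynomial growth.\<close>

lemma gaussian_schwartz:
  assumes "0 < c"
  shows "(\<lambda>x. complex_of_real (gaussian c x)) \<in> schwartz"
proof -
  let ?g = "\<lambda>x::real^'a. complex_of_real (gaussian c x)"
  let ?f = "\<lambda>x::real^'a. complex_of_real (- c) * (\<Sum>i\<in>UNIV. complex_of_real (x $ i) * complex_of_real (x $ i))"
  have g: "?g = (\<lambda>x. exp (?f x))"
  proof
    fix x :: "real^'a"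
    have n: "(norm x)\<^sup>2 = (\<Sum>i\<in>UNIV. x $ i * x $ i)"
      by (simp add: norm_vec_def L2_set_def sum_nonneg power2_eq_square)
    show "?g x = exp (?f x)"
      unfolding gaussian_def n exp_of_real[symmetric] by simp
  qed
  have gx: "exp (?f x) = ?g x" for x :: "real^'a"
    using fun_cong[OF g, of x] by simp
  have "?f \<in> FT"
    by (intro FT_mult FT_const FT_sum FT_coord) auto
  then have gFT: "?g \<in> FT" unfolding g
    by (rule FT_exp) (rule back_subst[of poly_bounded, OF rapid_imp_poly_bounded[OF rapid_gaussian[OF assms]] g])
  let ?A = "(\<lambda>q x. ?g x * q x) ` FT"
  have "?A \<subseteq> schwartz"
  proof (rule schwartz_coinduct)
    fix h i assume "h \<in> ?A"
    then obtain q where q: "q \<in> FT" and h: "h = (\<lambda>x. ?g x * q x)" by blast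
    have pf: "has_partial i ?g (\<lambda>x. partial_derivative i ?f x * exp (?f x))"
      unfolding g using FT_has_partial[OF \<open>?f \<in> FT\<close>]
      by (intro has_partial_chain[of _ _ _ exp exp]) auto
    have "has_partial i h (\<lambda>x. ?g x * partial_derivative i q x + (partial_derivative i ?f x * exp (?f x)) * q x)"
      unfolding h by (rule has_partial_mult[OF pf FT_has_partial[OF q]])
    also have "(\<lambda>x. ?g x * partial_derivative i q x + (partial_derivative i ?f x * exp (?f x)) * q x) =
        (\<lambda>x. ?g x * (partial_derivative i q x + partial_derivative i ?f x * q x))"
      unfolding gx by (auto simp: algebra_simps)
    finally have *: "has_partial i h \<dots>" .
    have "(\<lambda>x. partial_derivative i q x + partial_derivative i ?f x * q x) \<in> FT"
      by (intro FT_add FT_mult FT_partial q \<open>?f \<in> FT\<close>)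
    from imageI[OF this, of "\<lambda>q x. ?g x * q x"] * show "\<exists>f'\<in>?A. has_partial i h f'"
      by (intro bexI) simp_all
  next
    fix h assume "h \<in> ?A"
    then show "continuous_on UNIV h" "rapid h"
      using gFT rapid_gaussian[OF assms]
      by (auto intro!: continuous_intros rapid_mult intro: FT_continuous FT_poly_bounded)
  qed
  moreover have "(\<lambda>x. ?g x * 1) \<in> ?A" by (rule imageI[OF FT_const])
  ultimately show ?thesis by auto
qed

subsection \<open>Lebesgue integration\<close>

lemma norm_add_power2_le: "(norm (a + b))\<^sup>2 \<le> 2 * (norm a)\<^sup>2 + 2 * (norm b)\<^sup>2"
  for a b :: "'b::real_normed_vector"
proof -
  have "(norm (a + b))\<^sup>2 \<le> (norm a + norm b)\<^sup>2"
    by (intro power_mono norm_triangle_ineq) auto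
  also have "\<dots> \<le> 2 * (norm a)\<^sup>2 + 2 * (norm b)\<^sup>2"
    using zero_le_power2[of "norm a - norm b"] by (simp add: power2_sum power2_diff)
  finally show ?thesis .
qed

text \<open>Peetre's inequality: a translation changes the weight by a bounded factor only, which
  provides dominating functions that are uniform over bounded translations.\<close>

lemma weight_add: "weight (a + b) \<le> 2 * weight a * weight b"
proof -
  have "weight (a + b) \<le> 2 * (1 + (norm a)\<^sup>2 + (norm b)\<^sup>2)"
    using norm_add_power2_le[of a b] by (simp add: weight_def)
  also have "\<dots> \<le> 2 * weight a * weight b"
    by (simp add: weight_def algebra_simps)
  finally show ?thesis .
qed

lemma weight_scaleR: "\<bar>t\<bar> \<le> 1 \<Longrightarrow> weight (t *\<^sub>R x) \<le> weight x"
  unfolding weight_def by (intro add_left_mono power_mono) (auto simp: mult_left_le_one_le)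

section \<open>Passing between Lebesgue and Borel integrals, product integrals, affine
  substitution\<close>

lemma borel_measurable_continuous_UNIV:
  fixes f :: "'a::topological_space \<Rightarrow> 'b::topological_space"
  shows "continuous_on UNIV f \<Longrightarrow> f \<in> borel_measurable borel"
  by (rule borel_measurable_continuous_onI)

lemma lebesgue_integral_eq_lborel:
  fixes f :: "'a::euclidean_space \<Rightarrow> 'b::{banach, second_countable_topology}"
  shows "f \<in> borel_measurable borel \<Longrightarrow> integral\<^sup>L lebesgue f = integral\<^sup>L lborel f"
  by (rule integral_completion) simp

lemma lebesgue_integrable_eq_lborel:
  fixes f :: "'a::euclidean_space \<Rightarrow> 'b::{banach, second_countable_topology}"
  shows "f \<in> borel_measurable borel \<Longrightarrow> integrable lebesgue f = integrable lborel f"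
  by (rule integrable_completion) simp

text \<open>\<open>lborel\<close> is the image of the product of one-dimensional Lebesgue measures
  under the map sending coordinates to a vector, so the product rule for finite product measures
  applies.\<close>

lemma
  fixes f :: "'a::euclidean_space \<Rightarrow> real \<Rightarrow> 'b::{real_normed_field, banach, second_countable_topology}"
  assumes "\<And>b. b \<in> Basis \<Longrightarrow> integrable lborel (f b)"
  shows integrable_lborel_prod: "integrable lborel (\<lambda>x::'a. \<Prod>b\<in>Basis. f b (x \<bullet> b))"
    and integral_lborel_prod:
      "(LINT x|lborel. (\<Prod>b\<in>Basis. f b ((x::'a) \<bullet> b))) = (\<Prod>b\<in>Basis. LINT t|lborel. f b t)"
proof -
  interpret product_sigma_finite "\<lambda>_::'a. lborel :: real measure" by standard
  let ?g = "\<lambda>f::'a \<Rightarrow> real. \<Sum>b\<in>Basis. f b *\<^sub>R b"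
  have g: "?g \<in> (\<Pi>\<^sub>M b\<in>Basis. lborel) \<rightarrow>\<^sub>M borel" by measurable
  have fm: "(\<lambda>x::'a. \<Prod>b\<in>Basis. f b (x \<bullet> b)) \<in> borel_measurable borel"
    using assms by (auto intro!: borel_measurable_prod dest!: borel_measurable_integrable)
  have eq: "(\<Prod>b\<in>Basis. f b (?g x \<bullet> b)) = (\<Prod>b\<in>Basis. f b (x b))" for x
    by (intro prod.cong) auto
  have "integrable (\<Pi>\<^sub>M b\<in>Basis. lborel) (\<lambda>x. \<Prod>b\<in>Basis. f b (x b))"
    using assms by (intro product_integrable_prod) auto
  then show "integrable lborel (\<lambda>x::'a. \<Prod>b\<in>Basis. f b (x \<bullet> b))"
    by (subst lborel_eq) (simp add: integrable_distr_eq[OF g fm] eq del: inner_sum_left_Basis)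
  show "(LINT x|lborel. (\<Prod>b\<in>Basis. f b ((x::'a) \<bullet> b))) = (\<Prod>b\<in>Basis. LINT t|lborel. f b t)"
    using product_integral_prod[of Basis f] assms
    by (subst lborel_eq) (simp add: integral_distr[OF g fm] eq del: inner_sum_left_Basis)
qed

lemma prod_Basis_vec:
  "(\<Prod>b\<in>(Basis :: (real^'d::finite) set). h (axis_index b) (x \<bullet> b)) = (\<Prod>i\<in>UNIV. h i (x $ i))"
proof -
  have B: "(Basis :: (real^'d) set) = range (\<lambda>i. axis i 1)"
    by (auto simp: Basis_vec_def)
  have "inj (\<lambda>i. axis i (1::real) :: real^'d)"
    by (auto simp: inj_on_def axis_eq_axis)
  then show ?thesis unfolding B
    by (subst prod.reindex) (auto simp: axis_index_axis inner_axis)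
qed

lemma integrable_prod_vec:
  fixes f :: "'d::finite \<Rightarrow> real \<Rightarrow> 'b::{real_normed_field, banach, second_countable_topology}"
  assumes "\<And>i. integrable lborel (f i)"
  shows "integrable lborel (\<lambda>x::real^'d. \<Prod>i\<in>UNIV. f i (x $ i))"
  using integrable_lborel_prod[where ?'a = "real^'d", of "\<lambda>b. f (axis_index b)"] assms
  by (simp add: prod_Basis_vec[of f])

lemma integral_prod_vec:
  fixes f :: "'d::finite \<Rightarrow> real \<Rightarrow> 'b::{real_normed_field, banach, second_countable_topology}"
  assumes "\<And>i. integrable lborel (f i)"
  shows "(LINT x|lborel. (\<Prod>i\<in>UNIV. f i ((x::real^'d) $ i))) = (\<Prod>i\<in>UNIV. LINT t|lborel. f i t)"
proof -
  have "(LINT x|lborel. (\<Prod>i\<in>UNIV. f i ((x::real^'d) $ i))) =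
      (\<Prod>b\<in>(Basis :: (real^'d) set). (\<lambda>i _. LINT t|lborel. f i t) (axis_index b) (0 \<bullet> b))"
    using integral_lborel_prod[where ?'a = "real^'d", of "\<lambda>b. f (axis_index b)"] assms
    by (simp add: prod_Basis_vec[of f])
  also have "\<dots> = (\<Prod>i\<in>UNIV. LINT t|lborel. f i t)"
    by (rule prod_Basis_vec)
  finally show ?thesis .
qed

text \<open>The power \<open>weight x ^ CARD('d)\<close> dominates the product of the factors 1 +
  x_i^2, whose reciprocal is a product of integrable functions of one variable. This fixes the
  exponent \<open>CARD('d)\<close> used in all later bounds.\<close>

lemma integrable_inverse_weight:
  "integrable lborel (\<lambda>x::real^'d::finite. inverse (weight x ^ CARD('d)))"
proof (rule Bochner_Integration.integrable_bound)
  have "integrable lborel (\<lambda>t::real. inverse (1 + t\<^sup>2))"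
    using integrable_inverse_1_plus_square by (simp add: set_integrable_def einterval_def)
  then show "integrable lborel (\<lambda>x::real^'d. \<Prod>i\<in>UNIV. inverse (1 + (x $ i)\<^sup>2))"
    by (rule integrable_prod_vec)
  show "(\<lambda>x::real^'d. inverse (weight x ^ CARD('d))) \<in> borel_measurable lborel"
    unfolding weight_def by measurable
  have "norm (inverse (weight x ^ CARD('d))) \<le> norm (\<Prod>i\<in>UNIV. inverse (1 + (x $ i)\<^sup>2))"
    for x :: "real^'d"
  proof -
    have "(\<Prod>i\<in>UNIV. 1 + (x $ i)\<^sup>2) \<le> (\<Prod>i\<in>(UNIV::'d set). weight x)"
    proof (intro prod_mono conjI)
      fix i
      have "(x $ i)\<^sup>2 \<le> (norm x)\<^sup>2"
        using component_le_norm_cart[of x i] by (simp add: abs_le_square_iff[symmetric])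
      then show "1 + (x $ i)\<^sup>2 \<le> weight x" by (simp add: weight_def)
    qed simp
    then have "inverse (weight x ^ CARD('d)) \<le> inverse (\<Prod>i\<in>UNIV. 1 + (x $ i)\<^sup>2)"
      by (intro le_imp_inverse_le prod_pos) (auto simp: add_pos_nonneg)
    also have "\<dots> = (\<Prod>i\<in>UNIV. inverse (1 + (x $ i)\<^sup>2))"
      using prod_inversef[of "\<lambda>i. 1 + (x $ i)\<^sup>2" UNIV] by (simp add: o_def)
    finally show ?thesis by simp
  qed
  then show "AE x in lborel. norm (inverse (weight x ^ CARD('d))) \<le>
      norm (\<Prod>i\<in>UNIV. inverse (1 + ((x::real^'d) $ i)\<^sup>2))" by auto
qed

lemma rapid_integrable:
  fixes f :: "real^'d::finite \<Rightarrow> 'b::{banach, second_countable_topology}"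
  assumes "rapid f" "f \<in> borel_measurable borel"
  shows "integrable lborel f"
proof -
  obtain C where C: "\<And>x. weight x ^ CARD('d) * norm (f x) \<le> C"
    using assms(1) unfolding rapid_def by blast
  have "norm (f x) \<le> norm (C * inverse (weight x ^ CARD('d)))" for x
  proof -
    have "norm (f x) = (weight x ^ CARD('d) * norm (f x)) * inverse (weight x ^ CARD('d))"
      by simp
    also have "\<dots> \<le> C * inverse (weight x ^ CARD('d))"
      using C by (intro mult_right_mono) auto
    finally show ?thesis by simp
  qed
  then show ?thesis
    using assms(2)
    by (intro Bochner_Integration.integrable_bound[OF integrable_mult_right[OF integrable_inverse_weight, of C]]) auto
qed

lemma schwartz_borel: "f \<in> schwartz \<Longrightarrow> f \<in> borel_measurable borel"
  by (intro borel_measurable_continuous_UNIV schwartz_continuous)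

lemma schwartz_integrable: "f \<in> schwartz \<Longrightarrow> integrable lborel f"
  by (intro rapid_integrable schwartz_rapid schwartz_borel)

lemma
  fixes f :: "'a::euclidean_space \<Rightarrow> 'b::{banach, second_countable_topology}"
  assumes "c \<noteq> 0" and [measurable]: "f \<in> borel_measurable borel"
  shows lborel_integral_affine:
      "(LINT x|lborel. f x) = \<bar>c\<bar> ^ DIM('a) *\<^sub>R (LINT x|lborel. f (t + c *\<^sub>R x))"
    and lborel_integrable_affine:
      "integrable lborel (\<lambda>x. f (t + c *\<^sub>R x)) \<longleftrightarrow> integrable lborel f"
proof -
  show "(LINT x|lborel. f x) = \<bar>c\<bar> ^ DIM('a) *\<^sub>R (LINT x|lborel. f (t + c *\<^sub>R x))"
    using assms(1) by (subst lborel_affine[of c t]) (simp_all add: integral_density integral_distr)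
  have "integrable lborel f \<longleftrightarrow> integrable (density (distr lborel borel (\<lambda>x. t + c *\<^sub>R x)) (\<lambda>_. ennreal (\<bar>c\<bar> ^ DIM('a)))) f"
    using lborel_affine[OF assms(1), of t] by simp
  also have "\<dots> \<longleftrightarrow> integrable lborel (\<lambda>x. \<bar>c\<bar> ^ DIM('a) *\<^sub>R f (t + c *\<^sub>R x))"
    by (subst integrable_density) (auto simp: integrable_distr_eq)
  also have "\<dots> \<longleftrightarrow> integrable lborel (\<lambda>x. f (t + c *\<^sub>R x))"
    using assms(1)
      integrable_scaleR_right[of "inverse (\<bar>c\<bar> ^ DIM('a))" lborel "\<lambda>x. \<bar>c\<bar> ^ DIM('a) *\<^sub>R f (t + c *\<^sub>R x)"]
    by auto
  finally show "integrable lborel (\<lambda>x. f (t + c *\<^sub>R x)) \<longleftrightarrow> integrable lborel f" ..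
qed

lemma lborel_integral_reflect:
  fixes f :: "'a::euclidean_space \<Rightarrow> 'b::{banach, second_countable_topology}"
  shows "f \<in> borel_measurable borel \<Longrightarrow> (LINT x|lborel. f (- x)) = (LINT x|lborel. f x)"
  using lborel_integral_affine[of "-1" f 0] by simp

lemma lborel_integrable_product:
  fixes u v :: "'a::euclidean_space \<Rightarrow> complex"
  assumes "integrable lborel u" "integrable lborel v"
    and [measurable]: "(\<lambda>(x, y). k x y) \<in> borel_measurable (borel \<Otimes>\<^sub>M borel)"
    and "\<And>x y. norm (k x y) \<le> 1"
  shows "integrable (lborel \<Otimes>\<^sub>M lborel) (\<lambda>(x, y). u x * v y * k x y)"
proof -
  have [measurable]: "u \<in> borel_measurable borel" "v \<in> borel_measurable borel"
    using assms(1,2)[THEN borel_measurable_integrable] by auto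
  have "integrable (lborel \<Otimes>\<^sub>M lborel) (\<lambda>(x, y). u x * v y)"
  proof (rule lborel_pair.Fubini_integrable)
    show "(\<lambda>(x, y). u x * v y) \<in> borel_measurable (lborel \<Otimes>\<^sub>M lborel)" by measurable
    show "integrable lborel (\<lambda>x. LINT y|lborel. norm (case (x, y) of (x, y) \<Rightarrow> u x * v y))"
      using assms(1,2) by (simp add: norm_mult)
    show "AE x in lborel. integrable lborel (\<lambda>y. case (x, y) of (x, y) \<Rightarrow> u x * v y)"
      using assms(2) by simp
  qed
  then show ?thesis
  proof (rule Bochner_Integration.integrable_bound)
    show "(\<lambda>(x, y). u x * v y * k x y) \<in> borel_measurable (lborel \<Otimes>\<^sub>M lborel)"
      using assms(3) by measurable
    show "AE xy in lborel \<Otimes>\<^sub>M lborel. norm (case xy of (x, y) \<Rightarrow> u x * v y * k x y) \<le>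
        norm (case xy of (x, y) \<Rightarrow> u x * v y)"
      by (rule AE_I2) (use assms(4) in \<open>auto simp: norm_mult intro!: mult_left_le\<close>)
  qed
qed

lemma has_vector_derivative_at_0_iff:
  fixes g :: "real \<Rightarrow> 'b::real_normed_vector"
  shows "(g has_vector_derivative D) (at 0) \<longleftrightarrow> ((\<lambda>h. (g h - g 0) /\<^sub>R h) \<longlongrightarrow> D) (at 0)"
proof -
  have "(g has_vector_derivative D) (at 0) \<longleftrightarrow>
      ((\<lambda>h. norm (g h - g 0 - h *\<^sub>R D) / norm h) \<longlongrightarrow> 0) (at 0)"
    by (simp add: has_vector_derivative_def has_derivative_at bounded_linear_scaleR_left)
  also have "\<dots> \<longleftrightarrow> ((\<lambda>h. norm ((g h - g 0) /\<^sub>R h - D)) \<longlongrightarrow> 0) (at 0)"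
  proof (rule filterlim_cong)
    show "\<forall>\<^sub>F h in at 0. norm (g h - g 0 - h *\<^sub>R D) / norm h = norm ((g h - g 0) /\<^sub>R h - D)"
      unfolding eventually_at_filter
    proof (rule always_eventually, intro allI impI)
      fix h :: real assume h: "h \<noteq> 0"
      have "(g h - g 0) /\<^sub>R h - D = (g h - g 0 - h *\<^sub>R D) /\<^sub>R h"
        using h by (simp add: scaleR_diff_right)
      then show "norm (g h - g 0 - h *\<^sub>R D) / norm h = norm ((g h - g 0) /\<^sub>R h - D)"
        using h by (simp add: divide_inverse)
    qed
  qed auto
  also have "\<dots> \<longleftrightarrow> ((\<lambda>h. (g h - g 0) /\<^sub>R h) \<longlongrightarrow> D) (at 0)"
    by (simp add: tendsto_norm_zero_iff LIM_zero_iff)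
  finally show ?thesis .
qed

text \<open>The mean value inequality bounds the difference quotients by \<open>B\<close>, so
  dominated convergence applies along every sequence tending to 0.\<close>

lemma has_vector_derivative_integral:
  fixes f :: "real \<Rightarrow> 'a \<Rightarrow> complex"
  assumes int: "\<And>t. \<bar>t\<bar> \<le> 1 \<Longrightarrow> integrable M (f t)"
    and der: "\<And>t y. \<bar>t\<bar> \<le> 1 \<Longrightarrow> ((\<lambda>t. f t y) has_vector_derivative f' t y) (at t)"
    and bd: "\<And>t y. \<bar>t\<bar> \<le> 1 \<Longrightarrow> norm (f' t y) \<le> B y" and B: "integrable M B"
    and meas: "f' 0 \<in> borel_measurable M"
  shows "((\<lambda>t. LINT y|M. f t y) has_vector_derivative (LINT y|M. f' 0 y)) (at 0)"
  unfolding has_vector_derivative_at_0_iff tendsto_at_iff_sequentially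
proof (intro allI impI)
  fix X :: "nat \<Rightarrow> real" assume X: "\<forall>i. X i \<in> UNIV - {0}" "X \<longlonglongrightarrow> 0"
  obtain N where N: "\<And>n. n \<ge> N \<Longrightarrow> \<bar>X n\<bar> \<le> 1"
    using LIMSEQ_D[OF X(2), of 1] by force
  have lip: "norm ((f t y - f 0 y) /\<^sub>R t) \<le> B y" if t: "\<bar>t\<bar> \<le> 1" "t \<noteq> 0" for t y
  proof -
    have "norm (f t y - f 0 y) \<le> B y * norm (t - 0)"
    proof (rule differentiable_bound[of "{-1..1}"])
      show "((\<lambda>t. f t y) has_derivative (\<lambda>h. h *\<^sub>R f' x y)) (at x within {-1..1})" if "x \<in> {-1..1}" for x
        using der[of x y] that
        by (auto simp: has_vector_derivative_def abs_le_iff intro: has_derivative_at_withinI)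
      show "onorm (\<lambda>h. h *\<^sub>R f' x y) \<le> B y" if "x \<in> {-1..1}" for x
        using bd[of x y] that
        by (intro onorm_le) (auto simp: abs_le_iff mult.commute[of "B y"] intro!: mult_left_mono)
    qed (use t in \<open>auto simp: abs_le_iff\<close>)
    moreover have "norm ((f t y - f 0 y) /\<^sub>R t) = norm (f t y - f 0 y) / \<bar>t\<bar>"
      by (simp add: divide_inverse)
    ultimately show ?thesis using t by (simp add: pos_divide_le_eq)
  qed
  \<comment> \<open>The assumptions cover only |t| <= 1, so the limit is taken along the tail
    starting at \<open>N\<close>; the shift is undone at the end.\<close>
  have "(\<lambda>n. LINT y|M. (f (X (n + N)) y - f 0 y) /\<^sub>R X (n + N)) \<longlonglongrightarrow> (LINT y|M. f' 0 y)"
  proof (rule integral_dominated_convergence[where w = B])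
    show "AE y in M. (\<lambda>n. (f (X (n + N)) y - f 0 y) /\<^sub>R X (n + N)) \<longlonglongrightarrow> f' 0 y"
    proof (rule AE_I2)
      fix y
      have "((\<lambda>h. (f h y - f 0 y) /\<^sub>R h) \<longlongrightarrow> f' 0 y) (at 0)"
        using der[of 0 y] by (simp add: has_vector_derivative_at_0_iff)
      then have "(\<lambda>n. (f (X n) y - f 0 y) /\<^sub>R X n) \<longlonglongrightarrow> f' 0 y"
        using X unfolding tendsto_at_iff_sequentially by (auto simp: o_def)
      then show "(\<lambda>n. (f (X (n + N)) y - f 0 y) /\<^sub>R X (n + N)) \<longlonglongrightarrow> f' 0 y"
        by (rule LIMSEQ_ignore_initial_segment)
    qed
    show "AE y in M. norm ((f (X (n + N)) y - f 0 y) /\<^sub>R X (n + N)) \<le> B y" for n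
      using lip[of "X (n + N)"] N[of "n + N"] X(1) by auto
    show "(\<lambda>y. (f (X (n + N)) y - f 0 y) /\<^sub>R X (n + N)) \<in> borel_measurable M" for n
      using int[of "X (n + N)"] int[of 0] N[of "n + N"] by auto
  qed (use B meas in auto)
  moreover have "(LINT y|M. (f (X (n + N)) y - f 0 y) /\<^sub>R X (n + N)) =
      ((LINT y|M. f (X (n + N)) y) - (LINT y|M. f 0 y)) /\<^sub>R X (n + N)" for n
    using int[of "X (n + N)"] int[of 0] N[of "n + N"] by simp
  ultimately have "(\<lambda>n. ((LINT y|M. f (X (n + N)) y) - (LINT y|M. f 0 y)) /\<^sub>R X (n + N)) \<longlonglongrightarrow> (LINT y|M. f' 0 y)"
    by (simp only:)
  then show "((\<lambda>h. ((LINT y|M. f h y) - (LINT y|M. f 0 y)) /\<^sub>R h) \<circ> X) \<longlonglongrightarrow> (LINT y|M. f' 0 y)"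
    unfolding o_def by (rule LIMSEQ_offset)
qed

subsection \<open>The Fourier transform on Schwartz space\<close>

definition fourier_scale :: "'d::finite itself \<Rightarrow> real" where
  "fourier_scale _ = (2 * pi) powr (- (real CARD('d) / 2))"

lemma fourier_scale_pos [simp]: "0 < fourier_scale TYPE('d::finite)"
  by (simp add: fourier_scale_def)

lemma fourier_scale_nz [simp]: "fourier_scale TYPE('d::finite) \<noteq> 0"
  using fourier_scale_pos[where 'd = 'd] by linarith

lemma abs_fourier_scale [simp]: "\<bar>fourier_scale TYPE('d::finite)\<bar> = fourier_scale TYPE('d)"
  by (rule abs_of_pos) simp

lemma inverse_fourier_scale: "sqrt (2 * pi) ^ CARD('d::finite) = inverse (fourier_scale TYPE('d))"
  by (simp add: fourier_scale_def powr_minus powr_half_sqrt[symmetric] powr_power)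

lemma exp_inner_borel [measurable]:
  "(\<lambda>y. exp (- \<i> * complex_of_real (x \<bullet> (y::'a::euclidean_space)))) \<in> borel_measurable borel"
  by (intro borel_measurable_continuous_UNIV continuous_intros)

lemma fourier_lborel:
  fixes f :: "real^'d::finite \<Rightarrow> complex"
  assumes "f \<in> borel_measurable borel"
  shows "fourier f x = fourier_scale TYPE('d) *\<^sub>R
    (LINT y|lborel. f y * exp (- \<i> * complex_of_real (x \<bullet> y)))"
  unfolding fourier_def fourier_scale_def scaleR_conv_of_real
  using assms by (subst lebesgue_integral_eq_lborel) (auto intro!: borel_measurable_times exp_inner_borel)

lemma integrable_mult_exp_inner:
  fixes f :: "real^'d::finite \<Rightarrow> complex"
  assumes "integrable M f" "sets M = sets borel"
  shows "integrable M (\<lambda>y. f y * exp (- \<i> * complex_of_real (x \<bullet> y)))"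
proof (rule Bochner_Integration.integrable_bound[OF assms(1)])
  have "f \<in> borel_measurable borel"
    using borel_measurable_integrable[OF assms(1)] assms(2) by (simp cong: measurable_cong_sets)
  then show "(\<lambda>y. f y * exp (- \<i> * complex_of_real (x \<bullet> y))) \<in> borel_measurable M"
    using assms(2) exp_inner_borel[of x] by (simp cong: measurable_cong_sets)
qed (auto simp: norm_mult)

lemma fourier_continuous:
  fixes f :: "real^'d::finite \<Rightarrow> complex"
  assumes "integrable lborel f"
  shows "continuous_on UNIV (fourier f)"
proof (rule continuous_at_imp_continuous_on, intro ballI)
  fix x :: "real^'d"
  have [measurable]: "f \<in> borel_measurable borel"
    using borel_measurable_integrable[OF assms] by simp
  have "(\<lambda>n. LINT y|lborel. f y * exp (- \<i> * complex_of_real (X n \<bullet> y)))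
      \<longlonglongrightarrow> (LINT y|lborel. f y * exp (- \<i> * complex_of_real (x \<bullet> y)))"
    if "X \<longlonglongrightarrow> x" for X
  proof (rule integral_dominated_convergence[where w = "\<lambda>y. norm (f y)"])
    show "AE y in lborel. (\<lambda>n. f y * exp (- \<i> * complex_of_real (X n \<bullet> y)))
        \<longlonglongrightarrow> f y * exp (- \<i> * complex_of_real (x \<bullet> y))"
      using that by (intro AE_I2 tendsto_intros)
  qed (use assms in \<open>auto simp: norm_mult\<close>)
  then show "isCont (fourier f) x"
    unfolding continuous_at_sequentially o_def
    by (simp add: fourier_lborel tendsto_scaleR)
qed

lemma fourier_bounded:
  fixes f :: "real^'d::finite \<Rightarrow> complex"
  assumes "integrable lborel f"
  shows "\<exists>C. \<forall>x. norm (fourier f x) \<le> C"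
proof -
  have [measurable]: "f \<in> borel_measurable borel"
    using borel_measurable_integrable[OF assms] by simp
  have "norm (fourier f x) \<le> fourier_scale TYPE('d) * (LINT y|lborel. norm (f y))" for x
  proof -
    have "norm (LINT y|lborel. f y * exp (- \<i> * complex_of_real (x \<bullet> y))) \<le>
        (LINT y|lborel. norm (f y * exp (- \<i> * complex_of_real (x \<bullet> y))))"
      by (rule integral_norm_bound)
    then have "norm (LINT y|lborel. f y * exp (- \<i> * complex_of_real (x \<bullet> y))) \<le>
        (LINT y|lborel. norm (f y))"
      by (simp add: norm_mult)
    from mult_left_mono[OF this less_imp_le[OF fourier_scale_pos[where 'd = 'd]]] show ?thesis
      by (simp add: fourier_lborel)
  qed
  then show ?thesis by blast
qed

text \<open>Fubini's theorem for a bounded kernel that is symmetric in its two arguments. This is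
  the mechanism by which the transform is moved from one factor to the other throughout.\<close>

lemma fourier_multiplication_formula:
  fixes u v :: "real^'d::finite \<Rightarrow> complex"
  assumes u: "integrable lborel u" and v: "integrable lborel v"
  shows "(LINT x|lborel. u x * fourier v x) = (LINT x|lborel. fourier u x * v x)"
proof -
  have [measurable]: "u \<in> borel_measurable borel" "v \<in> borel_measurable borel"
    using borel_measurable_integrable[OF u] borel_measurable_integrable[OF v] by auto
  let ?k = "\<lambda>x y. exp (- \<i> * complex_of_real ((x::real^'d) \<bullet> y))"
  have [measurable]: "(\<lambda>(x, y). ?k x y) \<in> borel_measurable (borel \<Otimes>\<^sub>M borel)"
    unfolding borel_prod case_prod_beta
    by (intro borel_measurable_continuous_UNIV continuous_intros)
  have int: "integrable (lborel \<Otimes>\<^sub>M lborel) (\<lambda>(x, y). u x * v y * ?k x y)"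
    by (rule lborel_integrable_product[OF u v]) auto
  have "(LINT x|lborel. u x * (LINT y|lborel. v y * ?k x y)) =
      (LINT x|lborel. (LINT y|lborel. u x * v y * ?k x y))"
    by (simp add: mult.assoc)
  also have "\<dots> = (LINT y|lborel. (LINT x|lborel. u x * v y * ?k x y))"
    by (rule lborel_pair.Fubini_integral[symmetric, OF int])
  also have "\<dots> = (LINT y|lborel. (LINT x|lborel. u x * ?k y x) * v y)"
    by (subst integral_mult_left_zero[symmetric]) (simp add: inner_commute mult_ac)
  finally show ?thesis
    by (simp add: fourier_lborel)
qed

lemma fourier_has_partial:
  assumes f: "f \<in> schwartz"
  shows "has_partial i (fourier f) (fourier (\<lambda>y. - \<i> * complex_of_real (y $ i) * f y))"
proof (rule has_partialI)
  fix x
  let ?e = "axis i 1"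
  have g: "(\<lambda>y. - \<i> * complex_of_real (y $ i) * f y) \<in> schwartz"
    by (intro FT_mult_schwartz FT_mult FT_const FT_coord f)
  have [measurable]: "f \<in> borel_measurable borel" by (rule schwartz_borel[OF f])
  have "((\<lambda>t. LINT y|lborel. f y * exp (- \<i> * complex_of_real ((x + t *\<^sub>R ?e) \<bullet> y))) has_vector_derivative
      (LINT y|lborel. (- \<i> * complex_of_real (y $ i) * f y) * exp (- \<i> * complex_of_real ((x + 0 *\<^sub>R ?e) \<bullet> y)))) (at 0)"
  proof (rule has_vector_derivative_integral[where B = "\<lambda>y. norm (- \<i> * complex_of_real (y $ i) * f y)"])
    show "integrable lborel (\<lambda>y. f y * exp (- \<i> * complex_of_real ((x + t *\<^sub>R ?e) \<bullet> y)))" for t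
      by (intro integrable_mult_exp_inner schwartz_integrable f) simp
    show "integrable lborel (\<lambda>y. norm (- \<i> * complex_of_real (y $ i) * f y))"
      by (intro integrable_norm schwartz_integrable g)
    fix t y
    have "((\<lambda>t. x \<bullet> y + t * (y $ i)) has_vector_derivative y $ i) (at t)"
      by (auto intro!: derivative_eq_intros simp flip: has_real_derivative_iff_has_vector_derivative)
    then have "((\<lambda>t. complex_of_real (x \<bullet> y + t * (y $ i))) has_vector_derivative complex_of_real (y $ i)) (at t)"
      by (intro has_vector_derivative_of_real) (simp add: has_real_derivative_iff_has_vector_derivative)
    then have "((\<lambda>t. - \<i> * complex_of_real (x \<bullet> y + t * (y $ i))) has_vector_derivative - \<i> * complex_of_real (y $ i)) (at t)"
      by (rule has_vector_derivative_mult_right)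
    then have "((exp \<circ> (\<lambda>t. - \<i> * complex_of_real (x \<bullet> y + t * (y $ i)))) has_vector_derivative
        - \<i> * complex_of_real (y $ i) * exp (- \<i> * complex_of_real (x \<bullet> y + t * (y $ i)))) (at t)"
      by (rule field_vector_diff_chain_at) (rule DERIV_exp)
    then have "((\<lambda>t. f y * exp (- \<i> * complex_of_real (x \<bullet> y + t * (y $ i)))) has_vector_derivative
        f y * (- \<i> * complex_of_real (y $ i) * exp (- \<i> * complex_of_real (x \<bullet> y + t * (y $ i))))) (at t)"
      unfolding o_def by (rule has_vector_derivative_mult_right)
    then show "((\<lambda>t. f y * exp (- \<i> * complex_of_real ((x + t *\<^sub>R ?e) \<bullet> y))) has_vector_derivative
        (- \<i> * complex_of_real (y $ i) * f y) * exp (- \<i> * complex_of_real ((x + t *\<^sub>R ?e) \<bullet> y))) (at t)"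
      by (simp add: inner_add_left inner_axis' mult_ac)
    show "norm ((- \<i> * complex_of_real (y $ i) * f y) * exp (- \<i> * complex_of_real ((x + t *\<^sub>R ?e) \<bullet> y))) \<le>
        norm (- \<i> * complex_of_real (y $ i) * f y)"
      by (simp add: norm_mult)
  next
    have [measurable]: "(\<lambda>y. - \<i> * complex_of_real (y $ i) * f y) \<in> borel_measurable borel"
      by (rule schwartz_borel[OF g])
    show "(\<lambda>y. (- \<i> * complex_of_real (y $ i) * f y) * exp (- \<i> * complex_of_real ((x + 0 *\<^sub>R ?e) \<bullet> y)))
        \<in> borel_measurable lborel"
      using exp_inner_borel[of "x + 0 *\<^sub>R ?e"] by measurable
  qed
  from bounded_linear.has_vector_derivative[OF bounded_linear_scaleR_right this,
      where r1 = "fourier_scale TYPE('a)"]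
  show "((\<lambda>t. fourier f (x + t *\<^sub>R ?e)) has_vector_derivative
      fourier (\<lambda>y. - \<i> * complex_of_real (y $ i) * f y) x) (at 0)"
    using schwartz_borel[OF f] schwartz_borel[OF g]
    by (simp add: fourier_lborel)
qed

text \<open>By translation invariance the integral of f(y + t e) does not depend on t;
  differentiating under the integral sign gives the claim. This takes the place of integration by
  parts.\<close>

lemma integral_partial_eq_0:
  assumes f: "f \<in> schwartz"
  shows "(LINT y|lborel. partial_derivative i f y) = 0"
proof -
  let ?e = "axis i 1 :: real^'a"
  let ?f' = "partial_derivative i f"
  have [measurable]: "f \<in> borel_measurable borel" by (rule schwartz_borel[OF f])
  have f': "?f' \<in> schwartz" by (rule schwartz_partial[OF f])
  obtain C where C: "\<And>x. weight x ^ CARD('a) * norm (?f' x) \<le> C"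
    using schwartz_rapid[OF f'] unfolding rapid_def by blast
  have C0: "0 \<le> C" by (rule order_trans[OF _ C[of 0]]) simp
  have "((\<lambda>t. LINT y|lborel. f (y + t *\<^sub>R ?e)) has_vector_derivative
      (LINT y|lborel. ?f' (y + 0 *\<^sub>R ?e))) (at 0)"
  proof (rule has_vector_derivative_integral[where B = "\<lambda>y. C * 4 ^ CARD('a) * inverse (weight y ^ CARD('a))"])
    show "integrable lborel (\<lambda>y. f (y + t *\<^sub>R ?e))" for t
      using lborel_integrable_affine[of 1 f "t *\<^sub>R ?e"] schwartz_integrable[OF f]
      by (simp add: add.commute)
    show "integrable lborel (\<lambda>y::real^'a. C * 4 ^ CARD('a) * inverse (weight y ^ CARD('a)))"
      by (intro integrable_mult_right integrable_inverse_weight)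
    show "((\<lambda>t. f (y + t *\<^sub>R ?e)) has_vector_derivative ?f' (y + t *\<^sub>R ?e)) (at t)" for t y
      by (rule has_partial_at[OF schwartz_has_partial[OF f]])
    show "(\<lambda>y. ?f' (y + 0 *\<^sub>R ?e)) \<in> borel_measurable lborel"
      using schwartz_borel[OF f'] by simp
    fix t :: real and y :: "real^'a" assume t: "\<bar>t\<bar> \<le> 1"
    define z where "z = y + t *\<^sub>R ?e"
    \<comment> \<open>Peetre's inequality and \<open>weight ?e = 2\<close> give
      \<open>weight y \<le> 4 * weight z\<close> whenever |t| <= 1. Decay of the derivative at the
      moved point \<open>z\<close> thereby becomes decay in \<open>y\<close>, uniformly in
      \<open>t\<close>.\<close>
    have "weight y = weight (z + (- t) *\<^sub>R ?e)" by (simp add: z_def)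
    also have "\<dots> \<le> 2 * weight z * weight ((- t) *\<^sub>R ?e)" by (rule weight_add)
    also have "\<dots> \<le> 2 * weight z * weight ?e"
      using t by (intro mult_left_mono weight_scaleR) auto
    also have "weight ?e = 2" by (simp add: weight_def)
    finally have "weight y ^ CARD('a) \<le> (4 * weight z) ^ CARD('a)"
      by (intro power_mono) auto
    then have "norm (?f' z) * weight y ^ CARD('a) \<le> norm (?f' z) * (4 * weight z) ^ CARD('a)"
      by (intro mult_left_mono) auto
    also have "\<dots> = 4 ^ CARD('a) * (weight z ^ CARD('a) * norm (?f' z))"
      by (simp add: power_mult_distrib)
    also have "\<dots> \<le> 4 ^ CARD('a) * C" using C by (intro mult_left_mono) auto
    finally show "norm (?f' (y + t *\<^sub>R ?e)) \<le> C * 4 ^ CARD('a) * inverse (weight y ^ CARD('a))"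
      unfolding z_def[symmetric] by (simp add: divide_simps mult.commute)
  qed
  moreover have "(LINT y|lborel. f (y + t *\<^sub>R ?e)) = (LINT y|lborel. f y)" for t
    using lborel_integral_affine[of 1 f "t *\<^sub>R ?e"] by (simp add: add.commute)
  ultimately have "((\<lambda>t::real. LINT y|lborel. f y) has_vector_derivative (LINT y|lborel. ?f' y)) (at 0)"
    by simp
  then show ?thesis
    using vector_derivative_at[OF has_vector_derivative_const] by (metis vector_derivative_at)
qed

text \<open>Integration by parts: the integral of a partial derivative of f times a character
  vanishes, and the character reproduces itself with the factor -i x_i when differentiated.\<close>

lemma fourier_partial:
  assumes f: "f \<in> schwartz"
  shows "fourier (partial_derivative i f) x = \<i> * complex_of_real (x $ i) * fourier f x"
proof -
  let ?E = "\<lambda>y. exp (\<i> * complex_of_real ((- x) \<bullet> y))"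
  have E: "?E \<in> FT" by (rule FT_cexp)
  have fE: "(\<lambda>y. f y * ?E y) \<in> schwartz" by (rule schwartz_mult_FT[OF f E])
  have pE: "has_partial i ?E (\<lambda>y. - \<i> * complex_of_real (x $ i) * ?E y)"
  proof (rule has_partialI)
    fix y
    have "((\<lambda>t. - (x \<bullet> y + t * (x $ i))) has_vector_derivative - (x $ i)) (at 0)"
      by (auto intro!: derivative_eq_intros simp flip: has_real_derivative_iff_has_vector_derivative)
    then have "((\<lambda>t. complex_of_real (- (x \<bullet> y + t * (x $ i)))) has_vector_derivative complex_of_real (- (x $ i))) (at 0)"
      by (intro has_vector_derivative_of_real) (simp add: has_real_derivative_iff_has_vector_derivative)
    then have "((\<lambda>t. \<i> * complex_of_real (- (x \<bullet> y + t * (x $ i)))) has_vector_derivative \<i> * complex_of_real (- (x $ i))) (at 0)"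
      by (rule has_vector_derivative_mult_right)
    then have "((exp \<circ> (\<lambda>t. \<i> * complex_of_real (- (x \<bullet> y + t * (x $ i))))) has_vector_derivative
        \<i> * complex_of_real (- (x $ i)) * exp (\<i> * complex_of_real (- (x \<bullet> y + 0 * (x $ i))))) (at 0)"
      by (rule field_vector_diff_chain_at) (rule DERIV_exp)
    then show "((\<lambda>t. ?E (y + t *\<^sub>R axis i 1)) has_vector_derivative - \<i> * complex_of_real (x $ i) * ?E y) (at 0)"
      by (simp add: o_def inner_add_right inner_axis)
  qed
  have "partial_derivative i (\<lambda>y. f y * ?E y) =
      (\<lambda>y. f y * (- \<i> * complex_of_real (x $ i) * ?E y) + partial_derivative i f y * ?E y)"
    by (intro has_partial_imp_partial_derivative has_partial_mult schwartz_has_partial f pE)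
  then have "0 = (LINT y|lborel. f y * (- \<i> * complex_of_real (x $ i) * ?E y) + partial_derivative i f y * ?E y)"
    using integral_partial_eq_0[OF fE, of i] by simp
  also have "\<dots> = (LINT y|lborel. (- \<i> * complex_of_real (x $ i)) * (f y * ?E y)) +
      (LINT y|lborel. partial_derivative i f y * ?E y)"
  proof (subst Bochner_Integration.integral_add[symmetric])
    show "integrable lborel (\<lambda>y. (- \<i> * complex_of_real (x $ i)) * (f y * ?E y))"
      by (intro integrable_mult_right schwartz_integrable fE)
    show "integrable lborel (\<lambda>y. partial_derivative i f y * ?E y)"
      by (intro schwartz_integrable schwartz_mult_FT schwartz_partial f E)
  qed (simp add: mult_ac)
  also have "(LINT y|lborel. (- \<i> * complex_of_real (x $ i)) * (f y * ?E y)) =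
      (- \<i> * complex_of_real (x $ i)) * (LINT y|lborel. f y * ?E y)"
    by (rule integral_mult_right_zero)
  finally have h0: "0 = (- \<i> * complex_of_real (x $ i)) * (LINT y|lborel. f y * ?E y) +
      (LINT y|lborel. partial_derivative i f y * ?E y)" .
  have "J = a * b * I" if "0 = (- a * b) * I + J" for a b I J :: complex
    using that by (simp add: algebra_simps)
  note h = this[OF h0]
  have conv: "?E y = exp (- \<i> * complex_of_real (x \<bullet> y))" for y
    by simp
  show ?thesis
    by (simp only: fourier_lborel[OF schwartz_borel[OF f]]
        fourier_lborel[OF schwartz_borel[OF schwartz_partial[OF f, of i]]]
        h[unfolded conv] scaleR_conv_of_real mult_ac)
qed

lemma fourier_add:
  fixes f g :: "real^'d::finite \<Rightarrow> complex"
  assumes "integrable lborel f" "integrable lborel g"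
  shows "fourier (\<lambda>y. f y + g y) x = fourier f x + fourier g x"
proof -
  have [measurable]: "f \<in> borel_measurable borel" "g \<in> borel_measurable borel"
    using assms[THEN borel_measurable_integrable] by auto
  show ?thesis
    using integrable_mult_exp_inner[OF assms(1), of x] integrable_mult_exp_inner[OF assms(2), of x]
    by (simp add: fourier_lborel distrib_right scaleR_add_right)
qed

lemma fourier_scaleC:
  fixes f :: "real^'d::finite \<Rightarrow> complex"
  shows "fourier (\<lambda>y. c * f y) x = c * fourier f x"
  by (simp add: fourier_def mult.assoc)

text \<open>Multiplication by the weight on the Fourier side is the operator 1 minus the Laplacian;
  the function \<open>g\<close> is its N-th power applied to \<open>f\<close>.\<close>

lemma weight_fourier:
  assumes f: "f \<in> schwartz"
  shows "\<exists>g\<in>schwartz. \<forall>x. complex_of_real (weight x ^ N) * fourier f x = fourier g x"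
proof (induction N)
  case 0
  then show ?case using f by (intro bexI[of _ f]) auto
next
  case (Suc N)
  then obtain g where g: "g \<in> schwartz" "\<And>x. complex_of_real (weight x ^ N) * fourier f x = fourier g x"
    by blast
  let ?D = "\<lambda>i. partial_derivative i (partial_derivative i g)"
  have D: "?D i \<in> schwartz" for i by (intro schwartz_partial g)
  have S: "(\<lambda>y. \<Sum>i\<in>A. ?D i y) \<in> schwartz \<and>
      (\<forall>x. fourier (\<lambda>y. \<Sum>i\<in>A. ?D i y) x = (\<Sum>i\<in>A. fourier (?D i) x))" if "finite A" for A
    using that
  proof induction
    case empty
    show ?case by (simp add: schwartz_zero fourier_def)
  next
    case (insert i A)
    then show ?case
      using fourier_add[OF schwartz_integrable schwartz_integrable, of "?D i" "\<lambda>y. \<Sum>i\<in>A. ?D i y"] D[of i]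
      by (auto intro!: schwartz_add)
  qed
  let ?h = "\<lambda>y. g y + (-1) * (\<Sum>i\<in>UNIV. ?D i y)"
  have h: "?h \<in> schwartz" using S[OF finite] by (intro schwartz_add schwartz_scale g) auto
  have "complex_of_real (weight x ^ Suc N) * fourier f x = fourier ?h x" for x
  proof -
    have n: "(norm x)\<^sup>2 = (\<Sum>i\<in>UNIV. x $ i * x $ i)"
      by (simp add: norm_vec_def L2_set_def sum_nonneg power2_eq_square)
    have "fourier ?h x = fourier g x + fourier (\<lambda>y. (-1) * (\<Sum>i\<in>UNIV. ?D i y)) x"
      using S[OF finite]
      by (intro fourier_add schwartz_integrable schwartz_scale g) auto
    also have "fourier (\<lambda>y. (-1) * (\<Sum>i\<in>UNIV. ?D i y)) x = (-1) * fourier (\<lambda>y. \<Sum>i\<in>UNIV. ?D i y) x"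
      by (rule fourier_scaleC)
    also have "fourier (\<lambda>y. \<Sum>i\<in>UNIV. ?D i y) x = (\<Sum>i\<in>UNIV. fourier (?D i) x)"
      using S[OF finite] by blast
    also have "\<dots> = (\<Sum>i\<in>UNIV. - complex_of_real (x $ i * x $ i) * fourier g x)"
    proof (intro sum.cong refl)
      fix i
      have "\<i> * a * (\<i> * a * F) = - (a * a) * F" for a F :: complex
      proof -
        have "\<i> * a * (\<i> * a * F) = \<i> * (\<i> * (a * a * F))" by (simp only: mult_ac)
        then show ?thesis by simp
      qed
      then show "fourier (?D i) x = - complex_of_real (x $ i * x $ i) * fourier g x"
        by (simp add: fourier_partial g schwartz_partial)
    qed
    also have "\<dots> = - complex_of_real ((norm x)\<^sup>2) * fourier g x"
      by (simp only: n of_real_sum sum_distrib_right sum_negf mult_minus_left)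
    finally show ?thesis
      by (simp add: weight_def algebra_simps g(2)[symmetric])
  qed
  with h show ?case by blast
qed

text \<open>The set of transforms of Schwartz functions is stable under partials, because these
  correspond to multiplication by coordinates. Rapid decay holds since the transform times any power
  of the weight is again a transform, hence bounded.\<close>

lemma fourier_schwartz:
  fixes f :: "real^'d::finite \<Rightarrow> complex"
  assumes "f \<in> schwartz"
  shows "fourier f \<in> schwartz"
proof -
  have "fourier ` schwartz \<subseteq> (schwartz :: (real^'d \<Rightarrow> complex) set)"
  proof (rule schwartz_coinduct)
    fix g :: "real^'d \<Rightarrow> complex" and i assume "g \<in> fourier ` schwartz"
    then obtain f where f: "f \<in> schwartz" "g = fourier f" by blast
    have "(\<lambda>y. - \<i> * complex_of_real (y $ i) * f y) \<in> schwartz"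
      by (intro FT_mult_schwartz FT_mult FT_const FT_coord f)
    with fourier_has_partial[OF f(1), of i] f(2)
    show "\<exists>f'\<in>fourier ` schwartz. has_partial i g f'" by blast
  next
    fix g :: "real^'d \<Rightarrow> complex" assume "g \<in> fourier ` schwartz"
    then obtain f where f: "f \<in> schwartz" "g = fourier f" by blast
    show "continuous_on UNIV g"
      unfolding f(2) by (intro fourier_continuous schwartz_integrable f)
    show "rapid g" unfolding rapid_def
    proof
      fix N
      obtain h where h: "h \<in> schwartz" "\<And>x. complex_of_real (weight x ^ N) * fourier f x = fourier h x"
        using weight_fourier[OF f(1)] by blast
      obtain C where C: "\<And>x. norm (fourier h x) \<le> C"
        using fourier_bounded[OF schwartz_integrable[OF h(1)]] by blast
      have "weight x ^ N * norm (g x) \<le> C" for x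
        using C[of x] unfolding h(2)[symmetric] f(2) by (simp add: norm_mult norm_power)
      then show "\<exists>C. \<forall>x. weight x ^ N * norm (g x) \<le> C" by blast
    qed
  qed
  then show ?thesis using assms by blast
qed

subsection \<open>Square-integrable functions\<close>

text \<open>Functions are kept instead of classes modulo null sets, and the measure is arbitrary so
  that the kernel construction below can be carried out for an abstract feature map.\<close>

definition square_integrable :: "'a measure \<Rightarrow> ('a \<Rightarrow> complex) set" where
  "square_integrable M = {f \<in> borel_measurable M. integrable M (\<lambda>x. (norm (f x))\<^sup>2)}"

definition l2_inner :: "'a measure \<Rightarrow> ('a \<Rightarrow> complex) \<Rightarrow> ('a \<Rightarrow> complex) \<Rightarrow> complex" where
  "l2_inner M f g = (LINT x|M. f x * cnj (g x))"

definition l2_norm2 :: "'a measure \<Rightarrow> ('a \<Rightarrow> complex) \<Rightarrow> real" where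
  "l2_norm2 M f = (LINT x|M. (norm (f x))\<^sup>2)"

text \<open>Membership of all terms and of the limit is included because the integral of a
  non-integrable function is 0 by convention, so that small values of \<open>l2_norm2\<close> alone
  would say nothing.\<close>

definition l2_tendsto :: "'a measure \<Rightarrow> (nat \<Rightarrow> 'a \<Rightarrow> complex) \<Rightarrow> ('a \<Rightarrow> complex) \<Rightarrow> bool" where
  "l2_tendsto M u f \<longleftrightarrow> (\<forall>n. u n \<in> square_integrable M) \<and> f \<in> square_integrable M \<and>
     (\<lambda>n. l2_norm2 M (\<lambda>x. u n x - f x)) \<longlonglongrightarrow> 0"

definition l2_cauchy :: "'a measure \<Rightarrow> (nat \<Rightarrow> 'a \<Rightarrow> complex) \<Rightarrow> bool" where
  "l2_cauchy M u \<longleftrightarrow> (\<forall>n. u n \<in> square_integrable M) \<and>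
     (\<forall>e>0. \<exists>K. \<forall>k\<ge>K. \<forall>l\<ge>K. l2_norm2 M (\<lambda>x. u k x - u l x) < e)"

lemma square_integrableD:
  assumes "f \<in> square_integrable M"
  shows "f \<in> borel_measurable M" "integrable M (\<lambda>x. (norm (f x))\<^sup>2)"
  using assms by (auto simp: square_integrable_def)

lemma square_integrable_scale:
  "f \<in> square_integrable M \<Longrightarrow> (\<lambda>x. c * f x) \<in> square_integrable M"
  by (auto simp: square_integrable_def norm_mult power_mult_distrib)

lemma square_integrable_add:
  assumes "f \<in> square_integrable M" "g \<in> square_integrable M"
  shows "(\<lambda>x. f x + g x) \<in> square_integrable M"
proof -
  note [measurable] = square_integrableD(1)[OF assms(1)] square_integrableD(1)[OF assms(2)]
  have "integrable M (\<lambda>x. (norm (f x + g x))\<^sup>2)"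
  proof (rule Bochner_Integration.integrable_bound)
    show "integrable M (\<lambda>x. 2 * (norm (f x))\<^sup>2 + 2 * (norm (g x))\<^sup>2)"
      using square_integrableD(2)[OF assms(1)] square_integrableD(2)[OF assms(2)] by auto
  qed (auto simp: norm_add_power2_le)
  then show ?thesis by (auto simp: square_integrable_def)
qed

lemma square_integrable_diff:
  "f \<in> square_integrable M \<Longrightarrow> g \<in> square_integrable M \<Longrightarrow> (\<lambda>x. f x - g x) \<in> square_integrable M"
  using square_integrable_add[of f M "\<lambda>x. (-1) * g x"] square_integrable_scale[of g M "-1"] by simp

lemma square_integrable_sum:
  "finite A \<Longrightarrow> (\<And>a. a \<in> A \<Longrightarrow> f a \<in> square_integrable M) \<Longrightarrow> (\<lambda>x. \<Sum>a\<in>A. f a x) \<in> square_integrable M"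
proof (induction rule: finite_induct)
  case empty
  show ?case by (simp add: square_integrable_def)
qed (auto intro: square_integrable_add)

lemma borel_measurable_cnj [measurable]:
  "f \<in> borel_measurable M \<Longrightarrow> (\<lambda>x. cnj (f x)) \<in> borel_measurable M"
  by (rule measurable_compose[OF _ borel_measurable_continuous_onI[OF continuous_on_cnj[OF continuous_on_id]]])

lemma l2_integrable:
  assumes "f \<in> square_integrable M" "g \<in> square_integrable M"
  shows "integrable M (\<lambda>x. f x * g x)" "integrable M (\<lambda>x. f x * cnj (g x))"
proof -
  note [measurable] = square_integrableD(1)[OF assms(1)] square_integrableD(1)[OF assms(2)]
  have i: "integrable M (\<lambda>x. (norm (f x))\<^sup>2 + (norm (g x))\<^sup>2)"
    using square_integrableD(2)[OF assms(1)] square_integrableD(2)[OF assms(2)] by auto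
  have b: "norm (f x) * norm (g x) \<le> (norm (f x))\<^sup>2 + (norm (g x))\<^sup>2" for x
  proof -
    have "2 * (norm (f x) * norm (g x)) \<le> (norm (f x))\<^sup>2 + (norm (g x))\<^sup>2"
      using zero_le_power2[of "norm (f x) - norm (g x)"] by (simp add: power2_diff)
    moreover have "0 \<le> norm (f x) * norm (g x)" by simp
    ultimately show ?thesis by linarith
  qed
  show "integrable M (\<lambda>x. f x * g x)" "integrable M (\<lambda>x. f x * cnj (g x))"
    by (rule Bochner_Integration.integrable_bound[OF i]; use b in \<open>auto simp: norm_mult\<close>)+
qed

lemma l2_norm2_nonneg [simp]: "0 \<le> l2_norm2 M f"
  by (simp add: l2_norm2_def)

lemma l2_inner_self: "l2_inner M f f = complex_of_real (l2_norm2 M f)"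
  by (simp add: l2_inner_def l2_norm2_def complex_norm_square[symmetric] del: of_real_power)

lemma l2_inner_cnj: "l2_inner M g f = cnj (l2_inner M f g)"
  unfolding l2_inner_def by (subst Bochner_Integration.integral_cnj[symmetric]) (simp add: mult.commute)

lemma l2_inner_diff_left:
  "f \<in> square_integrable M \<Longrightarrow> g \<in> square_integrable M \<Longrightarrow> h \<in> square_integrable M \<Longrightarrow>
   l2_inner M (\<lambda>x. f x - g x) h = l2_inner M f h - l2_inner M g h"
  by (simp add: l2_inner_def left_diff_distrib l2_integrable)

lemma l2_inner_diff_right:
  "f \<in> square_integrable M \<Longrightarrow> g \<in> square_integrable M \<Longrightarrow> h \<in> square_integrable M \<Longrightarrow>
   l2_inner M h (\<lambda>x. f x - g x) = l2_inner M h f - l2_inner M h g"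
  using l2_inner_diff_left[of f M g h] by (simp add: l2_inner_cnj[of M h])

lemma l2_inner_scale_left: "l2_inner M (\<lambda>x. c * f x) h = c * l2_inner M f h"
  by (simp add: l2_inner_def mult.assoc)

lemma l2_inner_scale_right: "l2_inner M h (\<lambda>x. c * f x) = cnj c * l2_inner M h f"
  by (simp add: l2_inner_cnj[of M h] l2_inner_scale_left)

lemma l2_inner_sum_left:
  "finite A \<Longrightarrow> (\<And>a. a \<in> A \<Longrightarrow> f a \<in> square_integrable M) \<Longrightarrow> h \<in> square_integrable M \<Longrightarrow>
   l2_inner M (\<lambda>x. \<Sum>a\<in>A. f a x) h = (\<Sum>a\<in>A. l2_inner M (f a) h)"
  by (simp add: l2_inner_def sum_distrib_right l2_integrable)

lemma l2_inner_sum_right: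
  "finite A \<Longrightarrow> (\<And>a. a \<in> A \<Longrightarrow> f a \<in> square_integrable M) \<Longrightarrow> h \<in> square_integrable M \<Longrightarrow>
   l2_inner M h (\<lambda>x. \<Sum>a\<in>A. f a x) = (\<Sum>a\<in>A. l2_inner M h (f a))"
  by (simp add: l2_inner_cnj[of M h] l2_inner_sum_left)

lemma l2_norm2_scale: "l2_norm2 M (\<lambda>x. c * f x) = (norm c)\<^sup>2 * l2_norm2 M f"
  by (simp add: l2_norm2_def norm_mult power_mult_distrib)

lemma l2_norm2_minus_commute: "l2_norm2 M (\<lambda>x. f x - g x) = l2_norm2 M (\<lambda>x. g x - f x)"
  by (simp add: l2_norm2_def norm_minus_commute)

lemma l2_norm2_add_le:
  assumes "f \<in> square_integrable M" "g \<in> square_integrable M"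
  shows "l2_norm2 M (\<lambda>x. f x + g x) \<le> 2 * l2_norm2 M f + 2 * l2_norm2 M g"
proof -
  have "l2_norm2 M (\<lambda>x. f x + g x) \<le> (LINT x|M. 2 * (norm (f x))\<^sup>2 + 2 * (norm (g x))\<^sup>2)"
    unfolding l2_norm2_def
    using square_integrableD[OF square_integrable_add[OF assms]] square_integrableD[OF assms(1)]
      square_integrableD[OF assms(2)]
    by (intro integral_mono norm_add_power2_le) auto
  then show ?thesis
    using square_integrableD[OF assms(1)] square_integrableD[OF assms(2)] by (simp add: l2_norm2_def)
qed

lemma l2_norm2_diff_le:
  assumes "f \<in> square_integrable M" "g \<in> square_integrable M" "h \<in> square_integrable M"
  shows "l2_norm2 M (\<lambda>x. f x - h x) \<le> 2 * l2_norm2 M (\<lambda>x. f x - g x) + 2 * l2_norm2 M (\<lambda>x. g x - h x)"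
  using l2_norm2_add_le[OF square_integrable_diff[OF assms(1,2)] square_integrable_diff[OF assms(2,3)]] by simp

lemma l2_norm2_diff_expand:
  assumes "f \<in> square_integrable M" "g \<in> square_integrable M"
  shows "l2_norm2 M (\<lambda>x. f x - g x) = l2_norm2 M f - 2 * Re (l2_inner M f g) + l2_norm2 M g"
proof -
  have d: "(\<lambda>x. f x - g x) \<in> square_integrable M" by (rule square_integrable_diff[OF assms])
  have "complex_of_real (l2_norm2 M (\<lambda>x. f x - g x)) =
      complex_of_real (l2_norm2 M f) - l2_inner M f g - (cnj (l2_inner M f g) - complex_of_real (l2_norm2 M g))"
    unfolding l2_inner_self[symmetric] l2_inner_cnj[of M g f, symmetric]
    by (simp add: l2_inner_diff_left[OF assms d] l2_inner_diff_right assms)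
  then have "Re (complex_of_real (l2_norm2 M (\<lambda>x. f x - g x))) =
      Re (complex_of_real (l2_norm2 M f) - l2_inner M f g - (cnj (l2_inner M f g) - complex_of_real (l2_norm2 M g)))"
    by simp
  then show ?thesis by simp
qed

text \<open>Nonnegativity of the squared distance from f to t c g for real t, where c is the inner
  product; the factor c makes the cross term real.\<close>

lemma l2_Cauchy_Schwarz:
  assumes "f \<in> square_integrable M" "g \<in> square_integrable M"
  shows "(norm (l2_inner M f g))\<^sup>2 \<le> l2_norm2 M f * l2_norm2 M g"
proof -
  let ?c = "l2_inner M f g"
  have key: "0 \<le> l2_norm2 M f - 2 * t * (norm ?c)\<^sup>2 + t\<^sup>2 * (norm ?c)\<^sup>2 * l2_norm2 M g" for t :: real
  proof -
    let ?g = "\<lambda>x. (of_real t * ?c) * g x"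
    have "0 \<le> l2_norm2 M (\<lambda>x. f x - ?g x)" by simp
    also have "\<dots> = l2_norm2 M f - 2 * Re (l2_inner M f ?g) + l2_norm2 M ?g"
      by (intro l2_norm2_diff_expand square_integrable_scale assms)
    also have "l2_inner M f ?g = of_real t * (?c * cnj ?c)"
      unfolding l2_inner_scale_right by (simp add: mult_ac)
    also have "\<dots> = of_real (t * (norm ?c)\<^sup>2)"
      by (simp add: complex_norm_square[symmetric] del: of_real_power)
    also have "l2_norm2 M ?g = t\<^sup>2 * (norm ?c)\<^sup>2 * l2_norm2 M g"
      by (simp add: l2_norm2_scale norm_mult power_mult_distrib)
    finally show ?thesis by simp
  qed
  show ?thesis
  proof (cases "l2_norm2 M g = 0")
    \<comment> \<open>A seminorm may vanish on \<open>g\<close> without \<open>g\<close> being zero.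
      Here the expression is affine in t, and the chosen t would make it equal to
      \<open>- l2_norm2 M f - 2\<close>.\<close>
    case True
    have "(norm ?c)\<^sup>2 = 0"
    proof (rule ccontr)
      assume n: "(norm ?c)\<^sup>2 \<noteq> 0"
      then have p: "(norm ?c)\<^sup>2 > 0" by simp
      have "0 \<le> l2_norm2 M f - 2 * ((l2_norm2 M f + 1) / (norm ?c)\<^sup>2) * (norm ?c)\<^sup>2"
        using key[of "(l2_norm2 M f + 1) / (norm ?c)\<^sup>2"] True by simp
      also have "\<dots> = - l2_norm2 M f - 2" using n by simp
      finally show False using l2_norm2_nonneg[of M f] by linarith
    qed
    then show ?thesis using True by simp
  next
    case False
    then have g: "l2_norm2 M g > 0" using l2_norm2_nonneg[of M g] by linarith
    have "0 \<le> l2_norm2 M f - (norm ?c)\<^sup>2 / l2_norm2 M g"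
      using key[of "1 / l2_norm2 M g"] g by (simp add: power2_eq_square field_simps)
    then show ?thesis using g by (simp add: field_simps)
  qed
qed

lemma l2_tendstoD:
  assumes "l2_tendsto M u f"
  shows "u n \<in> square_integrable M" "f \<in> square_integrable M"
    "(\<lambda>n. l2_norm2 M (\<lambda>x. u n x - f x)) \<longlonglongrightarrow> 0"
  using assms by (auto simp: l2_tendsto_def)

lemma l2_tendsto_const: "f \<in> square_integrable M \<Longrightarrow> l2_tendsto M (\<lambda>n. f) f"
  by (simp add: l2_tendsto_def l2_norm2_def)

lemma l2_tendsto_inner:
  assumes u: "l2_tendsto M u f" and v: "l2_tendsto M v g"
  shows "(\<lambda>n. l2_inner M (u n) (v n)) \<longlonglongrightarrow> l2_inner M f g"
proof -
  note [simp] = l2_tendstoD(1,2)[OF u] l2_tendstoD(1,2)[OF v]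
  have lim0: "(\<lambda>n. l2_inner M (a n) (b n)) \<longlonglongrightarrow> 0"
    if a: "\<And>n. a n \<in> square_integrable M" and b: "\<And>n. b n \<in> square_integrable M"
      and la: "(\<lambda>n. l2_norm2 M (a n)) \<longlonglongrightarrow> 0" and B: "\<And>n. l2_norm2 M (b n) \<le> B" for a b B
  proof -
    have "(\<lambda>n. (norm (l2_inner M (a n) (b n)))\<^sup>2) \<longlonglongrightarrow> 0"
    proof (rule tendsto_sandwich[OF _ _ tendsto_const])
      show "(\<lambda>n. l2_norm2 M (a n) * B) \<longlonglongrightarrow> 0"
        using tendsto_mult_right[OF la, of B] by simp
      show "\<forall>\<^sub>F n in sequentially. (norm (l2_inner M (a n) (b n)))\<^sup>2 \<le> l2_norm2 M (a n) * B"
        using l2_Cauchy_Schwarz[OF a b] B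
        by (intro always_eventually allI order_trans[OF l2_Cauchy_Schwarz[OF a b]] mult_left_mono) auto
    qed auto
    then have "(\<lambda>n. sqrt ((norm (l2_inner M (a n) (b n)))\<^sup>2)) \<longlonglongrightarrow> sqrt 0"
      by (rule tendsto_real_sqrt)
    then show ?thesis by (simp add: tendsto_norm_zero_iff)
  qed
  have sw: "(\<lambda>n. l2_inner M (b n) (a n)) \<longlonglongrightarrow> 0" if "(\<lambda>n. l2_inner M (a n) (b n)) \<longlonglongrightarrow> 0" for a b
    using tendsto_cnj[OF that] by (simp add: l2_inner_cnj[symmetric])
  have "Bseq (\<lambda>n. l2_norm2 M (\<lambda>x. v n x - g x))"
    using l2_tendstoD(3)[OF v] by (rule convergent_imp_Bseq[OF convergentI])
  then obtain K where K: "\<And>n. l2_norm2 M (\<lambda>x. v n x - g x) \<le> K"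
    unfolding Bseq_def by (auto simp: abs_of_nonneg)
  have vb: "l2_norm2 M (v n) \<le> 2 * K + 2 * l2_norm2 M g" for n
  proof -
    have "l2_norm2 M (\<lambda>x. (v n x - g x) + g x) \<le> 2 * l2_norm2 M (\<lambda>x. v n x - g x) + 2 * l2_norm2 M g"
      by (intro l2_norm2_add_le square_integrable_diff) simp_all
    then show ?thesis using K[of n] by simp
  qed
  have 1: "(\<lambda>n. l2_inner M (\<lambda>x. u n x - f x) (v n)) \<longlonglongrightarrow> 0"
    by (rule lim0[OF _ _ l2_tendstoD(3)[OF u] vb]) (auto intro: square_integrable_diff)
  have 2: "(\<lambda>n. l2_inner M f (\<lambda>x. v n x - g x)) \<longlonglongrightarrow> 0"
    by (rule sw, rule lim0[OF _ _ l2_tendstoD(3)[OF v], where B = "l2_norm2 M f"])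
      (auto intro: square_integrable_diff)
  have "l2_inner M (u n) (v n) = l2_inner M f g + (l2_inner M (\<lambda>x. u n x - f x) (v n) + l2_inner M f (\<lambda>x. v n x - g x))" for n
    by (simp add: l2_inner_diff_left l2_inner_diff_right)
  then show ?thesis
    using tendsto_add[OF tendsto_const[of "l2_inner M f g"] tendsto_add[OF 1 2]] by simp
qed

lemma l2_norm2_eq_0:
  assumes "f \<in> square_integrable M" "l2_norm2 M f = 0"
  shows "AE x in M. f x = 0"
  using assms integral_nonneg_eq_0_iff_AE[of M "\<lambda>x. (norm (f x))\<^sup>2"]
  by (auto simp: l2_norm2_def square_integrable_def)

lemma l2_tendsto_cauchy:
  assumes "l2_tendsto M u f"
  shows "l2_cauchy M u"
  unfolding l2_cauchy_def
proof (intro conjI allI impI)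
  fix e :: real assume "0 < e"
  note lim = l2_tendstoD[OF assms]
  obtain K where K: "\<And>n. n \<ge> K \<Longrightarrow> l2_norm2 M (\<lambda>x. u n x - f x) < e / 4"
    using LIMSEQ_D[OF lim(3), of "e / 4"] \<open>0 < e\<close> by auto
  have "l2_norm2 M (\<lambda>x. u k x - u l x) < e" if "k \<ge> K" "l \<ge> K" for k l
    using l2_norm2_diff_le[OF lim(1)[of k] lim(2) lim(1)[of l]] K[OF that(1)] K[OF that(2)]
    by (simp add: l2_norm2_minus_commute[of M f])
  then show "\<exists>K. \<forall>k\<ge>K. \<forall>l\<ge>K. l2_norm2 M (\<lambda>x. u k x - u l x) < e" by blast
qed (use l2_tendstoD(1)[OF assms] in auto)

text \<open>
  Along a subsequence with \<open>\<parallel>u\<^bsub>k+1\<^esub> - u\<^bsub>k\<^esub>\<parallel>\<^sup>2 < 8\<^sup>-\<^sup>k\<close> the function \<open>\<Sum>\<^sub>k 4\<^sup>k |u\<^bsub>k+1\<^esub> - u\<^bsub>k\<^esub>|\<^sup>2\<close> is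
  integrable, hence finite almost everywhere, and where it is finite the increments are \<open>O(2\<^sup>-\<^sup>k)\<close>.
\<close>
lemma l2_complete:
  assumes c: "l2_cauchy M u"
  shows "\<exists>f. l2_tendsto M u f"
proof -
  have sq: "\<And>n. u n \<in> square_integrable M"
    and C: "\<And>e. e > 0 \<Longrightarrow> \<exists>K. \<forall>k\<ge>K. \<forall>l\<ge>K. l2_norm2 M (\<lambda>x. u k x - u l x) < e"
    using c by (auto simp: l2_cauchy_def)
  note [measurable] = square_integrableD(1)[OF sq]
  have "\<exists>r. \<forall>n. (\<forall>k\<ge>r n. \<forall>l\<ge>r n. l2_norm2 M (\<lambda>x. u k x - u l x) < (1/8)^n) \<and> r n < r (Suc n)"
  proof (rule dependent_nat_choice)
    show "\<exists>x. \<forall>k\<ge>x. \<forall>l\<ge>x. l2_norm2 M (\<lambda>xa. u k xa - u l xa) < (1/8) ^ 0"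
      using C[of 1] by simp
    fix x n
    obtain K where K: "\<forall>k\<ge>K. \<forall>l\<ge>K. l2_norm2 M (\<lambda>x. u k x - u l x) < (1/8)^Suc n"
      using C[of "(1/8)^Suc n"] by auto
    then show "\<exists>y. (\<forall>k\<ge>y. \<forall>l\<ge>y. l2_norm2 M (\<lambda>x. u k x - u l x) < (1/8) ^ Suc n) \<and> x < y"
      by (intro exI[of _ "max K (Suc x)"]) auto
  qed
  then obtain r where r: "\<And>n k l. k \<ge> r n \<Longrightarrow> l \<ge> r n \<Longrightarrow> l2_norm2 M (\<lambda>x. u k x - u l x) < (1/8)^n"
    and rs: "\<And>n. r n < r (Suc n)" by blast
  let ?d = "\<lambda>n x. norm (u (r (Suc n)) x - u (r n) x)"
  have dn: "(\<integral>\<^sup>+ x. ennreal (4 ^ n * (?d n x)\<^sup>2) \<partial>M) \<le> ennreal ((1/2) ^ n)" for n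
  proof -
    have "integrable M (\<lambda>x. (?d n x)\<^sup>2)"
      by (rule square_integrableD(2)[OF square_integrable_diff[OF sq sq]])
    then have "(\<integral>\<^sup>+ x. ennreal (4 ^ n * (?d n x)\<^sup>2) \<partial>M) = ennreal (4 ^ n * l2_norm2 M (\<lambda>x. u (r (Suc n)) x - u (r n) x))"
      by (subst nn_integral_eq_integral) (auto simp: l2_norm2_def)
    also have "\<dots> \<le> ennreal (4 ^ n * (1/8) ^ n)"
      using r[of n "r (Suc n)" "r n"] rs[of n] by (intro ennreal_leI mult_left_mono) auto
    also have "(4::real) ^ n * (1/8) ^ n = (1/2) ^ n"
      by (simp add: power_mult_distrib[symmetric])
    finally show ?thesis .
  qed
  have "(\<integral>\<^sup>+ x. (\<Sum>n. ennreal (4 ^ n * (?d n x)\<^sup>2)) \<partial>M) = (\<Sum>n. \<integral>\<^sup>+ x. ennreal (4 ^ n * (?d n x)\<^sup>2) \<partial>M)"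
    by (intro nn_integral_suminf) measurable
  also have "\<dots> \<le> (\<Sum>n. ennreal ((1/2) ^ n))"
    by (intro suminf_le dn) auto
  also have "\<dots> = ennreal (\<Sum>n. (1/2) ^ n)"
    by (intro suminf_ennreal2 summable_geometric) auto
  finally have "(\<integral>\<^sup>+ x. (\<Sum>n. ennreal (4 ^ n * (?d n x)\<^sup>2)) \<partial>M) \<noteq> \<infinity>"
    by (auto simp: top_unique)
  then have "AE x in M. (\<Sum>n. ennreal (4 ^ n * (?d n x)\<^sup>2)) \<noteq> \<infinity>"
    by (intro nn_integral_PInf_AE) measurable
  then have ae: "AE x in M. convergent (\<lambda>n. u (r n) x)"
  proof eventually_elim
    case (elim x)
    have "summable (\<lambda>n. 4 ^ n * (?d n x)\<^sup>2)"
      using elim by (intro summable_suminf_not_top) auto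
    then have "Bseq (\<lambda>n. 4 ^ n * (?d n x)\<^sup>2)"
      by (intro convergent_imp_Bseq convergentI[OF summable_LIMSEQ_zero])
    then obtain B where B: "\<And>n. 4 ^ n * (?d n x)\<^sup>2 \<le> B" "B > 0"
      unfolding Bseq_def by (auto simp: abs_mult)
    have "?d n x \<le> sqrt B * (1/2) ^ n" for n
    proof -
      have "(2 ^ n * ?d n x)\<^sup>2 \<le> B"
      proof -
        have "(2 ^ n)\<^sup>2 = (4::real) ^ n"
          by (simp add: power2_eq_square flip: power_mult_distrib)
        then show ?thesis using B(1)[of n] by (simp add: power_mult_distrib)
      qed
      then have "2 ^ n * ?d n x \<le> sqrt B" by (rule real_le_rsqrt)
      then show ?thesis by (simp add: power_one_over field_simps)
    qed
    moreover have "summable (\<lambda>n. sqrt B * (1/2) ^ n)"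
      by (intro summable_mult summable_geometric) simp
    ultimately have "summable (\<lambda>n. u (r (Suc n)) x - u (r n) x)"
      by (blast intro: summable_comparison_test')
    then have "convergent (\<lambda>n. \<Sum>i<n. u (r (Suc i)) x - u (r i) x)"
      by (simp add: summable_iff_convergent)
    then have "convergent (\<lambda>n. (\<Sum>i<n. u (r (Suc i)) x - u (r i) x) + u (r 0) x)"
      by (intro convergent_add convergent_const)
    moreover have "(\<lambda>n. (\<Sum>i<n. u (r (Suc i)) x - u (r i) x) + u (r 0) x) = (\<lambda>n. u (r n) x)"
      using sum_lessThan_telescope[of "\<lambda>i. u (r i) x"] by (simp only: diff_add_cancel)
    ultimately show ?case by (simp only:)
  qed
  \<comment> \<open>Where the subsequence diverges \<open>lim\<close> is an arbitrary value; this
    concerns a null set only.\<close>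
  define f where "f x = lim (\<lambda>n. u (r n) x)" for x
  have fm [measurable]: "f \<in> borel_measurable M" unfolding f_def by measurable
  have rmono: "n \<le> r n" for n
  proof (induction n)
    case (Suc n)
    then show ?case using rs[of n] by linarith
  qed simp
  \<comment> \<open>Fatou's lemma along the subsequence turns the Cauchy estimate between terms into
    an estimate of each late term of the whole sequence against the limit; \<open>rmono\<close>
    ensures that the subsequence has passed \<open>K\<close>.\<close>
  have close: "(\<integral>\<^sup>+ x. ennreal ((norm (u k x - f x))\<^sup>2) \<partial>M) \<le> ennreal e"
    if e: "e > 0" and K: "\<forall>k\<ge>K. \<forall>l\<ge>K. l2_norm2 M (\<lambda>x. u k x - u l x) < e" and k: "k \<ge> K" for e K k
  proof -
    have "(\<integral>\<^sup>+ x. ennreal ((norm (u k x - f x))\<^sup>2) \<partial>M) =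
        (\<integral>\<^sup>+ x. liminf (\<lambda>n. ennreal ((norm (u k x - u (r n) x))\<^sup>2)) \<partial>M)"
    proof (intro nn_integral_cong_AE)
      show "AE x in M. ennreal ((norm (u k x - f x))\<^sup>2) = liminf (\<lambda>n. ennreal ((norm (u k x - u (r n) x))\<^sup>2))"
        using ae
      proof eventually_elim
        case (elim x)
        then have "(\<lambda>n. u (r n) x) \<longlonglongrightarrow> f x" by (simp add: f_def convergent_LIMSEQ_iff)
        then have "(\<lambda>n. ennreal ((norm (u k x - u (r n) x))\<^sup>2)) \<longlonglongrightarrow> ennreal ((norm (u k x - f x))\<^sup>2)"
          by (intro tendsto_ennrealI tendsto_intros)
        then show ?case by (rule lim_imp_Liminf[symmetric, rotated]) simp
      qed
    qed
    also have "\<dots> \<le> liminf (\<lambda>n. \<integral>\<^sup>+ x. ennreal ((norm (u k x - u (r n) x))\<^sup>2) \<partial>M)"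
      by (intro nn_integral_liminf) measurable
    also have "\<dots> \<le> ennreal e"
    proof (rule Liminf_le)
        show "\<forall>\<^sub>F n in sequentially. (\<integral>\<^sup>+ x. ennreal ((norm (u k x - u (r n) x))\<^sup>2) \<partial>M) \<le> ennreal e"
          unfolding eventually_sequentially
        proof (intro exI[of _ K] allI impI)
          fix n assume "K \<le> n"
          then have "K \<le> r n" using rmono[of n] by linarith
          have "integrable M (\<lambda>x. (norm (u k x - u (r n) x))\<^sup>2)"
            by (rule square_integrableD(2)[OF square_integrable_diff[OF sq sq]])
          then have "(\<integral>\<^sup>+ x. ennreal ((norm (u k x - u (r n) x))\<^sup>2) \<partial>M) = ennreal (l2_norm2 M (\<lambda>x. u k x - u (r n) x))"
            by (subst nn_integral_eq_integral) (auto simp: l2_norm2_def)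
          also have "\<dots> \<le> ennreal e"
            using K k \<open>K \<le> r n\<close> by (intro ennreal_leI) (auto intro: less_imp_le)
          finally show "(\<integral>\<^sup>+ x. ennreal ((norm (u k x - u (r n) x))\<^sup>2) \<partial>M) \<le> ennreal e" .
        qed
    qed simp
    finally show ?thesis .
  qed
  obtain K1 where K1: "\<forall>k\<ge>K1. \<forall>l\<ge>K1. l2_norm2 M (\<lambda>x. u k x - u l x) < 1" using C[of 1] by auto
  have "integrable M (\<lambda>x. (norm (u K1 x - f x))\<^sup>2)"
  proof (rule integrableI_bounded)
    have "(\<integral>\<^sup>+ x. ennreal (norm ((norm (u K1 x - f x))\<^sup>2)) \<partial>M) \<le> ennreal 1"
      using close[OF _ K1, of K1] by simp
    then show "(\<integral>\<^sup>+ x. ennreal (norm ((norm (u K1 x - f x))\<^sup>2)) \<partial>M) < \<infinity>"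
      by (rule order.strict_trans1) simp
  qed measurable
  then have "(\<lambda>x. u K1 x - f x) \<in> square_integrable M"
    by (simp add: square_integrable_def)
  from square_integrable_diff[OF sq[of K1] this] have f: "f \<in> square_integrable M" by simp
  have "(\<lambda>n. l2_norm2 M (\<lambda>x. u n x - f x)) \<longlonglongrightarrow> 0"
  proof (rule LIMSEQ_I)
    fix e :: real assume e: "0 < e"
    obtain K where K: "\<forall>k\<ge>K. \<forall>l\<ge>K. l2_norm2 M (\<lambda>x. u k x - u l x) < e / 2" using C[of "e / 2"] e by auto
    have "norm (l2_norm2 M (\<lambda>x. u n x - f x) - 0) < e" if "n \<ge> K" for n
    proof -
      have "integrable M (\<lambda>x. (norm (u n x - f x))\<^sup>2)"
        by (rule square_integrableD(2)[OF square_integrable_diff[OF sq f]])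
      then have "ennreal (l2_norm2 M (\<lambda>x. u n x - f x)) = (\<integral>\<^sup>+ x. ennreal ((norm (u n x - f x))\<^sup>2) \<partial>M)"
        by (subst nn_integral_eq_integral) (auto simp: l2_norm2_def)
      also have "\<dots> \<le> ennreal (e / 2)" using e by (intro close[OF _ K that]) auto
      finally have "l2_norm2 M (\<lambda>x. u n x - f x) \<le> e / 2" using e by (simp add: ennreal_le_iff)
      then show ?thesis using e by simp
    qed
    then show "\<exists>no. \<forall>n\<ge>no. norm (l2_norm2 M (\<lambda>x. u n x - f x) - 0) < e" by blast
  qed
  then show ?thesis using sq f by (auto simp: l2_tendsto_def)
qed

lemma l2_parallelogram:
  assumes "f \<in> square_integrable M" "g \<in> square_integrable M"
  shows "l2_norm2 M (\<lambda>x. f x - g x) = 2 * l2_norm2 M f + 2 * l2_norm2 M g - 4 * l2_norm2 M (\<lambda>x. (f x + g x) / 2)"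
proof -
  have p: "(norm (a - b))\<^sup>2 + 4 * (norm ((a + b) / 2))\<^sup>2 = 2 * (norm a)\<^sup>2 + 2 * (norm b)\<^sup>2" for a b :: complex
  proof -
    have "4 * (norm ((a + b) / 2))\<^sup>2 = (norm (a + b))\<^sup>2"
      by (simp add: norm_divide power_divide)
    then show ?thesis
      by (simp add: cmod_power2 power2_sum power2_diff)
  qed
  have s: "(\<lambda>x. (1/2) * (f x + g x)) \<in> square_integrable M"
    by (intro square_integrable_scale square_integrable_add assms)
  have "l2_norm2 M (\<lambda>x. f x - g x) + 4 * l2_norm2 M (\<lambda>x. (f x + g x) / 2) =
      (LINT x|M. (norm (f x - g x))\<^sup>2 + 4 * (norm ((f x + g x) / 2))\<^sup>2)"
    using square_integrableD(2)[OF square_integrable_diff[OF assms]] square_integrableD(2)[OF s]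
    by (simp add: l2_norm2_def)
  also have "\<dots> = 2 * l2_norm2 M f + 2 * l2_norm2 M g"
    unfolding p l2_norm2_def using square_integrableD(2)[OF assms(1)] square_integrableD(2)[OF assms(2)] by simp
  finally show ?thesis by simp
qed

text \<open>The projection is the limit of a minimising sequence, which is Cauchy by the parallelogram law.\<close>
lemma l2_projection:
  assumes V: "V \<subseteq> square_integrable M" and ne: "(\<lambda>x. 0) \<in> V"
    and lin: "\<And>f g a b. f \<in> V \<Longrightarrow> g \<in> V \<Longrightarrow> (\<lambda>x. complex_of_real a * f x + complex_of_real b * g x) \<in> V"
    and h: "h \<in> square_integrable M"
  shows "\<exists>u f. (\<forall>n. u n \<in> V) \<and> l2_tendsto M u f \<and> (\<forall>v\<in>V. Re (l2_inner M (\<lambda>x. h x - f x) v) = 0)"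
proof -
  let ?D = "\<lambda>v. l2_norm2 M (\<lambda>x. h x - v x)"
  define \<delta> where "\<delta> = Inf (?D ` V)"
  have bdd: "bdd_below (?D ` V)" by (rule bdd_belowI[of _ 0]) auto
  have \<delta>le: "\<delta> \<le> ?D v" if "v \<in> V" for v
    unfolding \<delta>_def using bdd that by (intro cInf_lower) auto
  have "\<exists>v\<in>V. ?D v < \<delta> + inverse (real (Suc n))" for n
  proof -
    have "Inf (?D ` V) < \<delta> + inverse (real (Suc n))" by (simp add: \<delta>_def)
    then show ?thesis using cInf_lessD[of "?D ` V"] ne by blast
  qed
  then obtain u where uV: "\<And>n. u n \<in> V" and u: "\<And>n. ?D (u n) < \<delta> + inverse (real (Suc n))" by metis
  have hv: "(\<lambda>x. h x - v x) \<in> square_integrable M" if "v \<in> V" for v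
    using that V by (intro square_integrable_diff h) auto
  \<comment> \<open>The midpoint of two members of \<open>V\<close> lies in \<open>V\<close>, hence
    is at squared distance at least \<delta> from \<open>h\<close>; the parallelogram law then
    bounds the distance of two near-minimisers.\<close>
  have diff: "l2_norm2 M (\<lambda>x. u k x - u l x) \<le> 2 * inverse (real (Suc k)) + 2 * inverse (real (Suc l))" for k l
  proof -
    have mid: "(\<lambda>x. complex_of_real (1/2) * u k x + complex_of_real (1/2) * u l x) \<in> V" by (intro lin uV)
    have "l2_norm2 M (\<lambda>x. u l x - u k x) = l2_norm2 M (\<lambda>x. (h x - u k x) - (h x - u l x))" by simp
    also have "\<dots> = 2 * ?D (u k) + 2 * ?D (u l) - 4 * l2_norm2 M (\<lambda>x. ((h x - u k x) + (h x - u l x)) / 2)"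
      by (rule l2_parallelogram) (intro hv uV)+
    also have "(\<lambda>x. ((h x - u k x) + (h x - u l x)) / 2) =
        (\<lambda>x. h x - (complex_of_real (1/2) * u k x + complex_of_real (1/2) * u l x))"
      by (auto simp: field_simps)
    finally have "l2_norm2 M (\<lambda>x. u l x - u k x) \<le> 2 * ?D (u k) + 2 * ?D (u l) - 4 * \<delta>"
      using \<delta>le[OF mid] by simp
    then show ?thesis using u[of k] u[of l] by (simp add: l2_norm2_minus_commute[of M "u k"])
  qed
  have "l2_cauchy M u" unfolding l2_cauchy_def
  proof (intro conjI allI impI)
    fix e :: real assume e: "0 < e"
    obtain K where K: "inverse (real (Suc K)) < e / 4" using reals_Archimedean[of "e / 4"] e by auto
    have "l2_norm2 M (\<lambda>x. u k x - u l x) < e" if "k \<ge> K" "l \<ge> K" for k l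
    proof -
      have "inverse (real (Suc k)) \<le> inverse (real (Suc K))" "inverse (real (Suc l)) \<le> inverse (real (Suc K))"
        using that by (auto intro!: le_imp_inverse_le)
      then show ?thesis using diff[of k l] K by linarith
    qed
    then show "\<exists>K. \<forall>k\<ge>K. \<forall>l\<ge>K. l2_norm2 M (\<lambda>x. u k x - u l x) < e" by blast
  qed (use uV V in auto)
  then obtain f where f: "l2_tendsto M u f" using l2_complete by blast
  \<comment> \<open>\<open>V\<close> is closed under real combinations only, so varying t over the
    reals determines just the real part of the inner product.\<close>
  have "Re (l2_inner M (\<lambda>x. h x - f x) v) = 0" if v: "v \<in> V" for v
  proof -
    have vsq: "v \<in> square_integrable M" using v V by blast
    have key: "0 \<le> inverse (real (Suc n)) - 2 * t * Re (l2_inner M (\<lambda>x. h x - u n x) v) + t\<^sup>2 * l2_norm2 M v" for n t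
    proof -
      have "(\<lambda>x. complex_of_real 1 * u n x + complex_of_real t * v x) \<in> V" by (intro lin uV v)
      from \<delta>le[OF this] have "\<delta> \<le> l2_norm2 M (\<lambda>x. (h x - u n x) - complex_of_real t * v x)"
        by (simp add: algebra_simps)
      also have "\<dots> = ?D (u n) - 2 * Re (l2_inner M (\<lambda>x. h x - u n x) (\<lambda>x. complex_of_real t * v x)) +
          l2_norm2 M (\<lambda>x. complex_of_real t * v x)"
        by (intro l2_norm2_diff_expand hv uV square_integrable_scale vsq)
      finally show ?thesis using u[of n]
        by (simp add: l2_inner_scale_right l2_norm2_scale)
    qed
    have lim: "(\<lambda>n. Re (l2_inner M (\<lambda>x. h x - u n x) v)) \<longlonglongrightarrow> Re (l2_inner M (\<lambda>x. h x - f x) v)"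
    proof -
      have "l2_tendsto M (\<lambda>n x. h x - u n x) (\<lambda>x. h x - f x)"
        using f hv[OF uV] square_integrable_diff[OF h l2_tendstoD(2)[OF f]]
        by (simp add: l2_tendsto_def l2_norm2_minus_commute[of M f])
      from tendsto_Re[OF l2_tendsto_inner[OF this l2_tendsto_const[OF vsq]]] show ?thesis .
    qed
    let ?r = "Re (l2_inner M (\<lambda>x. h x - f x) v)"
    have lim2: "0 \<le> 0 - 2 * t * ?r + t\<^sup>2 * l2_norm2 M v" for t
    proof (rule LIMSEQ_le_const)
      show "(\<lambda>n. inverse (real (Suc n)) - 2 * t * Re (l2_inner M (\<lambda>x. h x - u n x) v) + t\<^sup>2 * l2_norm2 M v)
          \<longlonglongrightarrow> 0 - 2 * t * ?r + t\<^sup>2 * l2_norm2 M v"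
        by (intro tendsto_intros lim LIMSEQ_inverse_real_of_nat)
    qed (use key in auto)
    show ?thesis
    proof (rule ccontr)
      assume r: "?r \<noteq> 0"
      \<comment> \<open>Adding 1 keeps the denominator positive even if \<open>v\<close> is a null
        function; t = ?r/N makes the quadratic expression at most -?r^2/N.\<close>
      define N where "N = l2_norm2 M v + 1"
      have N: "N > 0" "l2_norm2 M v < N" by (auto simp: N_def add_nonneg_pos)
      have "0 \<le> - 2 * (?r / N) * ?r + (?r / N)\<^sup>2 * l2_norm2 M v" using lim2[of "?r / N"] by simp
      also have "\<dots> \<le> - 2 * (?r / N) * ?r + (?r / N)\<^sup>2 * N"
        using N by (intro add_left_mono mult_left_mono) auto
      also have "\<dots> = - (?r\<^sup>2 / N)" using N by (simp add: power2_eq_square field_simps)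
      also have "\<dots> < 0" using r N by simp
      finally show False by simp
    qed
  qed
  with uV f show ?thesis by blast
qed

subsection \<open>Gaussians and Fourier inversion\<close>

text \<open>The substitution of \<epsilon> t for t reduces to \<epsilon> = 1, where the integral is
  sqrt(2 pi) times the characteristic function of the standard normal law.\<close>

lemma
  fixes s \<epsilon> :: real
  assumes "0 < \<epsilon>"
  shows integrable_gaussian_exp_real:
      "integrable lborel (\<lambda>t. complex_of_real (exp (- (\<epsilon>\<^sup>2 / 2) * t\<^sup>2)) * exp (- \<i> * complex_of_real (s * t)))"
    and integral_gaussian_exp_real:
      "(LINT t|lborel. complex_of_real (exp (- (\<epsilon>\<^sup>2 / 2) * t\<^sup>2)) * exp (- \<i> * complex_of_real (s * t))) =
        complex_of_real (sqrt (2 * pi) / \<epsilon> * exp (- (1 / (2 * \<epsilon>\<^sup>2)) * s\<^sup>2))"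
proof -
  let ?h = "\<lambda>r t. complex_of_real (exp (- t\<^sup>2 / 2)) * exp (- \<i> * complex_of_real (r * t))"
  have [measurable]: "?h r \<in> borel_measurable borel" for r
    by (intro borel_measurable_continuous_UNIV continuous_intros) auto
  have hd: "?h r t = complex_of_real (sqrt (2 * pi)) * (std_normal_density t *\<^sub>R iexp (- r * t))" for r t
    by (simp add: normal_density_def scaleR_conv_of_real field_simps)
  have 1: "integrable lborel (?h r)" for r
    unfolding hd
  proof (intro integrable_mult_right Bochner_Integration.integrable_bound[OF integrable_normal_density[of 1 0]])
    show "(\<lambda>t. std_normal_density t *\<^sub>R iexp (- r * t)) \<in> borel_measurable lborel" by measurable
  qed auto
  have 2: "(LINT t|lborel. ?h r t) = complex_of_real (sqrt (2 * pi) * exp (- r\<^sup>2 / 2))" for r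
  proof -
    have "(LINT t|lborel. ?h r t) = complex_of_real (sqrt (2 * pi)) * (LINT t|lborel. std_normal_density t *\<^sub>R iexp (- r * t))"
      unfolding hd by (rule integral_mult_right_zero)
    also have "(LINT t|lborel. std_normal_density t *\<^sub>R iexp (- r * t)) = char std_normal_distribution (- r)"
      unfolding char_def by (subst integral_density) auto
    finally show ?thesis by (simp add: char_std_normal_distribution)
  qed
  have eq: "complex_of_real (exp (- (\<epsilon>\<^sup>2 / 2) * t\<^sup>2)) * exp (- \<i> * complex_of_real (s * t)) = ?h (s / \<epsilon>) (0 + \<epsilon> *\<^sub>R t)" for t
    using assms by (simp add: power_mult_distrib)
  show "integrable lborel (\<lambda>t. complex_of_real (exp (- (\<epsilon>\<^sup>2 / 2) * t\<^sup>2)) * exp (- \<i> * complex_of_real (s * t)))"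
    unfolding eq using assms 1[of "s / \<epsilon>"] by (subst lborel_integrable_affine) auto
  have "complex_of_real \<epsilon> * (LINT t|lborel. ?h (s / \<epsilon>) (0 + \<epsilon> *\<^sub>R t)) = (LINT t|lborel. ?h (s / \<epsilon>) t)"
    using assms lborel_integral_affine[of \<epsilon> "?h (s / \<epsilon>)" 0] by (simp add: scaleR_conv_of_real)
  also have "\<dots> = complex_of_real \<epsilon> * complex_of_real (sqrt (2 * pi) / \<epsilon> * exp (- (1 / (2 * \<epsilon>\<^sup>2)) * s\<^sup>2))"
    unfolding 2 of_real_mult[symmetric] using assms by (simp add: power_divide)
  finally show "(LINT t|lborel. complex_of_real (exp (- (\<epsilon>\<^sup>2 / 2) * t\<^sup>2)) * exp (- \<i> * complex_of_real (s * t))) =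
        complex_of_real (sqrt (2 * pi) / \<epsilon> * exp (- (1 / (2 * \<epsilon>\<^sup>2)) * s\<^sup>2))"
  proof -
    assume *: "complex_of_real \<epsilon> * (LINT t|lborel. ?h (s / \<epsilon>) (0 + \<epsilon> *\<^sub>R t)) =
      complex_of_real \<epsilon> * complex_of_real (sqrt (2 * pi) / \<epsilon> * exp (- (1 / (2 * \<epsilon>\<^sup>2)) * s\<^sup>2))"
    have "complex_of_real \<epsilon> \<noteq> 0" using assms by simp
    from mult_left_cancel[OF this] * show ?thesis unfolding eq by blast
  qed
qed

lemma gaussian_prod: "gaussian c x = (\<Prod>i\<in>UNIV. exp (- c * (x $ i)\<^sup>2))"
proof -
  have "(norm x)\<^sup>2 = (\<Sum>i\<in>UNIV. (x $ i)\<^sup>2)"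
    by (simp add: norm_vec_def L2_set_def sum_nonneg)
  then show ?thesis
    by (simp only: gaussian_def sum_distrib_left exp_sum[OF finite])
qed

lemma integral_gaussian_exp:
  fixes s :: "real^'d::finite"
  assumes "0 < \<epsilon>"
  shows "(LINT y|lborel. complex_of_real (gaussian (\<epsilon>\<^sup>2 / 2) y) * exp (- \<i> * complex_of_real (s \<bullet> y))) =
    complex_of_real ((sqrt (2 * pi) / \<epsilon>) ^ CARD('d) * gaussian (1 / (2 * \<epsilon>\<^sup>2)) s)"
proof -
  have "complex_of_real (gaussian (\<epsilon>\<^sup>2 / 2) y) * exp (- \<i> * complex_of_real (s \<bullet> y)) =
      (\<Prod>i\<in>UNIV. (\<lambda>i t. complex_of_real (exp (- (\<epsilon>\<^sup>2 / 2) * t\<^sup>2)) * exp (- \<i> * complex_of_real (s $ i * t))) i (y $ i))"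
    for y :: "real^'d"
  proof -
    have "- \<i> * complex_of_real (s \<bullet> y) = (\<Sum>i\<in>UNIV. - \<i> * complex_of_real (s $ i * y $ i))"
      by (simp only: inner_vec_def inner_real_def of_real_sum sum_distrib_left)
    then have "exp (- \<i> * complex_of_real (s \<bullet> y)) = (\<Prod>i\<in>UNIV. exp (- \<i> * complex_of_real (s $ i * y $ i)))"
      by (simp only: exp_sum[OF finite])
    then show ?thesis by (simp only: gaussian_prod of_real_prod prod.distrib)
  qed
  then have "(LINT y|lborel. complex_of_real (gaussian (\<epsilon>\<^sup>2 / 2) y) * exp (- \<i> * complex_of_real (s \<bullet> y))) =
      (\<Prod>i\<in>UNIV. LINT t|lborel. complex_of_real (exp (- (\<epsilon>\<^sup>2 / 2) * t\<^sup>2)) * exp (- \<i> * complex_of_real (s $ i * t)))"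
    using integral_prod_vec[OF integrable_gaussian_exp_real[OF assms]] by (simp only:)
  also have "\<dots> = (\<Prod>i\<in>UNIV. complex_of_real (sqrt (2 * pi) / \<epsilon> * exp (- (1 / (2 * \<epsilon>\<^sup>2)) * (s $ i)\<^sup>2)))"
    by (simp only: integral_gaussian_exp_real[OF assms])
  also have "\<dots> = complex_of_real (\<Prod>i\<in>UNIV. sqrt (2 * pi) / \<epsilon> * exp (- (1 / (2 * \<epsilon>\<^sup>2)) * (s $ i)\<^sup>2))"
    by simp
  also have "(\<Prod>i\<in>UNIV. sqrt (2 * pi) / \<epsilon> * exp (- (1 / (2 * \<epsilon>\<^sup>2)) * (s $ i)\<^sup>2)) =
      (sqrt (2 * pi) / \<epsilon>) ^ CARD('d) * gaussian (1 / (2 * \<epsilon>\<^sup>2)) s"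
    by (simp only: gaussian_prod prod.distrib prod_constant)
  finally show ?thesis .
qed

text \<open>A substitute for the character exp(-i x y), which is not a Schwartz function. As
  \<epsilon> tends to 0 it converges to the character, while its transform becomes an approximate
  identity concentrated at -x.\<close>

definition modulated_gaussian :: "real \<Rightarrow> real^'d::finite \<Rightarrow> real^'d \<Rightarrow> complex" where
  "modulated_gaussian \<epsilon> x y = complex_of_real (gaussian (\<epsilon>\<^sup>2 / 2) y) * exp (- \<i> * complex_of_real (x \<bullet> y))"

lemma modulated_gaussian_schwartz:
  assumes "0 < \<epsilon>"
  shows "modulated_gaussian \<epsilon> x \<in> schwartz"
proof -
  have "(\<lambda>y. complex_of_real (gaussian (\<epsilon>\<^sup>2 / 2) y) * exp (\<i> * complex_of_real ((- x) \<bullet> y))) \<in> schwartz"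
    using assms by (intro schwartz_mult_FT gaussian_schwartz FT_cexp) auto
  then show ?thesis by (simp add: modulated_gaussian_def[abs_def])
qed

lemma fourier_modulated_gaussian:
  fixes x z :: "real^'d::finite"
  assumes "0 < \<epsilon>"
  shows "fourier (modulated_gaussian \<epsilon> x) z = complex_of_real (gaussian (1 / (2 * \<epsilon>\<^sup>2)) (x + z) / \<epsilon> ^ CARD('d))"
proof -
  have "fourier (modulated_gaussian \<epsilon> x) z = fourier_scale TYPE('d) *\<^sub>R
      (LINT y|lborel. complex_of_real (gaussian (\<epsilon>\<^sup>2 / 2) y) * exp (- \<i> * complex_of_real ((x + z) \<bullet> y)))"
    unfolding fourier_lborel[OF schwartz_borel[OF modulated_gaussian_schwartz[OF assms]]]
    by (simp only: modulated_gaussian_def inner_add_left of_real_add distrib_left exp_add mult.assoc)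
  also have "\<dots> = complex_of_real (fourier_scale TYPE('d) * ((sqrt (2 * pi) / \<epsilon>) ^ CARD('d) * gaussian (1 / (2 * \<epsilon>\<^sup>2)) (x + z)))"
    unfolding integral_gaussian_exp[OF assms] scaleR_conv_of_real of_real_mult ..
  also have "fourier_scale TYPE('d) * ((sqrt (2 * pi) / \<epsilon>) ^ CARD('d) * gaussian (1 / (2 * \<epsilon>\<^sup>2)) (x + z)) =
      gaussian (1 / (2 * \<epsilon>\<^sup>2)) (x + z) / \<epsilon> ^ CARD('d)"
    unfolding power_divide inverse_fourier_scale by simp
  finally show ?thesis .
qed

lemma integral_std_gaussian:
  "(LINT s|lborel. complex_of_real (gaussian (1 / 2) (s :: real^'d::finite))) =
    complex_of_real (inverse (fourier_scale TYPE('d)))"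
  using integral_gaussian_exp[of 1 "0 :: real^'d"]
  by (simp add: inverse_fourier_scale gaussian_def)

text \<open>Polynomial growth of \<open>f\<close> is harmless against Gaussian decay: Peetre's
  inequality separates \<open>x\<close> from \<open>s\<close> and gives a dominating function
  uniform in the width 1/(n+1).\<close>

lemma gaussian_approximate_identity:
  fixes f :: "real^'d::finite \<Rightarrow> complex"
  assumes f: "continuous_on UNIV f" "poly_bounded f"
  shows "(\<lambda>n. LINT s|lborel. f (x + inverse (real (Suc n)) *\<^sub>R s) * complex_of_real (gaussian (1 / 2) s))
    \<longlonglongrightarrow> f x * complex_of_real (inverse (fourier_scale TYPE('d)))"
proof -
  obtain N C where C: "\<And>x. norm (f x) \<le> C * weight x ^ N" "0 \<le> C"
    using f(2) by (elim poly_boundedE) blast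
  have [measurable]: "f \<in> borel_measurable borel" by (rule borel_measurable_continuous_UNIV[OF f(1)])
  have g: "(\<lambda>s::real^'d. complex_of_real (gaussian (1 / 2) s)) \<in> schwartz"
    by (rule gaussian_schwartz) simp
  have [measurable]: "(\<lambda>s::real^'d. complex_of_real (gaussian (1 / 2) s)) \<in> borel_measurable borel"
    by (rule schwartz_borel[OF g])
  let ?w = "\<lambda>s::real^'d. C * (2 * weight x) ^ N * norm (complex_of_real (gaussian (1 / 2) s) * complex_of_real (weight s ^ N))"
  have "rapid (\<lambda>s::real^'d. complex_of_real (gaussian (1 / 2) s) * complex_of_real (weight s ^ N))"
    by (rule rapid_mult[OF schwartz_rapid[OF g]])
      (rule poly_boundedI[of _ 1 N], simp add: norm_power)
  moreover have "(\<lambda>s::real^'d. complex_of_real (gaussian (1 / 2) s) * complex_of_real (weight s ^ N)) \<in> borel_measurable borel"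
    by (intro borel_measurable_continuous_UNIV continuous_intros)
  ultimately have w: "integrable lborel ?w"
    by (intro integrable_mult_right integrable_norm rapid_integrable)
  have "(\<lambda>n. LINT s|lborel. f (x + inverse (real (Suc n)) *\<^sub>R s) * complex_of_real (gaussian (1 / 2) s))
      \<longlonglongrightarrow> (LINT s|lborel. f x * complex_of_real (gaussian (1 / 2) (s :: real^'d)))"
  proof (rule integral_dominated_convergence[where w = ?w])
    show "AE s in lborel. (\<lambda>n. f (x + inverse (real (Suc n)) *\<^sub>R s) * complex_of_real (gaussian (1 / 2) s))
        \<longlonglongrightarrow> f x * complex_of_real (gaussian (1 / 2) s)"
    proof (rule AE_I2)
      fix s :: "real^'d"
      have "(\<lambda>n. x + inverse (real (Suc n)) *\<^sub>R s) \<longlonglongrightarrow> x + 0 *\<^sub>R s"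
        by (intro tendsto_intros LIMSEQ_inverse_real_of_nat)
      then have "(\<lambda>n. x + inverse (real (Suc n)) *\<^sub>R s) \<longlonglongrightarrow> x" by simp
      moreover have "isCont f x" using f(1) by (simp add: continuous_on_eq_continuous_at)
      ultimately have "(\<lambda>n. f (x + inverse (real (Suc n)) *\<^sub>R s)) \<longlonglongrightarrow> f x"
        by (rule isCont_tendsto_compose[rotated])
      then show "(\<lambda>n. f (x + inverse (real (Suc n)) *\<^sub>R s) * complex_of_real (gaussian (1 / 2) s))
        \<longlonglongrightarrow> f x * complex_of_real (gaussian (1 / 2) s)"
        by (intro tendsto_mult tendsto_const)
    qed
    show "AE s in lborel. norm (f (x + inverse (real (Suc n)) *\<^sub>R s) * complex_of_real (gaussian (1 / 2) s)) \<le> ?w s" for n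
    proof (rule AE_I2)
      fix s :: "real^'d"
      let ?t = "inverse (real (Suc n))"
      have "weight (x + ?t *\<^sub>R s) \<le> 2 * weight x * weight (?t *\<^sub>R s)" by (rule weight_add)
      also have "\<dots> \<le> 2 * weight x * weight s"
        by (intro mult_left_mono weight_scaleR) (auto simp: divide_simps)
      finally have "C * weight (x + ?t *\<^sub>R s) ^ N \<le> C * (2 * weight x * weight s) ^ N"
        using C(2) by (intro mult_left_mono power_mono) auto
      then have "norm (f (x + ?t *\<^sub>R s)) \<le> C * (2 * weight x * weight s) ^ N"
        using C(1)[of "x + ?t *\<^sub>R s"] by linarith
      then have "norm (f (x + ?t *\<^sub>R s)) * gaussian (1 / 2) s \<le> (C * (2 * weight x * weight s) ^ N) * gaussian (1 / 2) s"
        by (intro mult_right_mono) (auto simp: less_imp_le)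
      then show "norm (f (x + ?t *\<^sub>R s) * complex_of_real (gaussian (1 / 2) s)) \<le> ?w s"
        by (simp add: norm_mult norm_power power_mult_distrib less_imp_le abs_of_pos mult_ac)
    qed
  qed (use w in auto)
  then show ?thesis unfolding integral_mult_right_zero integral_std_gaussian .
qed

text \<open>Substituting z = -x + \<epsilon> s, the Jacobian \<epsilon>^d cancels the normalisation
  \<epsilon>^(-d) of the concentrating Gaussian.\<close>

lemma integral_mult_fourier_modulated_gaussian:
  fixes f :: "real^'d::finite \<Rightarrow> complex"
  assumes [measurable]: "f \<in> borel_measurable borel" and "0 < \<epsilon>"
  shows "(LINT z|lborel. f z * fourier (modulated_gaussian \<epsilon> x) z) =
    (LINT s|lborel. f (- x + \<epsilon> *\<^sub>R s) * complex_of_real (gaussian (1 / 2) s))"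
proof -
  have [measurable]: "fourier (modulated_gaussian \<epsilon> x) \<in> borel_measurable borel"
    by (intro schwartz_borel fourier_schwartz modulated_gaussian_schwartz assms)
  have "(LINT z|lborel. f z * fourier (modulated_gaussian \<epsilon> x) z) =
      \<epsilon> ^ CARD('d) *\<^sub>R (LINT s|lborel. f (- x + \<epsilon> *\<^sub>R s) * fourier (modulated_gaussian \<epsilon> x) (- x + \<epsilon> *\<^sub>R s))"
    using lborel_integral_affine[of \<epsilon> "\<lambda>z. f z * fourier (modulated_gaussian \<epsilon> x) z" "- x"] assms(2) by simp
  also have "\<dots> = (LINT s|lborel. f (- x + \<epsilon> *\<^sub>R s) * complex_of_real (gaussian (1 / 2) s))"
  proof -
    have "\<epsilon> ^ CARD('d) *\<^sub>R (f (- x + \<epsilon> *\<^sub>R s) * fourier (modulated_gaussian \<epsilon> x) (- x + \<epsilon> *\<^sub>R s)) =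
        f (- x + \<epsilon> *\<^sub>R s) * complex_of_real (gaussian (1 / 2) s)" for s
    proof -
      have "gaussian (1 / (2 * \<epsilon>\<^sup>2)) (x + (- x + \<epsilon> *\<^sub>R s)) = gaussian (1 / 2) s"
        using assms(2) by (simp add: gaussian_def power_mult_distrib)
      then show ?thesis
        unfolding fourier_modulated_gaussian[OF assms(2)]
        using assms(2) by (simp add: scaleR_conv_of_real[where 'a = complex])
    qed
    then show ?thesis
      by (subst integral_scaleR_right[symmetric]) simp
  qed
  finally show ?thesis .
qed

lemma fourier_gaussian_limit:
  fixes f :: "real^'d::finite \<Rightarrow> complex"
  assumes f: "continuous_on UNIV f" "poly_bounded f"
  shows "(\<lambda>n. LINT z|lborel. f z * fourier (modulated_gaussian (inverse (real (Suc n))) x) z)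
    \<longlonglongrightarrow> f (- x) * complex_of_real (inverse (fourier_scale TYPE('d)))"
  using gaussian_approximate_identity[OF f, of "- x"]
  by (subst integral_mult_fourier_modulated_gaussian)
    (auto intro: borel_measurable_continuous_UNIV[OF f(1)])

lemma modulated_gaussian_tendsto:
  "(\<lambda>n. modulated_gaussian (inverse (real (Suc n))) x y) \<longlonglongrightarrow> exp (- \<i> * complex_of_real (x \<bullet> y))"
proof -
  have "(\<lambda>n. gaussian ((inverse (real (Suc n)))\<^sup>2 / 2) y) \<longlonglongrightarrow> gaussian (0\<^sup>2 / 2) y"
    unfolding gaussian_def by (intro tendsto_intros LIMSEQ_inverse_real_of_nat) simp
  then have "(\<lambda>n. complex_of_real (gaussian ((inverse (real (Suc n)))\<^sup>2 / 2) y) * exp (- \<i> * complex_of_real (x \<bullet> y)))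
      \<longlonglongrightarrow> complex_of_real (gaussian (0\<^sup>2 / 2) y) * exp (- \<i> * complex_of_real (x \<bullet> y))"
    by (intro tendsto_intros)
  then show ?thesis by (simp add: modulated_gaussian_def gaussian_def)
qed

lemma norm_modulated_gaussian_le: "norm (modulated_gaussian \<epsilon> x y) \<le> 1"
  by (simp add: modulated_gaussian_def norm_mult gaussian_def)

lemma fourier_modulated_limit:
  fixes u :: "real^'d::finite \<Rightarrow> complex"
  assumes "integrable lborel u"
  shows "(\<lambda>n. LINT y|lborel. u y * modulated_gaussian (inverse (real (Suc n))) x y)
    \<longlonglongrightarrow> (LINT y|lborel. u y * exp (- \<i> * complex_of_real (x \<bullet> y)))"
proof (rule integral_dominated_convergence[where w = "\<lambda>y. norm (u y)"])
  have [measurable]: "u \<in> borel_measurable borel"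
    using borel_measurable_integrable[OF assms] by simp
  have m: "modulated_gaussian (inverse (real (Suc n))) x \<in> borel_measurable lborel" for n
    using schwartz_borel[OF modulated_gaussian_schwartz[of "inverse (real (Suc n))" x]] by simp
  show "(\<lambda>y. u y * modulated_gaussian (inverse (real (Suc n))) x y) \<in> borel_measurable lborel" for n
    by (intro borel_measurable_times m) simp
  show "(\<lambda>y. u y * exp (- \<i> * complex_of_real (x \<bullet> y))) \<in> borel_measurable lborel"
    using exp_inner_borel[of x] by measurable
  show "AE y in lborel. norm (u y * modulated_gaussian (inverse (real (Suc n))) x y) \<le> norm (u y)" for n
    by (rule AE_I2) (simp add: norm_mult mult_left_le norm_modulated_gaussian_le)
  show "AE y in lborel. (\<lambda>n. u y * modulated_gaussian (inverse (real (Suc n))) x y)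
      \<longlonglongrightarrow> u y * exp (- \<i> * complex_of_real (x \<bullet> y))"
    by (intro AE_I2 tendsto_mult tendsto_const modulated_gaussian_tendsto)
qed (use assms in auto)

text \<open>Damp the outer integral by a Gaussian and move the transform onto the damped character.
  One side converges to the undamped integral by dominated convergence, the other to a point value
  of \<open>f\<close> by the approximate identity.\<close>

theorem fourier_fourier:
  fixes f :: "real^'d::finite \<Rightarrow> complex"
  assumes f: "f \<in> schwartz"
  shows "fourier (fourier f) x = f (- x)"
proof -
  have F: "fourier f \<in> schwartz" by (rule fourier_schwartz[OF f])
  have "(\<lambda>n. LINT y|lborel. fourier f y * modulated_gaussian (inverse (real (Suc n))) x y)
      \<longlonglongrightarrow> (LINT y|lborel. fourier f y * exp (- \<i> * complex_of_real (x \<bullet> y)))"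
    by (intro fourier_modulated_limit schwartz_integrable F)
  moreover have "(LINT y|lborel. fourier f y * modulated_gaussian (inverse (real (Suc n))) x y) =
      (LINT y|lborel. f y * fourier (modulated_gaussian (inverse (real (Suc n))) x) y)" for n
    by (rule fourier_multiplication_formula[symmetric])
      (auto intro!: schwartz_integrable modulated_gaussian_schwartz f)
  moreover have "(\<lambda>n. LINT z|lborel. f z * fourier (modulated_gaussian (inverse (real (Suc n))) x) z)
      \<longlonglongrightarrow> f (- x) * complex_of_real (inverse (fourier_scale TYPE('d)))"
    by (intro fourier_gaussian_limit schwartz_continuous rapid_imp_poly_bounded schwartz_rapid f)
  ultimately have "(LINT y|lborel. fourier f y * exp (- \<i> * complex_of_real (x \<bullet> y))) =
      f (- x) * complex_of_real (inverse (fourier_scale TYPE('d)))"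
    using LIMSEQ_unique by (simp only:) blast
  then show ?thesis
    by (simp add: fourier_lborel[OF schwartz_borel[OF F]] scaleR_conv_of_real)
qed

definition inverse_fourier :: "(real^'d::finite \<Rightarrow> complex) \<Rightarrow> real^'d \<Rightarrow> complex" where
  "inverse_fourier f x = fourier f (- x)"

lemma inverse_fourier_schwartz: "f \<in> schwartz \<Longrightarrow> inverse_fourier f \<in> schwartz"
  unfolding inverse_fourier_def[abs_def] by (intro schwartz_reflect fourier_schwartz)

lemma fourier_reflect:
  fixes f :: "real^'d::finite \<Rightarrow> complex"
  assumes [measurable]: "f \<in> borel_measurable borel"
  shows "fourier (\<lambda>y. f (- y)) x = fourier f (- x)"
proof -
  have [measurable]: "(\<lambda>y. f y * exp (- \<i> * complex_of_real ((- x) \<bullet> y))) \<in> borel_measurable borel"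
    using exp_inner_borel[of "- x"] by measurable
  have "(LINT y|lborel. f (- y) * exp (- \<i> * complex_of_real ((- x) \<bullet> (- y)))) =
      (LINT y|lborel. f y * exp (- \<i> * complex_of_real ((- x) \<bullet> y)))"
    by (rule lborel_integral_reflect) measurable
  then show ?thesis by (simp add: fourier_lborel)
qed

lemma fourier_inverse_fourier: "f \<in> schwartz \<Longrightarrow> fourier (inverse_fourier f) = f"
  by (auto simp: inverse_fourier_def[abs_def] fourier_reflect schwartz_borel fourier_schwartz fourier_fourier)

lemma inverse_fourier_fourier: "f \<in> schwartz \<Longrightarrow> inverse_fourier (fourier f) = f"
  by (auto simp: inverse_fourier_def[abs_def] fourier_fourier)

lemma cnj_fourier: "cnj (fourier f x) = inverse_fourier (\<lambda>y. cnj (f y)) x"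
  unfolding fourier_def inverse_fourier_def
  by (simp add: exp_cnj flip: Bochner_Integration.integral_cnj)

text \<open>The conjugate of a transform is an inverse transform of the conjugate, so the
  multiplication formula followed by inversion gives the result.\<close>

lemma Parseval_schwartz:
  fixes f g :: "real^'d::finite \<Rightarrow> complex"
  assumes f: "f \<in> schwartz" and g: "g \<in> schwartz"
  shows "(LINT x|lborel. fourier f x * cnj (fourier g x)) = (LINT x|lborel. f x * cnj (g x))"
proof -
  let ?h = "inverse_fourier (\<lambda>y. cnj (g y))"
  have h: "?h \<in> schwartz" by (intro inverse_fourier_schwartz schwartz_cnj g)
  have "(LINT x|lborel. fourier f x * ?h x) = (LINT x|lborel. f x * fourier ?h x)"
    by (intro fourier_multiplication_formula[symmetric] schwartz_integrable f h)
  then show ?thesis by (simp add: cnj_fourier fourier_inverse_fourier schwartz_cnj g)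
qed

subsection \<open>The fundamental lemma of the calculus of variations\<close>

lemma lebesgue_ex_borel_complex:
  fixes f :: "'a::euclidean_space \<Rightarrow> complex"
  assumes "f \<in> borel_measurable lebesgue"
  shows "\<exists>g\<in>borel_measurable borel. AE x in lborel. f x = g x"
proof -
  obtain a where a: "a \<in> borel_measurable borel" "AE x in lborel. Re (f x) = a x"
    using completion_ex_borel_measurable_real[of "\<lambda>x. Re (f x)" lborel] assms by auto
  obtain b where b: "b \<in> borel_measurable borel" "AE x in lborel. Im (f x) = b x"
    using completion_ex_borel_measurable_real[of "\<lambda>x. Im (f x)" lborel] assms by auto
  have m: "(\<lambda>x. Complex (a x) (b x)) \<in> borel_measurable borel"
    using a(1) b(1) by (simp add: Complex_eq)
  have e: "AE x in lborel. f x = Complex (a x) (b x)"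
    using a(2) b(2) by eventually_elim (simp add: complex_eq_iff)
  show ?thesis by (rule bexI[OF _ m]) (rule e)
qed

text \<open>Lower orthants form an intersection-stable generator of the Borel sets, exhausted by
  countably many of them. The finite measures with the positive and the negative part of
  \<open>g\<close> as densities therefore coincide.\<close>

lemma AE_zero_of_orthant_integrals:
  fixes g :: "'a::ordered_euclidean_space \<Rightarrow> real"
  assumes g: "integrable lborel g"
    and zero: "\<And>a. (LINT x|lborel. indicator {x. eucl_less x a} x * g x) = 0"
  shows "AE x in lborel. g x = 0"
proof -
  have [measurable]: "g \<in> borel_measurable borel"
    using borel_measurable_integrable[OF g] by simp
  let ?E = "range (\<lambda>a::'a. {x. eucl_less x a})"
  have B: "sets borel = sigma_sets UNIV ?E"
    by (subst borel_eq_lessThan) simp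
  have Em: "X \<in> sets borel" if "X \<in> ?E" for X
    unfolding B using that by (rule sigma_sets.Basic)
  \<comment> \<open>\<open>ennreal\<close> sends negative reals to 0, so these are the positive and
    the negative part of \<open>g\<close>.\<close>
  let ?p = "\<lambda>x. ennreal (g x)" and ?m = "\<lambda>x. ennreal (- g x)"
  have fin: "integral\<^sup>N lborel (\<lambda>x. ennreal (norm (g x))) < \<infinity>"
    using g by (simp add: integrable_iff_bounded)
  have "density lborel ?p = density lborel ?m"
  proof (rule measure_eqI_generator_eq[where E = ?E and \<Omega> = UNIV and A = "\<lambda>n. {x. eucl_less x (\<Sum>b\<in>Basis. real n *\<^sub>R b)}"])
    show "Int_stable ?E"
    proof (rule Int_stableI, clarify)
      fix a b :: 'a
      have "{x. eucl_less x a} \<inter> {x. eucl_less x b} = {x. eucl_less x (\<Sum>i\<in>Basis. min (a \<bullet> i) (b \<bullet> i) *\<^sub>R i)}"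
        by (auto simp: eucl_less_def)
      then show "{x. eucl_less x a} \<inter> {x. eucl_less x b} \<in> ?E" by blast
    qed
    show "emeasure (density lborel ?p) X = emeasure (density lborel ?m) X" if XE: "X \<in> ?E" for X
    proof -
      obtain a where X: "X = {x. eucl_less x a}" using XE by blast
      have [measurable]: "X \<in> sets borel" by (rule Em[OF XE])
      have "integrable lborel (\<lambda>x. indicator X x * g x)"
        using integrable_real_mult_indicator[of X lborel g] g by (simp add: mult.commute)
      then have "enn2real (\<integral>\<^sup>+ x. ennreal (indicator X x * g x) \<partial>lborel) -
          enn2real (\<integral>\<^sup>+ x. ennreal (- (indicator X x * g x)) \<partial>lborel) = 0"
        using zero[of a] unfolding X[symmetric] by (simp add: real_lebesgue_integral_def)
      moreover have "(\<integral>\<^sup>+ x. ennreal (indicator X x * g x) \<partial>lborel) < \<infinity>"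
        "(\<integral>\<^sup>+ x. ennreal (- (indicator X x * g x)) \<partial>lborel) < \<infinity>"
        by (rule le_less_trans[OF nn_integral_mono fin]; auto intro!: ennreal_leI split: split_indicator)+
      ultimately have "(\<integral>\<^sup>+ x. ennreal (indicator X x * g x) \<partial>lborel) =
          (\<integral>\<^sup>+ x. ennreal (- (indicator X x * g x)) \<partial>lborel)"
        by (metis eq_iff_diff_eq_0 ennreal_enn2real infinity_ennreal_def)
      moreover have "(\<integral>\<^sup>+ x. ennreal (indicator X x * g x) \<partial>lborel) = emeasure (density lborel ?p) X"
        by (subst emeasure_density) (auto intro!: nn_integral_cong split: split_indicator)
      moreover have "(\<integral>\<^sup>+ x. ennreal (- (indicator X x * g x)) \<partial>lborel) = emeasure (density lborel ?m) X"
        by (subst emeasure_density) (auto intro!: nn_integral_cong split: split_indicator)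
      ultimately show ?thesis by simp
    qed
    show "(\<Union>n. {x::'a. eucl_less x (\<Sum>b\<in>Basis. real n *\<^sub>R b)}) = UNIV"
    proof (intro set_eqI iffI UNIV_I)
      fix x :: 'a
      obtain n where n: "norm x < real n" using reals_Archimedean2 by blast
      have "x \<bullet> b < real n" if "b \<in> Basis" for b
        using Basis_le_norm[OF that, of x] n by linarith
      then have "x \<in> {x. eucl_less x (\<Sum>b\<in>Basis. real n *\<^sub>R b)}" by (auto simp: eucl_less_def)
      then show "x \<in> (\<Union>n. {x::'a. eucl_less x (\<Sum>b\<in>Basis. real n *\<^sub>R b)})" by blast
    qed
    show "emeasure (density lborel ?p) {x. eucl_less x (\<Sum>b\<in>Basis. real n *\<^sub>R b)} \<noteq> \<infinity>" for n
    proof -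
      have "emeasure (density lborel ?p) {x. eucl_less x (\<Sum>b\<in>Basis. real n *\<^sub>R b)} \<le> emeasure (density lborel ?p) (space (density lborel ?p))"
        by (intro emeasure_space)
      also have "\<dots> = (\<integral>\<^sup>+ x. ?p x \<partial>lborel)" by (subst emeasure_density) auto
      also have "\<dots> \<le> integral\<^sup>N lborel (\<lambda>x. ennreal (norm (g x)))"
        by (intro nn_integral_mono ennreal_leI) auto
      finally show ?thesis using fin by auto
    qed
  qed (auto simp: B)
  moreover have "(\<integral>\<^sup>+ x. ?p x \<partial>lborel) \<noteq> \<infinity>"
  proof -
    have "(\<integral>\<^sup>+ x. ?p x \<partial>lborel) \<le> integral\<^sup>N lborel (\<lambda>x. ennreal (norm (g x)))"
      by (intro nn_integral_mono ennreal_leI) simp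
    then show ?thesis using fin by auto
  qed
  ultimately have "AE x in lborel. ?p x = ?m x"
    by (subst (asm) finite_density_unique) auto
  then show ?thesis
  proof eventually_elim
    case (elim x)
    then show ?case by (cases "g x \<ge> 0") (auto simp: ennreal_eq_0_iff ennreal_neg dest: sym)
  qed
qed

text \<open>A bounded smooth step. Products over the coordinates approximate indicators of orthants
  while staying in \<open>FT\<close>, so a Gaussian times such a product is an admissible test
  function.\<close>

definition logistic :: "real \<Rightarrow> complex" where
  "logistic t = inverse (1 + exp (- complex_of_real t))"

lemma logistic_of_real: "logistic t = complex_of_real (inverse (1 + exp (- t)))"
  by (simp add: logistic_def exp_of_real[symmetric])

lemma norm_logistic_le: "norm (logistic t) \<le> 1"
proof -
  have "\<bar>inverse (1 + exp (- t))\<bar> \<le> 1"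
    by (simp add: abs_of_pos add_pos_pos inverse_le_1_iff)
  then show ?thesis unfolding logistic_of_real norm_of_real .
qed

text \<open>The family is closed under partial derivatives because \<open>\<sigma>' = \<sigma> (1 - \<sigma>)\<close>.\<close>
lemma logistic_FT: "(\<lambda>x. logistic (b - a * x $ j)) \<in> FT"
proof -
  let ?s = "\<lambda>x::real^'a. logistic (b - a * x $ j)"
  have "generated {?s} \<subseteq> FT"
  proof (rule generated_subset_FT)
    fix f :: "real^'a \<Rightarrow> complex" assume "f \<in> {?s}"
    then have f: "f = ?s" by simp
    have nz: "1 + exp (- complex_of_real t) \<noteq> 0" for t
    proof
      assume "1 + exp (- complex_of_real t) = 0"
      then have "complex_of_real (1 + exp (- t)) = 0" by (simp add: exp_of_real[symmetric])
      then have "1 + exp (- t) = 0" by (simp only: of_real_eq_0_iff)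
      then show False using exp_gt_zero[of "- t"] by linarith
    qed
    show "continuous_on UNIV f"
      unfolding f logistic_def using nz by (intro continuous_intros) (auto simp del: of_real_diff)
    show "poly_bounded f" unfolding f
      using norm_logistic_le by (intro poly_boundedI[of _ 1 0]) simp
    fix i
    have "has_partial i (\<lambda>x::real^'a. complex_of_real b + complex_of_real (- a) * complex_of_real (x $ j))
        (\<lambda>x. 0 + (complex_of_real (- a) * of_bool (i = j) + 0 * complex_of_real (x $ j)))"
      by (intro has_partial_add has_partial_mult has_partial_const has_partial_coord)
    then have lin: "has_partial i (\<lambda>x::real^'a. complex_of_real (b - a * x $ j)) (\<lambda>x. complex_of_real (- a) * of_bool (i = j))"
      by simp
    have "has_partial i f (\<lambda>x. (complex_of_real (- a) * of_bool (i = j)) * (\<lambda>z. exp (- z) * (inverse (1 + exp (- z)) * inverse (1 + exp (- z)))) (complex_of_real (b - a * x $ j)))"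
      unfolding f logistic_def
    proof (rule has_partial_chain[OF lin])
      fix x :: "real^'a"
      show "((\<lambda>z. inverse (1 + exp (- z))) has_field_derivative
          exp (- complex_of_real (b - a * x $ j)) *
          (inverse (1 + exp (- complex_of_real (b - a * x $ j))) * inverse (1 + exp (- complex_of_real (b - a * x $ j)))))
          (at (complex_of_real (b - a * x $ j)))"
        using nz[of "b - a * x $ j"] by (auto intro!: derivative_eq_intros)
    qed
    also have "(\<lambda>x::real^'a. (complex_of_real (- a) * of_bool (i = j)) * (\<lambda>z. exp (- z) * (inverse (1 + exp (- z)) * inverse (1 + exp (- z)))) (complex_of_real (b - a * x $ j))) =
        (\<lambda>x. (complex_of_real (- a) * of_bool (i = j)) * (f x + (-1) * (f x * f x)))"
    proof
      fix x :: "real^'a"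
      have "E * (inverse (1 + E) * inverse (1 + E)) = inverse (1 + E) + (-1) * (inverse (1 + E) * inverse (1 + E))"
        if "1 + E \<noteq> 0" for E :: complex
      proof -
        have r: "(1 + E) * inverse (1 + E) = 1" using that by simp
        have "E * (inverse (1 + E) * inverse (1 + E)) =
            ((1 + E) * inverse (1 + E)) * inverse (1 + E) - inverse (1 + E) * inverse (1 + E)"
          by (simp only: distrib_right mult_1_left mult.assoc add_diff_cancel_left')
        then show ?thesis unfolding r by simp
      qed
      from this[OF nz[of "b - a * x $ j"]]
      show "(complex_of_real (- a) * of_bool (i = j)) * (\<lambda>z. exp (- z) * (inverse (1 + exp (- z)) * inverse (1 + exp (- z)))) (complex_of_real (b - a * x $ j)) =
        (complex_of_real (- a) * of_bool (i = j)) * (f x + (-1) * (f x * f x))"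
        unfolding f logistic_def by simp
    qed
    finally have *: "has_partial i f (\<lambda>x. (complex_of_real (- a) * of_bool (i = j)) * (f x + (-1) * (f x * f x)))" .
    have s: "f \<in> generated {?s}" unfolding f by (rule generated.base) simp
    have "(\<lambda>x. (complex_of_real (- a) * of_bool (i = j)) * (f x + (-1) * (f x * f x))) \<in> generated {?s}"
      by (rule generated.mult[OF generated.const
            generated.add[OF s generated.mult[OF generated.const generated.mult[OF s s]]]])
    with * show "\<exists>f'\<in>generated {?s}. has_partial i f f'" by blast
  qed
  then show ?thesis using generated.base[of ?s "{?s}"] by blast
qed

text \<open>The shift by \<open>sqrt n\<close> makes the limit \<open>0\<close> on the boundary hyperplane \<open>s = 0\<close>.\<close>
lemma logistic_tendsto:
  "(\<lambda>n. logistic (real n * s - sqrt (real n))) \<longlonglongrightarrow> (if 0 < s then 1 else 0)"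
proof -
  have "(\<lambda>n. inverse (1 + exp (- (real n * s - sqrt (real n))))) \<longlonglongrightarrow> (if 0 < s then 1 else 0)"
  proof (cases "0 < s")
    case True
    then have "(\<lambda>n. inverse (1 + exp (- (real n * s - sqrt (real n))))) \<longlonglongrightarrow> 1" by real_asymp
    then show ?thesis using True by simp
  next
    case False
    have "(\<lambda>n. inverse (1 + exp (- (real n * s - sqrt (real n))))) \<longlonglongrightarrow> 0"
    proof (rule tendsto_sandwich[OF _ _ tendsto_const])
      show "(\<lambda>n. inverse (1 + exp (sqrt (real n)))) \<longlonglongrightarrow> 0" by real_asymp
      show "\<forall>\<^sub>F n in sequentially. inverse (1 + exp (- (real n * s - sqrt (real n)))) \<le> inverse (1 + exp (sqrt (real n)))"
        using False by (intro always_eventually allI le_imp_inverse_le add_left_mono)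
          (auto simp: add_pos_pos mult_nonneg_nonpos)
    qed (auto simp: add_nonneg_nonneg)
    then show ?thesis using False by simp
  qed
  from tendsto_of_real[OF this, where 'a = complex]
  show ?thesis unfolding logistic_of_real by (auto split: if_splits)
qed

text \<open>Testing with Gaussian times logistic products and passing to the limit shows that
  \<open>f\<close> times the Gaussian has integral 0 over every orthant. Weighted integrability
  supplies the dominating function, and the Gaussian can be divided out because it never
  vanishes.\<close>

theorem fundamental_lemma:
  fixes f :: "real^'d::finite \<Rightarrow> complex"
  assumes f: "f \<in> borel_measurable lebesgue" "integrable lebesgue (\<lambda>x. f x / complex_of_real (weight x ^ N))"
    and zero: "\<And>\<eta>. \<eta> \<in> schwartz \<Longrightarrow> (LINT x|lebesgue. f x * \<eta> x) = 0"
  shows "AE x in lebesgue. f x = 0"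
proof -
  let ?g = "\<lambda>x::real^'d. complex_of_real (gaussian 1 x)"
  have gS: "?g \<in> schwartz" by (rule gaussian_schwartz) simp
  obtain h where h [measurable]: "h \<in> borel_measurable borel" and fh: "AE x in lborel. f x = h x"
    using lebesgue_ex_borel_complex[OF f(1)] by auto
  have fh': "AE x in lebesgue. f x = h x" by (rule AE_completion[OF fh])
  have [measurable]: "?g \<in> borel_measurable borel" by (rule schwartz_borel[OF gS])
  have w [measurable]: "(\<lambda>x::real^'d. complex_of_real (weight x ^ N)) \<in> borel_measurable borel"
    by (intro borel_measurable_continuous_UNIV continuous_intros)
  have hw: "(\<lambda>x. h x / complex_of_real (weight x ^ N)) \<in> borel_measurable borel"
    by (intro borel_measurable_divide h w)
  have "integrable lebesgue (\<lambda>x. h x / complex_of_real (weight x ^ N))"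
  proof (rule integrable_cong_AE_imp[OF f(2)])
    show "(\<lambda>x. h x / complex_of_real (weight x ^ N)) \<in> borel_measurable lebesgue"
      by (rule measurable_completion) (simp add: hw del: of_real_power)
    show "AE x in lebesgue. f x / complex_of_real (weight x ^ N) = h x / complex_of_real (weight x ^ N)"
      using fh' by eventually_elim simp
  qed
  then have hint: "integrable lborel (\<lambda>x. h x / complex_of_real (weight x ^ N))"
    unfolding lebesgue_integrable_eq_lborel[OF hw] .
  have hg: "integrable lborel (\<lambda>x. h x * ?g x)"
  proof -
    obtain C where C: "\<And>x. weight x ^ N * norm (?g x) \<le> C"
      using schwartz_rapid[OF gS] unfolding rapid_def by blast
    show ?thesis
    proof (rule Bochner_Integration.integrable_bound[OF integrable_mult_right[OF hint, of "complex_of_real C"]])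
      show "AE x in lborel. norm (h x * ?g x) \<le> norm (complex_of_real C * (h x / complex_of_real (weight x ^ N)))"
      proof (rule AE_I2)
        fix x
        have "norm (h x * ?g x) = norm (h x) / weight x ^ N * (weight x ^ N * norm (?g x))"
          by (simp add: norm_mult)
        also have "\<dots> \<le> norm (h x) / weight x ^ N * \<bar>C\<bar>"
          using C[of x] by (intro mult_left_mono) auto
        finally show "norm (h x * ?g x) \<le> norm (complex_of_real C * (h x / complex_of_real (weight x ^ N)))"
          by (simp add: norm_mult norm_divide norm_power mult.commute)
      qed
    qed measurable
  qed
  have orth: "(LINT x|lborel. indicator {x. eucl_less x a} x *\<^sub>R (h x * ?g x)) = 0" for a :: "real^'d"
  proof -
    let ?s = "\<lambda>n (x::real^'d). \<Prod>j\<in>UNIV. logistic (real n * (a $ j - x $ j) - sqrt (real n))"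
    have s: "?s n \<in> FT" for n
    proof (rule FT_prod)
      fix j :: 'd
      have "(\<lambda>x::real^'d. logistic ((real n * a $ j - sqrt (real n)) - real n * x $ j)) \<in> FT"
        by (rule logistic_FT)
      then show "(\<lambda>x::real^'d. logistic (real n * (a $ j - x $ j) - sqrt (real n))) \<in> FT"
        by (simp add: algebra_simps)
    qed simp
    have [measurable]: "?s n \<in> borel_measurable borel" for n
      by (rule borel_measurable_continuous_UNIV[OF FT_continuous[OF s]])
    have "0 = (LINT x|lborel. ?s n x * (h x * ?g x))" for n
    proof -
      have gs: "(\<lambda>x. ?g x * ?s n x) \<in> schwartz" by (rule schwartz_mult_FT[OF gS s])
      have "0 = (LINT x|lebesgue. f x * (?g x * ?s n x))" using zero[OF gs] by simp
      also have "\<dots> = (LINT x|lebesgue. h x * (?g x * ?s n x))"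
      proof (rule integral_cong_AE)
        have m: "(\<lambda>x. ?g x * ?s n x) \<in> borel_measurable lebesgue"
          by (rule measurable_completion) (simp add: schwartz_borel[OF gs])
        have hl: "h \<in> borel_measurable lebesgue"
          by (rule measurable_completion) (simp add: h)
        show "(\<lambda>x. f x * (?g x * ?s n x)) \<in> borel_measurable lebesgue"
          by (rule borel_measurable_times[OF f(1) m])
        show "(\<lambda>x. h x * (?g x * ?s n x)) \<in> borel_measurable lebesgue"
          by (rule borel_measurable_times[OF hl m])
        show "AE x in lebesgue. f x * (?g x * ?s n x) = h x * (?g x * ?s n x)"
          using fh' by eventually_elim simp
      qed
      also have "\<dots> = (LINT x|lborel. h x * (?g x * ?s n x))"
        by (rule lebesgue_integral_eq_lborel) measurable
      finally show ?thesis by (simp add: mult_ac)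
    qed
    moreover have "(\<lambda>n. LINT x|lborel. ?s n x * (h x * ?g x)) \<longlonglongrightarrow>
        (LINT x|lborel. indicator {x. eucl_less x a} x *\<^sub>R (h x * ?g x))"
    proof (rule integral_dominated_convergence[where w = "\<lambda>x. norm (h x * ?g x)"])
      show "AE x in lborel. (\<lambda>n. ?s n x * (h x * ?g x)) \<longlonglongrightarrow> indicator {x. eucl_less x a} x *\<^sub>R (h x * ?g x)"
      proof (rule AE_I2)
        fix x :: "real^'d"
        have "(\<lambda>n. ?s n x) \<longlonglongrightarrow> (\<Prod>j\<in>UNIV. if 0 < a $ j - x $ j then 1 else 0)"
          by (intro tendsto_prod logistic_tendsto)
        also have "(\<Prod>j\<in>UNIV. if 0 < a $ j - x $ j then 1 else 0) = (indicator {x. eucl_less x a} x :: complex)"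
        proof (cases "eucl_less x a")
          case True
          have "x $ j < a $ j" for j
          proof -
            have "axis j 1 \<in> (Basis :: (real^'d) set)" by (auto simp: Basis_vec_def)
            then have "x \<bullet> axis j 1 < a \<bullet> axis j 1" using True by (simp only: eucl_less_def)
            then show ?thesis by (simp add: inner_axis)
          qed
          then show ?thesis using True by simp
        next
          case False
          then obtain b where "b \<in> Basis" "\<not> x \<bullet> b < a \<bullet> b" by (auto simp: eucl_less_def)
          then obtain j where "\<not> x $ j < a $ j" by (auto simp: Basis_vec_def inner_axis)
          then show ?thesis using False by (auto intro!: bexI[of _ j])
        qed
        finally have "(\<lambda>n. ?s n x * (h x * ?g x)) \<longlonglongrightarrow> indicator {x. eucl_less x a} x * (h x * ?g x)"
          by (intro tendsto_mult tendsto_const)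
        then show "(\<lambda>n. ?s n x * (h x * ?g x)) \<longlonglongrightarrow> indicator {x. eucl_less x a} x *\<^sub>R (h x * ?g x)"
          by (cases "eucl_less x a") simp_all
      qed
      show "AE x in lborel. norm (?s n x * (h x * ?g x)) \<le> norm (h x * ?g x)" for n
      proof (rule AE_I2)
        fix x :: "real^'d"
        have "norm (?s n x) \<le> 1"
          unfolding prod_norm[symmetric] by (intro prod_le_1 conjI norm_logistic_le norm_ge_zero)
        then show "norm (?s n x * (h x * ?g x)) \<le> norm (h x * ?g x)"
          unfolding norm_mult[of "?s n x"] by (rule mult_left_le_one_le[OF norm_ge_zero norm_ge_zero])
      qed
      have "{x::real^'d. eucl_less x a} \<in> sets borel"
        by (subst borel_eq_lessThan) (auto intro!: sigma_sets.Basic)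
      then show "(\<lambda>x. indicator {x. eucl_less x a} x *\<^sub>R (h x * ?g x)) \<in> borel_measurable lborel"
        by measurable
    qed (use hg in auto)
    ultimately have "(\<lambda>n. 0) \<longlonglongrightarrow> (LINT x|lborel. indicator {x. eucl_less x a} x *\<^sub>R (h x * ?g x))"
      by (simp only:)
    then show ?thesis by (rule LIMSEQ_unique[OF _ tendsto_const])
  qed
  have "AE x in lborel. Re (h x * ?g x) = 0"
  proof (rule AE_zero_of_orthant_integrals)
    show "integrable lborel (\<lambda>x. Re (h x * ?g x))" by (intro integrable_Re hg)
    fix a :: "real^'d"
    have "{x::real^'d. eucl_less x a} \<in> sets lborel"
      by (subst sets_lborel, subst borel_eq_lessThan) (auto intro!: sigma_sets.Basic)
    then have i: "integrable lborel (\<lambda>x. indicator {x. eucl_less x a} x *\<^sub>R (h x * ?g x))"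
      by (intro integrable_mult_indicator hg)
    show "(LINT x|lborel. indicator {x. eucl_less x a} x * Re (h x * ?g x)) = 0"
      using arg_cong[OF orth[of a], of Re] i by (simp flip: integral_Re)
  qed
  moreover have "AE x in lborel. Im (h x * ?g x) = 0"
  proof (rule AE_zero_of_orthant_integrals)
    show "integrable lborel (\<lambda>x. Im (h x * ?g x))" by (intro integrable_Im hg)
    fix a :: "real^'d"
    have "{x::real^'d. eucl_less x a} \<in> sets lborel"
      by (subst sets_lborel, subst borel_eq_lessThan) (auto intro!: sigma_sets.Basic)
    then have i: "integrable lborel (\<lambda>x. indicator {x. eucl_less x a} x *\<^sub>R (h x * ?g x))"
      by (intro integrable_mult_indicator hg)
    show "(LINT x|lborel. indicator {x. eucl_less x a} x * Im (h x * ?g x)) = 0"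
      using arg_cong[OF orth[of a], of Im] i by (simp flip: integral_Im)
  qed
  ultimately have "AE x in lborel. h x = 0"
  proof eventually_elim
    case (elim x)
    then have "h x * ?g x = 0" by (simp add: complex_eq_iff)
    then show ?case by simp
  qed
  then have "AE x in lborel. f x = 0" using fh by eventually_elim simp
  then show ?thesis by (rule AE_completion)
qed

subsection \<open>Functions as tempered distributions\<close>

text \<open>A common class for everything paired with Schwartz functions here: square-integrable
  functions, locally integrable members of \<open>SI\<close>, and continuous functions of polynomial
  growth. Its members define tempered distributions and are determined by them almost
  everywhere.\<close>

definition moderate :: "(real^'d::finite \<Rightarrow> complex) \<Rightarrow> bool" where
  "moderate f \<longleftrightarrow> f \<in> borel_measurable lebesgue \<and>
     (\<exists>N. integrable lebesgue (\<lambda>x. f x / complex_of_real (weight x ^ N)))"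

lemma weight_power_measurable [measurable]:
  "(\<lambda>x::real^'d::finite. complex_of_real (weight x ^ N)) \<in> borel_measurable lebesgue"
  by (rule measurable_completion) (auto intro!: borel_measurable_continuous_UNIV continuous_intros)

lemma integrable_inverse_weight_lebesgue:
  "integrable lebesgue (\<lambda>x::real^'d::finite. inverse (weight x ^ CARD('d)))"
  using integrable_inverse_weight
  by (subst lebesgue_integrable_eq_lborel) (auto intro!: borel_measurable_continuous_UNIV continuous_intros)

lemma moderate_weight_mono:
  assumes "f \<in> borel_measurable lebesgue" "integrable lebesgue (\<lambda>x. f x / complex_of_real (weight x ^ N))" "N \<le> N'"
  shows "integrable lebesgue (\<lambda>x. f x / complex_of_real (weight x ^ N'))"
proof (rule Bochner_Integration.integrable_bound[OF assms(2)])
  show "(\<lambda>x. f x / complex_of_real (weight x ^ N')) \<in> borel_measurable lebesgue"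
    by (intro borel_measurable_divide assms(1) weight_power_measurable)
  show "AE x in lebesgue. norm (f x / complex_of_real (weight x ^ N')) \<le> norm (f x / complex_of_real (weight x ^ N))"
    using assms(3) by (intro AE_I2) (auto simp: norm_divide norm_power intro!: divide_left_mono power_increasing)
qed

lemma moderate_diff:
  assumes "moderate f" "moderate g"
  shows "moderate (\<lambda>x. f x - g x)"
proof -
  obtain N K where N: "integrable lebesgue (\<lambda>x. f x / complex_of_real (weight x ^ N))"
    and K: "integrable lebesgue (\<lambda>x. g x / complex_of_real (weight x ^ K))"
    and [measurable]: "f \<in> borel_measurable lebesgue" "g \<in> borel_measurable lebesgue"
    using assms by (auto simp: moderate_def)
  have "integrable lebesgue (\<lambda>x. f x / complex_of_real (weight x ^ (N + K)) - g x / complex_of_real (weight x ^ (N + K)))"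
    by (intro Bochner_Integration.integrable_diff moderate_weight_mono[OF _ N] moderate_weight_mono[OF _ K]) auto
  then have "integrable lebesgue (\<lambda>x. (f x - g x) / complex_of_real (weight x ^ (N + K)))"
    by (simp add: diff_divide_distrib)
  then show ?thesis unfolding moderate_def by auto
qed

lemma moderate_square_integrable:
  assumes "f \<in> square_integrable lebesgue"
  shows "moderate f"
  unfolding moderate_def
proof (intro conjI exI[of _ "CARD('a)"], goal_cases)
  case 1
  show ?case by (rule square_integrableD(1)[OF assms])
next
  case 2
  note [measurable] = square_integrableD(1)[OF assms]
  show ?case
  proof (rule Bochner_Integration.integrable_bound)
    show "(\<lambda>x. f x / complex_of_real (weight x ^ CARD('a))) \<in> borel_measurable lebesgue"
      by (intro borel_measurable_divide weight_power_measurable) measurable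
    show "integrable lebesgue (\<lambda>x. (norm (f x))\<^sup>2 + inverse (weight x ^ CARD('a)))"
      by (intro Bochner_Integration.integrable_add square_integrableD(2)[OF assms] integrable_inverse_weight_lebesgue)
    show "AE x in lebesgue. norm (f x / complex_of_real (weight x ^ CARD('a))) \<le>
        norm ((norm (f x))\<^sup>2 + inverse (weight x ^ CARD('a)))"
    proof (rule AE_I2)
      fix x
      define a b where "a = norm (f x)" and "b = inverse (weight x ^ CARD('a))"
      have b: "0 \<le> b" "b \<le> 1" unfolding b_def by (auto simp: inverse_le_1_iff)
      \<comment> \<open>The inverse weight satisfies b^2 <= b since it is at most 1, so its
        integrability suffices to dominate the product.\<close>
      have "a * b \<le> a\<^sup>2 + b"
      proof -
        have "0 \<le> a * b" using b by (simp add: a_def)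
        moreover have "2 * (a * b) \<le> a\<^sup>2 + b\<^sup>2"
          using zero_le_power2[of "a - b"] by (simp add: power2_diff)
        moreover have "b\<^sup>2 \<le> b" using b by (simp add: power2_eq_square mult_left_le)
        ultimately show ?thesis by linarith
      qed
      moreover have "norm (f x / complex_of_real (weight x ^ CARD('a))) = a * b"
        by (simp add: a_def b_def norm_divide norm_power field_simps)
      moreover have "norm ((norm (f x))\<^sup>2 + inverse (weight x ^ CARD('a))) = a\<^sup>2 + b"
        using b unfolding a_def[symmetric] b_def[symmetric] by simp
      ultimately show "norm (f x / complex_of_real (weight x ^ CARD('a))) \<le>
        norm ((norm (f x))\<^sup>2 + inverse (weight x ^ CARD('a)))" by simp
    qed
  qed
qed

lemma L1loc_measurable:
  fixes f :: "real^'d::finite \<Rightarrow> real"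
  assumes "f \<in> L1loc"
  shows "f \<in> borel_measurable lebesgue"
proof (rule borel_measurable_LIMSEQ_real)
  show "(\<lambda>n. indicator (cball 0 (real n)) x *\<^sub>R f x) \<longlonglongrightarrow> f x" for x
  proof (rule tendsto_eventually)
    obtain n where "norm x \<le> real n" using real_arch_simple by blast
    then show "\<forall>\<^sub>F n in sequentially. indicator (cball 0 (real n)) x *\<^sub>R f x = f x"
      unfolding eventually_sequentially by (intro exI[of _ n]) auto
  qed
  show "(\<lambda>x. indicator (cball 0 (real n)) x *\<^sub>R f x) \<in> borel_measurable lebesgue" for n
    using assms unfolding L1loc_def set_integrable_def
    by (intro borel_measurable_integrable) auto
qed

lemma moderate_L1loc_SI:
  fixes f :: "real^'d::finite \<Rightarrow> real"
  assumes "f \<in> L1loc" "f \<in> SI"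
  shows "moderate (\<lambda>x. complex_of_real (f x))"
proof -
  note fm [measurable] = L1loc_measurable[OF assms(1)]
  obtain k C R where ae: "AE x in lebesgue. R \<le> norm x \<longrightarrow> norm (f x) \<le> C * norm x ^ k"
    using assms(2) unfolding SI_def by blast
  let ?N = "k + CARD('d)"
  have "integrable lebesgue (\<lambda>x. complex_of_real (f x) / complex_of_real (weight x ^ ?N))"
  proof (rule Bochner_Integration.integrable_bound)
    show "integrable lebesgue (\<lambda>x. \<bar>indicator (cball 0 R) x *\<^sub>R f x\<bar> + \<bar>C\<bar> * inverse (weight x ^ CARD('d)))"
      using assms(1) unfolding L1loc_def set_integrable_def
      by (intro Bochner_Integration.integrable_add integrable_mult_right integrable_inverse_weight_lebesgue
          Bochner_Integration.integrable_abs) auto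
    show "(\<lambda>x. complex_of_real (f x) / complex_of_real (weight x ^ ?N)) \<in> borel_measurable lebesgue"
      by (intro borel_measurable_divide weight_power_measurable) measurable
    show "AE x in lebesgue. norm (complex_of_real (f x) / complex_of_real (weight x ^ ?N)) \<le>
        norm (\<bar>indicator (cball 0 R) x *\<^sub>R f x\<bar> + \<bar>C\<bar> * inverse (weight x ^ CARD('d)))"
      using ae
    proof eventually_elim
      case (elim x)
      have n: "norm (complex_of_real (f x) / complex_of_real (weight x ^ ?N)) = \<bar>f x\<bar> / weight x ^ ?N"
        by (simp add: norm_divide norm_power norm_mult)
      have p: "0 \<le> \<bar>C\<bar> * inverse (weight x ^ CARD('d))" by simp
      have "\<bar>f x\<bar> / weight x ^ ?N \<le> \<bar>indicator (cball 0 R) x *\<^sub>R f x\<bar> + \<bar>C\<bar> * inverse (weight x ^ CARD('d))"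
      proof (cases "R \<le> norm x")
        case True
        then have "\<bar>f x\<bar> \<le> C * norm x ^ k" using elim by simp
        also have "\<dots> \<le> \<bar>C\<bar> * weight x ^ k" by (intro mult_mono norm_power_le_weight) auto
        finally have "\<bar>f x\<bar> / weight x ^ ?N \<le> (\<bar>C\<bar> * weight x ^ k) / weight x ^ ?N"
          by (intro divide_right_mono) auto
        also have "\<dots> = \<bar>C\<bar> * inverse (weight x ^ CARD('d))" by (simp add: power_add field_simps)
        finally show ?thesis by linarith
      next
        case False
        have "\<bar>f x\<bar> / weight x ^ ?N \<le> \<bar>f x\<bar> / 1" by (intro divide_left_mono) auto
        also have "\<dots> = \<bar>indicator (cball 0 R) x *\<^sub>R f x\<bar>" using False by simp
        finally show ?thesis using p by linarith
      qed
      then show ?case unfolding n using p by (simp add: abs_of_nonneg)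
    qed
  qed
  then show ?thesis unfolding moderate_def by auto
qed

lemma schwartz_lebesgue_measurable: "\<eta> \<in> schwartz \<Longrightarrow> \<eta> \<in> borel_measurable lebesgue"
  by (rule measurable_completion) (simp add: schwartz_borel)

lemma
  assumes f: "f \<in> borel_measurable lebesgue" "integrable lebesgue (\<lambda>x. f x / complex_of_real (weight x ^ N))"
    and \<eta>: "\<eta> \<in> schwartz" and B: "\<And>x. weight x ^ N * norm (\<eta> x) \<le> B"
  shows weighted_pairing_integrable: "integrable lebesgue (\<lambda>x. f x * \<eta> x)"
    and weighted_pairing_bound: "norm (LINT x|lebesgue. f x * \<eta> x) \<le>
      B * (LINT x|lebesgue. norm (f x / complex_of_real (weight x ^ N)))"
proof -
  have le: "norm (f x * \<eta> x) \<le> B * norm (f x / complex_of_real (weight x ^ N))" for x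
  proof -
    have "norm (f x * \<eta> x) = (weight x ^ N * norm (\<eta> x)) * norm (f x / complex_of_real (weight x ^ N))"
      by (simp add: norm_mult norm_divide norm_power)
    also have "\<dots> \<le> B * norm (f x / complex_of_real (weight x ^ N))"
      by (intro mult_right_mono B) auto
    finally show ?thesis .
  qed
  have iB: "integrable lebesgue (\<lambda>x. B * norm (f x / complex_of_real (weight x ^ N)))"
    by (intro integrable_mult_right integrable_norm f(2))
  show i: "integrable lebesgue (\<lambda>x. f x * \<eta> x)"
  proof (rule Bochner_Integration.integrable_bound[OF iB])
    show "(\<lambda>x. f x * \<eta> x) \<in> borel_measurable lebesgue"
      by (intro borel_measurable_times f(1) schwartz_lebesgue_measurable \<eta>)
    show "AE x in lebesgue. norm (f x * \<eta> x) \<le> norm (B * norm (f x / complex_of_real (weight x ^ N)))"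
      unfolding real_norm_def by (intro AE_I2 order_trans[OF le abs_ge_self])
  qed
  have "norm (LINT x|lebesgue. f x * \<eta> x) \<le> (LINT x|lebesgue. norm (f x * \<eta> x))"
    by (rule integral_norm_bound)
  also have "\<dots> \<le> (LINT x|lebesgue. B * norm (f x / complex_of_real (weight x ^ N)))"
    by (intro integral_mono integrable_norm i iB le)
  also have "\<dots> = B * (LINT x|lebesgue. norm (f x / complex_of_real (weight x ^ N)))"
    by (rule integral_mult_right_zero)
  finally show "norm (LINT x|lebesgue. f x * \<eta> x) \<le>
      B * (LINT x|lebesgue. norm (f x / complex_of_real (weight x ^ N)))" .
qed

lemma moderate_pairing_integrable:
  assumes "moderate f" "\<eta> \<in> schwartz"
  shows "integrable lebesgue (\<lambda>x. f x * \<eta> x)"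
proof -
  obtain N where f: "f \<in> borel_measurable lebesgue" "integrable lebesgue (\<lambda>x. f x / complex_of_real (weight x ^ N))"
    using assms(1) by (auto simp: moderate_def)
  obtain B where "\<And>x. weight x ^ N * norm (\<eta> x) \<le> B"
    using schwartz_rapid[OF assms(2)] unfolding rapid_def by blast
  then show ?thesis by (rule weighted_pairing_integrable[OF f assms(2)])
qed

lemma moderate_unique:
  assumes f: "moderate f" and g: "moderate g"
    and eq: "\<And>\<eta>. \<eta> \<in> schwartz \<Longrightarrow> (LINT x|lebesgue. f x * \<eta> x) = (LINT x|lebesgue. g x * \<eta> x)"
  shows "AE x in lebesgue. f x = g x"
proof -
  obtain N where d: "(\<lambda>x. f x - g x) \<in> borel_measurable lebesgue"
    "integrable lebesgue (\<lambda>x. (f x - g x) / complex_of_real (weight x ^ N))"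
    using moderate_diff[OF f g] by (auto simp: moderate_def)
  have "AE x in lebesgue. f x - g x = 0"
  proof (rule fundamental_lemma[OF d])
    fix \<eta> :: "real^'a \<Rightarrow> complex" assume "\<eta> \<in> schwartz"
    then show "(LINT x|lebesgue. (f x - g x) * \<eta> x) = 0"
      by (simp add: left_diff_distrib moderate_pairing_integrable f g eq)
  qed
  then show ?thesis by eventually_elim simp
qed

lemma distr_of_cong_AE:
  assumes "f \<in> borel_measurable lebesgue" "g \<in> borel_measurable lebesgue" "AE x in lebesgue. f x = g x"
  shows "distr_of f = distr_of g"
  unfolding distr_of_def
proof (intro restrict_ext integral_cong_AE)
  fix \<eta> :: "real^'a \<Rightarrow> complex" assume "\<eta> \<in> schwartz"
  note \<eta> = schwartz_lebesgue_measurable[OF this]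
  show "(\<lambda>x. f x * \<eta> x) \<in> borel_measurable lebesgue" "(\<lambda>x. g x * \<eta> x) \<in> borel_measurable lebesgue"
    by (intro borel_measurable_times assms \<eta>)+
  show "AE x in lebesgue. f x * \<eta> x = g x * \<eta> x"
    using assms(3) by eventually_elim simp
qed

lemma distr_of_eqD:
  assumes "moderate f" "moderate g" "distr_of f = distr_of g"
  shows "AE x in lebesgue. f x = g x"
proof (rule moderate_unique[OF assms(1,2)])
  fix \<eta> :: "real^'a \<Rightarrow> complex" assume "\<eta> \<in> schwartz"
  with fun_cong[OF assms(3), of \<eta>] show "(LINT x|lebesgue. f x * \<eta> x) = (LINT x|lebesgue. g x * \<eta> x)"
    by (simp add: distr_of_def)
qed

lemma schwartz_square_integrable: "\<eta> \<in> schwartz \<Longrightarrow> \<eta> \<in> square_integrable lebesgue"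
proof -
  assume \<eta>: "\<eta> \<in> schwartz"
  have "integrable lborel (\<lambda>x. \<eta> x * cnj (\<eta> x))"
    by (intro schwartz_integrable schwartz_mult_FT schwartz_cnj[THEN subsetD[OF schwartz_subset_FT]] \<eta>)
  then have "integrable lborel (\<lambda>x. norm (\<eta> x * cnj (\<eta> x)))" by (rule integrable_norm)
  then have "integrable lborel (\<lambda>x. (norm (\<eta> x))\<^sup>2)" by (simp add: norm_mult power2_eq_square)
  then have "integrable lebesgue (\<lambda>x. (norm (\<eta> x))\<^sup>2)"
    using schwartz_borel[OF \<eta>] by (subst lebesgue_integrable_eq_lborel) auto
  then show ?thesis
    by (simp add: square_integrable_def schwartz_lebesgue_measurable \<eta>)
qed

lemma moderate_schwartz: "\<eta> \<in> schwartz \<Longrightarrow> moderate \<eta>"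
  by (intro moderate_square_integrable schwartz_square_integrable)

text \<open>Two continuous functions that agree almost everywhere agree on a closed set of full
  measure, hence everywhere. Without injectivity \<open>restrict_schwartz\<close>, defined through
  \<open>inv_into\<close>, could not be computed.\<close>

lemma inj_distr_of: "inj_on distr_of schwartz"
proof (rule inj_onI)
  fix f g :: "real^'d::finite \<Rightarrow> complex"
  assume f: "f \<in> schwartz" and g: "g \<in> schwartz" and eq: "distr_of f = distr_of g"
  have ae: "AE x in lebesgue. x \<in> {x. f x = g x}"
    using distr_of_eqD[OF moderate_schwartz[OF f] moderate_schwartz[OF g] eq] by simp
  have "closed {x. f x = g x}"
    by (intro closed_Collect_eq schwartz_continuous f g)
  then show "f = g" using mem_closed_if_AE_lebesgue[OF _ ae] by auto
qed

lemma schwartz_seminorm_zero: "schwartz_seminorm \<beta> is (\<lambda>x. 0) = 0"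
proof -
  have "iterated_partial is (\<lambda>x::real^'a. 0) \<in> {\<lambda>x. 0}"
    using has_partial_const by (intro iterated_partial_mem) auto
  then show ?thesis by (simp add: schwartz_seminorm_def)
qed

lemma topspace_schwartz: "topspace schwartz_topology = schwartz"
proof -
  let ?B = "\<lambda>f::real^'a \<Rightarrow> complex. {g \<in> schwartz. schwartz_seminorm (\<lambda>_. 0) [] (\<lambda>x. g x - f x) < 1}"
  show ?thesis
    unfolding schwartz_topology_def topology_generated_by_topspace
  proof (intro equalityI subsetI, goal_cases)
    case (1 f)
    then show ?case by (elim UnionE CollectE exE conjE) simp
  next
    case (2 f)
    have "f \<in> ?B f" using 2 by (simp add: schwartz_seminorm_zero)
    then show ?case
      by (rule UnionI[rotated])
        (rule CollectI, rule exI[of _ f], rule exI[of _ "\<lambda>_. 0"], rule exI[of _ "[]"], rule exI[of _ 1],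
          simp add: 2)
  qed
qed

text \<open>The topology is given by a subbasis of seminorm balls; a bound by finitely many
  seminorms makes a finite intersection of balls around \<open>f\<close> map into any given
  neighbourhood of \<open>T f\<close>.\<close>

lemma continuous_map_schwartz:
  fixes T :: "(real^'d::finite \<Rightarrow> complex) \<Rightarrow> complex"
  assumes diff: "\<And>f g. f \<in> schwartz \<Longrightarrow> g \<in> schwartz \<Longrightarrow> T (\<lambda>x. f x - g x) = T f - T g"
    and bound: "\<And>f. f \<in> schwartz \<Longrightarrow> norm (T f) \<le> C * (\<Sum>\<beta>\<leftarrow>L. schwartz_seminorm \<beta> [] f)"
  shows "continuous_map schwartz_topology euclidean T"
  unfolding continuous_map topspace_schwartz
proof (intro conjI allI impI)
  fix U :: "complex set" assume "openin euclidean U"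
  then have U: "open U" by simp
  show "openin schwartz_topology {f \<in> schwartz. T f \<in> U}"
  proof (subst openin_subopen, intro ballI)
    fix f assume "f \<in> {f \<in> schwartz. T f \<in> U}"
    then have f: "f \<in> schwartz" "T f \<in> U" by auto
    obtain e where e: "e > 0" "ball (T f) e \<subseteq> U" using U f(2) open_contains_ball by blast
    \<comment> \<open>The two summands 1 keep the denominator positive when \<open>C\<close> is 0 or
      \<open>L\<close> is empty, and they make the final estimate strict.\<close>
    define \<delta> where "\<delta> = e / ((\<bar>C\<bar> + 1) * (real (length L) + 1))"
    have D: "0 < (\<bar>C\<bar> + 1) * (real (length L) + 1)" by (intro mult_pos_pos) auto
    have \<delta>: "\<delta> > 0" using e D by (simp add: \<delta>_def)
    define W where "W \<beta> = {g \<in> schwartz. schwartz_seminorm \<beta> [] (\<lambda>x. g x - f x) < \<delta>}" for \<beta>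
    have W: "openin schwartz_topology (W \<beta>)" for \<beta>
      unfolding schwartz_topology_def W_def using f(1) \<delta>
      by (intro topology_generated_by_Basis) blast
    have "openin schwartz_topology schwartz"
      using openin_topspace[of schwartz_topology] by (simp add: topspace_schwartz)
    \<comment> \<open>Inserting \<open>schwartz\<close> itself keeps the family nonempty when
      \<open>L\<close> is empty.\<close>
    then have "openin schwartz_topology (\<Inter> (insert schwartz (W ` set L)))"
      using W by (intro openin_Inter) auto
    moreover have "f \<in> \<Inter> (insert schwartz (W ` set L))"
      using f(1) \<delta> by (auto simp: W_def schwartz_seminorm_zero)
    moreover have "\<Inter> (insert schwartz (W ` set L)) \<subseteq> {f \<in> schwartz. T f \<in> U}"
    proof
      fix g assume g: "g \<in> \<Inter> (insert schwartz (W ` set L))"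
      then have gS: "g \<in> schwartz" by auto
      have d: "(\<lambda>x. g x - f x) \<in> schwartz" by (rule schwartz_diff[OF gS f(1)])
      have "(\<Sum>\<beta>\<leftarrow>L. schwartz_seminorm \<beta> [] (\<lambda>x. g x - f x)) \<le> (\<Sum>\<beta>\<leftarrow>L. \<delta>)"
        using g by (intro sum_list_mono) (auto simp: W_def intro: less_imp_le)
      moreover have s0: "0 \<le> schwartz_seminorm \<beta> [] (\<lambda>x. g x - f x)" for \<beta>
        by (rule order_trans[OF _ schwartz_seminorm_bound[OF d, of \<beta> 0 "[]"]]) auto
      moreover have "0 \<le> (\<Sum>\<beta>\<leftarrow>L. schwartz_seminorm \<beta> [] (\<lambda>x. g x - f x))"
        using s0 by (intro sum_list_nonneg) auto
      ultimately have "C * (\<Sum>\<beta>\<leftarrow>L. schwartz_seminorm \<beta> [] (\<lambda>x. g x - f x)) \<le> \<bar>C\<bar> * (real (length L) * \<delta>)"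
        by (intro mult_mono) (auto simp: sum_list_triv)
      also have "\<dots> < (\<bar>C\<bar> + 1) * (real (length L) + 1) * \<delta>"
        using \<delta> by (simp add: algebra_simps add_pos_nonneg)
      also have "\<dots> = e" using D by (simp add: \<delta>_def)
      finally have "norm (T g - T f) < e"
        using bound[OF d] diff[OF gS f(1)] by simp
      then have "T g \<in> ball (T f) e" by (simp add: dist_norm norm_minus_commute)
      with e(2) gS show "g \<in> {f \<in> schwartz. T f \<in> U}" by auto
    qed
    ultimately show "\<exists>V. openin schwartz_topology V \<and> f \<in> V \<and> V \<subseteq> {f \<in> schwartz. T f \<in> U}" by blast
  qed
qed simp

lemma distr_of_tempered:
  assumes f: "moderate f"
  shows "distr_of f \<in> tempered"
  unfolding tempered_def
proof (intro CollectI IntI conjI ballI allI)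
  show "distr_of f \<in> extensional schwartz" by (simp add: distr_of_def)
  show lin: "distr_of f (\<lambda>x. a * \<gamma> x + b * \<eta> x) = a * distr_of f \<gamma> + b * distr_of f \<eta>"
    if "\<gamma> \<in> schwartz" "\<eta> \<in> schwartz" for a b \<gamma> \<eta>
  proof -
    have "(LINT x|lebesgue. f x * (a * \<gamma> x + b * \<eta> x)) = (LINT x|lebesgue. a * (f x * \<gamma> x) + b * (f x * \<eta> x))"
      by (intro Bochner_Integration.integral_cong) (auto simp: algebra_simps)
    also have "\<dots> = a * (LINT x|lebesgue. f x * \<gamma> x) + b * (LINT x|lebesgue. f x * \<eta> x)"
      using that f by (simp add: moderate_pairing_integrable)
    finally show ?thesis using that by (simp add: distr_of_def schwartz_lincomb)
  qed
  obtain N where N: "f \<in> borel_measurable lebesgue" "integrable lebesgue (\<lambda>x. f x / complex_of_real (weight x ^ N))"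
    using f by (auto simp: moderate_def)
  obtain L where L: "\<And>\<gamma> x. \<gamma> \<in> schwartz \<Longrightarrow> weight (x::real^'a) ^ N * norm (\<gamma> x) \<le> (\<Sum>\<beta>\<leftarrow>L. schwartz_seminorm \<beta> [] \<gamma>)"
    using schwartz_weight_bound[of N "[]"] by auto
  show "continuous_map schwartz_topology euclidean (distr_of f)"
  proof (rule continuous_map_schwartz[where C = "LINT x|lebesgue. norm (f x / complex_of_real (weight x ^ N))" and L = L])
    show "distr_of f (\<lambda>x. g x - h x) = distr_of f g - distr_of f h" if "g \<in> schwartz" "h \<in> schwartz" for g h
      using lin[OF that, of 1 "-1"] by simp
    show "norm (distr_of f \<gamma>) \<le> (LINT x|lebesgue. norm (f x / complex_of_real (weight x ^ N))) *
        (\<Sum>\<beta>\<leftarrow>L. schwartz_seminorm \<beta> [] \<gamma>)" if "\<gamma> \<in> schwartz" for \<gamma>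
      using weighted_pairing_bound[OF N that L[OF that]] that by (simp add: distr_of_def mult.commute)
  qed
qed

subsection \<open>The Plancherel theorem\<close>

lemma l2_norm2_cong_AE:
  assumes "f \<in> square_integrable M" "g \<in> square_integrable M" "AE x in M. f x = g x"
    and "h \<in> square_integrable M"
  shows "l2_norm2 M (\<lambda>x. h x - f x) = l2_norm2 M (\<lambda>x. h x - g x)"
proof -
  note [measurable] = square_integrableD(1)[OF assms(4)] square_integrableD(1)[OF assms(1)] square_integrableD(1)[OF assms(2)]
  show ?thesis unfolding l2_norm2_def
    by (intro integral_cong_AE) (use assms(3) in auto)
qed

text \<open>Project \<open>h\<close> onto the closure of the Schwartz space. The remainder
  annihilates all Schwartz functions, so it vanishes almost everywhere by the fundamental
  lemma.\<close>

lemma schwartz_dense: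
  assumes h: "h \<in> square_integrable lebesgue"
  shows "\<exists>u. (\<forall>n. u n \<in> schwartz) \<and> l2_tendsto lebesgue u h"
proof -
  have "\<exists>u f. (\<forall>n. u n \<in> schwartz) \<and> l2_tendsto lebesgue u f \<and>
      (\<forall>v\<in>schwartz. Re (l2_inner lebesgue (\<lambda>x. h x - f x) v) = 0)"
    by (rule l2_projection[OF _ _ _ h]) (auto intro: schwartz_square_integrable schwartz_zero schwartz_lincomb)
  then obtain u f where u: "\<And>n. u n \<in> schwartz" "l2_tendsto lebesgue u f"
    and orth: "\<And>v. v \<in> schwartz \<Longrightarrow> Re (l2_inner lebesgue (\<lambda>x. h x - f x) v) = 0" by blast
  note f = l2_tendstoD(2)[OF u(2)]
  have ae: "AE x in lebesgue. h x = f x"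
  proof (rule moderate_unique[OF moderate_square_integrable[OF h] moderate_square_integrable[OF f]])
    fix \<eta> :: "real^'a \<Rightarrow> complex" assume \<eta>: "\<eta> \<in> schwartz"
    \<comment> \<open>The projection controls real parts only, but the Schwartz space is complex
      linear: the multipliers 1 and i recover both parts.\<close>
    have *: "Re (LINT x|lebesgue. (h x - f x) * (c * \<eta> x)) = 0" for c
      using orth[OF schwartz_cnj[OF schwartz_scale[OF \<eta>, of c]]] by (simp add: l2_inner_def)
    have "(LINT x|lebesgue. (h x - f x) * (c * \<eta> x)) = c * (LINT x|lebesgue. (h x - f x) * \<eta> x)" for c
      by (simp add: mult.left_commute[of _ c])
    from *[unfolded this, of 1] *[unfolded this, of \<i>] have "(LINT x|lebesgue. (h x - f x) * \<eta> x) = 0"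
      by (simp add: complex_eq_iff)
    then show "(LINT x|lebesgue. h x * \<eta> x) = (LINT x|lebesgue. f x * \<eta> x)"
      using moderate_pairing_integrable[OF moderate_square_integrable[OF h] \<eta>]
        moderate_pairing_integrable[OF moderate_square_integrable[OF f] \<eta>]
      by (simp add: left_diff_distrib)
  qed
  have "l2_tendsto lebesgue u h"
    using u(2) h l2_norm2_cong_AE[OF h f ae] unfolding l2_tendsto_def by simp
  with u(1) show ?thesis by blast
qed

lemma l2_inner_fourier:
  assumes "f \<in> schwartz" "g \<in> schwartz"
  shows "l2_inner lebesgue (fourier f) (fourier g) = l2_inner lebesgue f g"
proof -
  note [measurable] = assms[THEN schwartz_borel] assms[THEN fourier_schwartz, THEN schwartz_borel]
  show ?thesis
    unfolding l2_inner_def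
    by (subst (1 2) lebesgue_integral_eq_lborel) (auto simp: Parseval_schwartz assms)
qed

lemma l2_norm2_fourier:
  assumes "f \<in> schwartz"
  shows "l2_norm2 lebesgue (fourier f) = l2_norm2 lebesgue f"
  using l2_inner_fourier[OF assms assms] by (simp add: l2_inner_self)

lemma fourier_diff:
  assumes "f \<in> schwartz" "g \<in> schwartz"
  shows "fourier (\<lambda>x. f x - g x) = (\<lambda>x. fourier f x - fourier g x)"
proof
  fix x
  have "fourier (\<lambda>x. f x + (-1) * g x) x = fourier f x + fourier (\<lambda>x. (-1) * g x) x"
    by (intro fourier_add schwartz_integrable schwartz_scale assms)
  then show "fourier (\<lambda>x. f x - g x) x = fourier f x - fourier g x"
    unfolding fourier_scaleC by simp
qed

text \<open>The graph of the extended Fourier transform. A relation is used because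
  square-integrable functions are determined only up to null sets, so no canonical value
  exists.\<close>

definition plancherel_pair :: "(real^'d::finite \<Rightarrow> complex) \<Rightarrow> (real^'d \<Rightarrow> complex) \<Rightarrow> bool" where
  "plancherel_pair h k \<longleftrightarrow> (\<exists>u. (\<forall>n. u n \<in> schwartz) \<and> l2_tendsto lebesgue u h \<and>
     l2_tendsto lebesgue (\<lambda>n. fourier (u n)) k)"

lemma l2_cauchy_fourier_iff:
  assumes "\<And>n. u n \<in> schwartz"
  shows "l2_cauchy lebesgue (\<lambda>n. fourier (u n)) \<longleftrightarrow> l2_cauchy lebesgue u"
  unfolding l2_cauchy_def fourier_diff[OF assms assms, symmetric]
    l2_norm2_fourier[OF schwartz_diff[OF assms assms]]
  using assms by (auto intro: schwartz_square_integrable fourier_schwartz)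

lemma plancherel_ex_right:
  assumes "h \<in> square_integrable lebesgue"
  shows "\<exists>k. plancherel_pair h k"
proof -
  obtain u where u: "\<And>n. u n \<in> schwartz" "l2_tendsto lebesgue u h" using schwartz_dense[OF assms] by blast
  have "l2_cauchy lebesgue (\<lambda>n. fourier (u n))"
    unfolding l2_cauchy_fourier_iff[OF u(1)] by (rule l2_tendsto_cauchy[OF u(2)])
  then show ?thesis using l2_complete u unfolding plancherel_pair_def by blast
qed

lemma plancherel_ex_left:
  assumes "k \<in> square_integrable lebesgue"
  shows "\<exists>h. plancherel_pair h k"
proof -
  obtain v where v: "\<And>n. v n \<in> schwartz" "l2_tendsto lebesgue v k" using schwartz_dense[OF assms] by blast
  define u where "u n = inverse_fourier (v n)" for n
  have u: "u n \<in> schwartz" "fourier (u n) = v n" for n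
    by (simp_all add: u_def inverse_fourier_schwartz fourier_inverse_fourier v)
  have "l2_cauchy lebesgue u"
    using l2_tendsto_cauchy[OF v(2)] unfolding l2_cauchy_fourier_iff[OF u(1), symmetric] u(2) .
  then obtain h where "l2_tendsto lebesgue u h" using l2_complete by blast
  then show ?thesis
    unfolding plancherel_pair_def using u v(2) by (intro exI[of _ h] exI[of _ u]) simp
qed

lemma plancherel_sq:
  assumes "plancherel_pair h k"
  shows "h \<in> square_integrable lebesgue" "k \<in> square_integrable lebesgue"
  using assms unfolding plancherel_pair_def by (auto dest: l2_tendstoD(2))

lemma plancherel_inner:
  assumes "plancherel_pair h k" "plancherel_pair h' k'"
  shows "l2_inner lebesgue h h' = l2_inner lebesgue k k'"
proof -
  obtain u where u: "\<And>n. u n \<in> schwartz" "l2_tendsto lebesgue u h" "l2_tendsto lebesgue (\<lambda>n. fourier (u n)) k"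
    using assms(1) unfolding plancherel_pair_def by blast
  obtain v where v: "\<And>n. v n \<in> schwartz" "l2_tendsto lebesgue v h'" "l2_tendsto lebesgue (\<lambda>n. fourier (v n)) k'"
    using assms(2) unfolding plancherel_pair_def by blast
  have "(\<lambda>n. l2_inner lebesgue (u n) (v n)) \<longlonglongrightarrow> l2_inner lebesgue h h'"
    by (rule l2_tendsto_inner[OF u(2) v(2)])
  moreover have "(\<lambda>n. l2_inner lebesgue (u n) (v n)) \<longlonglongrightarrow> l2_inner lebesgue k k'"
    using l2_tendsto_inner[OF u(3) v(3)] by (simp add: l2_inner_fourier u(1) v(1))
  ultimately show ?thesis by (rule LIMSEQ_unique)
qed

lemma schwartz_multiplication_formula:
  assumes "f \<in> schwartz" "g \<in> schwartz"
  shows "(LINT x|lebesgue. f x * fourier g x) = (LINT x|lebesgue. fourier f x * g x)"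
proof -
  note [measurable] = assms[THEN schwartz_borel] assms[THEN fourier_schwartz, THEN schwartz_borel]
  show ?thesis
    by (subst (1 2) lebesgue_integral_eq_lborel)
      (auto intro!: fourier_multiplication_formula schwartz_integrable assms)
qed

lemma plancherel_duality:
  assumes "plancherel_pair h k" and \<eta>: "\<eta> \<in> schwartz"
  shows "(LINT x|lebesgue. h x * fourier \<eta> x) = (LINT x|lebesgue. k x * \<eta> x)"
proof -
  obtain u where u: "\<And>n. u n \<in> schwartz" "l2_tendsto lebesgue u h" "l2_tendsto lebesgue (\<lambda>n. fourier (u n)) k"
    using assms(1) unfolding plancherel_pair_def by blast
  have c: "(LINT x|lebesgue. f x * \<xi> x) = l2_inner lebesgue f (\<lambda>x. cnj (\<xi> x))" for f \<xi> :: "real^'a \<Rightarrow> complex"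
    by (simp add: l2_inner_def)
  have S: "(\<lambda>x. cnj (fourier \<eta> x)) \<in> square_integrable lebesgue" "(\<lambda>x. cnj (\<eta> x)) \<in> square_integrable lebesgue"
    by (intro schwartz_square_integrable schwartz_cnj fourier_schwartz \<eta>)+
  have "(\<lambda>n. LINT x|lebesgue. u n x * fourier \<eta> x) \<longlonglongrightarrow> (LINT x|lebesgue. h x * fourier \<eta> x)"
    unfolding c by (rule l2_tendsto_inner[OF u(2) l2_tendsto_const[OF S(1)]])
  moreover have "(\<lambda>n. LINT x|lebesgue. u n x * fourier \<eta> x) \<longlonglongrightarrow> (LINT x|lebesgue. k x * \<eta> x)"
    unfolding schwartz_multiplication_formula[OF u(1) \<eta>]
    unfolding c by (rule l2_tendsto_inner[OF u(3) l2_tendsto_const[OF S(2)]])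
  ultimately show ?thesis by (rule LIMSEQ_unique)
qed

subsection \<open>The native space of a kernel with a square-integrable feature map\<close>

lemma poly_space_0: "poly_space 0 = {\<lambda>x. 0}"
  by (auto simp: poly_space_def)

lemma annihilates_0: "annihilates 0 X c"
  by (simp add: annihilates_def poly_space_0)

lemma interpolant_empty: "interpolant 0 {} f = (\<lambda>x. 0)"
  by (simp add: interpolant_def)

text \<open>Writing the kernel as an inner product of features embeds the kernel space isometrically
  into L2, so its abstract completion by Cauchy sequences can be replaced by limits in L2.\<close>

locale feature_map =
  fixes M :: "'a measure" and E :: "real^'d::finite \<Rightarrow> 'a \<Rightarrow> complex" and G :: "real^'d \<Rightarrow> real"
  assumes E: "\<And>x. E x \<in> square_integrable M"
    and inner_E: "\<And>x z. l2_inner M (E x) (E z) = complex_of_real (G (x - z))"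
begin

definition comb :: "(real^'d) set \<Rightarrow> (real^'d \<Rightarrow> real) \<Rightarrow> 'a \<Rightarrow> complex" where
  "comb X c = (\<lambda>y. \<Sum>x\<in>X. complex_of_real (c x) * E x y)"

text \<open>A kernel combination and a feature combination are linked by having the same points and
  coefficients. As a relation this needs no uniqueness of the coefficients.\<close>

definition rep :: "(real^'d \<Rightarrow> real) \<Rightarrow> ('a \<Rightarrow> complex) \<Rightarrow> bool" where
  "rep f \<phi> \<longleftrightarrow> (\<exists>X c. finite X \<and> f = kernel_comb G X c \<and> \<phi> = comb X c)"

abbreviation "V \<equiv> kernel_space 0 G"
abbreviation "ip \<equiv> kernel_inner 0 G"

lemma even: "G (- x) = G x"
proof -
  have "complex_of_real (G (0 - x)) = cnj (complex_of_real (G (x - 0)))"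
    unfolding inner_E[symmetric] by (rule l2_inner_cnj)
  then show ?thesis by simp
qed

lemma even_diff: "G (x - z) = G (z - x)"
  using even[of "x - z"] by simp

lemma comb_sq: "finite X \<Longrightarrow> comb X c \<in> square_integrable M"
  unfolding comb_def by (intro square_integrable_sum square_integrable_scale E)

lemma rep_sq: "rep f \<phi> \<Longrightarrow> \<phi> \<in> square_integrable M"
  by (auto simp: rep_def comb_sq)

lemma kernel_space_iff: "f \<in> V \<longleftrightarrow> (\<exists>\<phi>. rep f \<phi>)"
  by (auto simp: kernel_space_def annihilates_0 rep_def)

lemma inner_comb:
  assumes "finite X" "finite Y"
  shows "l2_inner M (comb X a) (comb Y b) = complex_of_real (\<Sum>x\<in>X. \<Sum>y\<in>Y. a x * b y * G (x - y))"
proof -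
  have "l2_inner M (comb X a) (comb Y b) =
      (\<Sum>x\<in>X. \<Sum>y\<in>Y. complex_of_real (a x) * (complex_of_real (b y) * complex_of_real (G (x - y))))"
    using assms unfolding comb_def
    by (subst l2_inner_sum_left; (intro square_integrable_sum square_integrable_scale E)?)
      (auto simp: l2_inner_scale_left inner_E square_integrable_scale E l2_inner_sum_right
        l2_inner_scale_right sum_distrib_left)
  then show ?thesis by (simp add: mult.assoc)
qed

text \<open>The double sum equals a sum of values of the second function and, by evenness of
  \<open>G\<close>, also a sum of values of the first. It therefore survives a change of
  representation in one argument at a time, which makes the definite description proper.\<close>

lemma kernel_inner_eq:
  assumes X: "finite X" and Y: "finite Y"
  shows "ip (kernel_comb G X a) (kernel_comb G Y b) = (\<Sum>x\<in>X. \<Sum>y\<in>Y. a x * b y * G (x - y))"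
proof -
  have 1: "(\<Sum>x\<in>X. \<Sum>y\<in>Y. a x * b y * G (x - y)) = (\<Sum>x\<in>X. a x * kernel_comb G Y b x)" for X a Y b
    by (simp add: kernel_comb_def sum_distrib_left mult.assoc)
  have 2: "(\<Sum>x\<in>X. \<Sum>y\<in>Y. a x * b y * G (x - y)) = (\<Sum>y\<in>Y. b y * kernel_comb G X a y)" for X a Y b
    by (subst sum.swap) (simp add: kernel_comb_def sum_distrib_left mult_ac even_diff[of _ "_ :: real^'d"])
  show ?thesis unfolding kernel_inner_def
  proof (rule the_equality)
    show "\<exists>X' a' Y' b'. finite X' \<and> annihilates 0 X' a' \<and> kernel_comb G X a = kernel_comb G X' a' \<and>
        finite Y' \<and> annihilates 0 Y' b' \<and> kernel_comb G Y b = kernel_comb G Y' b' \<and>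
        (\<Sum>x\<in>X. \<Sum>y\<in>Y. a x * b y * G (x - y)) = (\<Sum>x\<in>X'. \<Sum>y\<in>Y'. a' x * b' y * G (x - y))"
      using X Y annihilates_0 by blast
  next
    fix r
    assume "\<exists>X' a' Y' b'. finite X' \<and> annihilates 0 X' a' \<and> kernel_comb G X a = kernel_comb G X' a' \<and>
        finite Y' \<and> annihilates 0 Y' b' \<and> kernel_comb G Y b = kernel_comb G Y' b' \<and>
        r = (\<Sum>x\<in>X'. \<Sum>y\<in>Y'. a' x * b' y * G (x - y))"
    then obtain X' a' Y' b' where eq: "kernel_comb G X a = kernel_comb G X' a'"
      "kernel_comb G Y b = kernel_comb G Y' b'" "r = (\<Sum>x\<in>X'. \<Sum>y\<in>Y'. a' x * b' y * G (x - y))"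
      by blast
    have "r = (\<Sum>x\<in>X'. \<Sum>y\<in>Y. a' x * b y * G (x - y))"
      unfolding eq(3) 1 eq(2) ..
    also have "\<dots> = (\<Sum>x\<in>X. \<Sum>y\<in>Y. a x * b y * G (x - y))"
      unfolding 2 eq(1) ..
    finally show "r = (\<Sum>x\<in>X. \<Sum>y\<in>Y. a x * b y * G (x - y))" .
  qed
qed

lemma rep_inner:
  assumes "rep f \<phi>" "rep g \<psi>"
  shows "l2_inner M \<phi> \<psi> = complex_of_real (ip f g)"
  using assms unfolding rep_def by (auto simp: inner_comb kernel_inner_eq)

lemma rep_diff:
  assumes "rep f \<phi>" "rep g \<psi>"
  shows "rep (f - g) (\<lambda>y. \<phi> y - \<psi> y)"
proof -
  obtain X a where X: "finite X" "f = kernel_comb G X a" "\<phi> = comb X a" using assms(1) by (auto simp: rep_def)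
  obtain Y b where Y: "finite Y" "g = kernel_comb G Y b" "\<psi> = comb Y b" using assms(2) by (auto simp: rep_def)
  \<comment> \<open>Both coefficient families are padded by 0 so that they live on the common point
    set \<open>X \<union> Y\<close>.\<close>
  let ?a = "\<lambda>x. if x \<in> X then a x else 0" and ?b = "\<lambda>x. if x \<in> Y then b x else 0"
  have s: "(\<Sum>x\<in>X. h (a x) x) = (\<Sum>x\<in>X \<union> Y. h (?a x) x)" "(\<Sum>x\<in>Y. h (b x) x) = (\<Sum>x\<in>X \<union> Y. h (?b x) x)"
    if "\<And>x. h 0 x = 0" for h :: "real \<Rightarrow> real^'d \<Rightarrow> 'c::comm_monoid_add"
    using X(1) Y(1) that by (intro sum.mono_neutral_cong_left; auto)+
  have "f - g = kernel_comb G (X \<union> Y) (\<lambda>x. ?a x - ?b x)"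
    unfolding X Y kernel_comb_def fun_diff_def
    by (intro ext, subst s(1)[of "\<lambda>r x. r * G (_ - x)"], simp, subst s(2)[of "\<lambda>r x. r * G (_ - x)"], simp)
      (simp add: left_diff_distrib sum_subtractf)
  moreover have "(\<lambda>y. \<phi> y - \<psi> y) = comb (X \<union> Y) (\<lambda>x. ?a x - ?b x)"
    unfolding X Y comb_def
    by (intro ext, subst s(1)[of "\<lambda>r x. complex_of_real r * E x _"], simp, subst s(2)[of "\<lambda>r x. complex_of_real r * E x _"], simp)
      (simp add: left_diff_distrib sum_subtractf)
  ultimately show ?thesis unfolding rep_def using X(1) Y(1) by blast
qed

lemma ip_diff:
  assumes "rep f \<phi>" "rep g \<psi>"
  shows "ip (f - g) (f - g) = l2_norm2 M (\<lambda>y. \<phi> y - \<psi> y)"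
  using rep_inner[OF rep_diff[OF assms] rep_diff[OF assms]] by (simp add: l2_inner_self)

lemma cauchy_seqs_iff:
  assumes "\<And>n. rep (u n) (\<phi> n)"
  shows "u \<in> cauchy_seqs V ip \<longleftrightarrow> l2_cauchy M \<phi>"
proof -
  have "(\<forall>e>0. \<exists>K. \<forall>k\<ge>K. \<forall>l\<ge>K. sqrt (ip (u k - u l) (u k - u l)) < e) \<longleftrightarrow>
      (\<forall>e>0. \<exists>K. \<forall>k\<ge>K. \<forall>l\<ge>K. l2_norm2 M (\<lambda>y. \<phi> k y - \<phi> l y) < e)"
    unfolding ip_diff[OF assms assms]
  proof (intro iffI allI impI)
    fix e :: real assume *: "\<forall>e>0. \<exists>K. \<forall>k\<ge>K. \<forall>l\<ge>K. sqrt (l2_norm2 M (\<lambda>y. \<phi> k y - \<phi> l y)) < e" and e: "0 < e"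
    have "sqrt e > 0" using e by simp
    with * show "\<exists>K. \<forall>k\<ge>K. \<forall>l\<ge>K. l2_norm2 M (\<lambda>y. \<phi> k y - \<phi> l y) < e"
      by (metis real_sqrt_less_iff)
  next
    fix e :: real assume *: "\<forall>e>0. \<exists>K. \<forall>k\<ge>K. \<forall>l\<ge>K. l2_norm2 M (\<lambda>y. \<phi> k y - \<phi> l y) < e" and e: "0 < e"
    then obtain K where K: "\<forall>k\<ge>K. \<forall>l\<ge>K. l2_norm2 M (\<lambda>y. \<phi> k y - \<phi> l y) < e\<^sup>2"
      by (meson zero_less_power)
    show "\<exists>K. \<forall>k\<ge>K. \<forall>l\<ge>K. sqrt (l2_norm2 M (\<lambda>y. \<phi> k y - \<phi> l y)) < e"
      using K e by (intro exI[of _ K]) (auto intro!: real_less_lsqrt)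
  qed
  moreover have "u n \<in> V" "\<phi> n \<in> square_integrable M" for n
    using assms[of n] rep_sq by (auto simp: kernel_space_iff)
  ultimately show ?thesis by (auto simp: cauchy_seqs_def l2_cauchy_def)
qed

lemma cauchy_seqs_rep: "u \<in> cauchy_seqs V ip \<Longrightarrow> \<exists>\<phi>. \<forall>n. rep (u n) (\<phi> n)"
  unfolding cauchy_seqs_def kernel_space_iff by (auto intro: choice)

lemma l2_tendsto_close:
  assumes f: "l2_tendsto M \<phi> \<Phi>" and s: "\<And>n. \<psi> n \<in> square_integrable M"
    and c: "(\<lambda>n. l2_norm2 M (\<lambda>y. \<phi> n y - \<psi> n y)) \<longlonglongrightarrow> 0"
  shows "l2_tendsto M \<psi> \<Phi>"
  unfolding l2_tendsto_def
proof (intro conjI allI s l2_tendstoD(2)[OF f])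
  have le: "l2_norm2 M (\<lambda>y. \<psi> n y - \<Phi> y) \<le> 2 * l2_norm2 M (\<lambda>y. \<phi> n y - \<psi> n y) + 2 * l2_norm2 M (\<lambda>y. \<phi> n y - \<Phi> y)" for n
    using l2_norm2_diff_le[OF s[of n] l2_tendstoD(1)[OF f, of n] l2_tendstoD(2)[OF f]]
    by (simp add: l2_norm2_minus_commute[of M "\<psi> n" "\<phi> n"])
  show "(\<lambda>n. l2_norm2 M (\<lambda>y. \<psi> n y - \<Phi> y)) \<longlonglongrightarrow> 0"
  proof (rule tendsto_sandwich[OF _ _ tendsto_const])
    show "(\<lambda>n. 2 * l2_norm2 M (\<lambda>y. \<phi> n y - \<psi> n y) + 2 * l2_norm2 M (\<lambda>y. \<phi> n y - \<Phi> y)) \<longlonglongrightarrow> 0"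
      using tendsto_add[OF tendsto_mult_left[OF c, of 2] tendsto_mult_left[OF l2_tendstoD(3)[OF f], of 2]] by simp
  qed (use le in auto)
qed

lemma l2_tendsto_diff_0:
  assumes f: "l2_tendsto M \<phi> \<Phi>" and g: "l2_tendsto M \<psi> \<Phi>"
  shows "(\<lambda>n. l2_norm2 M (\<lambda>y. \<phi> n y - \<psi> n y)) \<longlonglongrightarrow> 0"
proof (rule tendsto_sandwich[OF _ _ tendsto_const])
  have le: "l2_norm2 M (\<lambda>y. \<phi> n y - \<psi> n y) \<le> 2 * l2_norm2 M (\<lambda>y. \<phi> n y - \<Phi> y) + 2 * l2_norm2 M (\<lambda>y. \<psi> n y - \<Phi> y)" for n
    using l2_norm2_diff_le[OF l2_tendstoD(1)[OF f, of n] l2_tendstoD(2)[OF f] l2_tendstoD(1)[OF g, of n]]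
    by (simp add: l2_norm2_minus_commute[of M \<Phi>])
  show "(\<lambda>n. 2 * l2_norm2 M (\<lambda>y. \<phi> n y - \<Phi> y) + 2 * l2_norm2 M (\<lambda>y. \<psi> n y - \<Phi> y)) \<longlonglongrightarrow> 0"
    using tendsto_add[OF tendsto_mult_left[OF l2_tendstoD(3)[OF f], of 2]
        tendsto_mult_left[OF l2_tendstoD(3)[OF g], of 2]] by simp
  show "\<forall>\<^sub>F n in sequentially. l2_norm2 M (\<lambda>y. \<phi> n y - \<psi> n y) \<le>
      2 * l2_norm2 M (\<lambda>y. \<phi> n y - \<Phi> y) + 2 * l2_norm2 M (\<lambda>y. \<psi> n y - \<Phi> y)"
    using le by simp
qed auto

text \<open>Under the isometry, two sequences are equivalent precisely if their L2 images have the
  same limit; an equivalence class is thus described by one function \<Phi>.\<close>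

lemma null_rel_iff:
  assumes u: "\<And>n. rep (u n) (\<phi> n)" and lim: "l2_tendsto M \<phi> \<Phi>" and v: "\<And>n. rep (v n) (\<psi> n)"
  shows "(u, v) \<in> null_rel V ip \<longleftrightarrow> l2_tendsto M \<psi> \<Phi>"
proof -
  have uc: "u \<in> cauchy_seqs V ip"
    unfolding cauchy_seqs_iff[OF u] by (rule l2_tendsto_cauchy[OF lim])
  have sq: "\<psi> n \<in> square_integrable M" for n by (rule rep_sq[OF v])
  have eq: "(\<lambda>n. sqrt (ip (u n - v n) (u n - v n))) \<longlonglongrightarrow> 0 \<longleftrightarrow>
      (\<lambda>n. l2_norm2 M (\<lambda>y. \<phi> n y - \<psi> n y)) \<longlonglongrightarrow> 0"
    unfolding ip_diff[OF u v]
  proof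
    assume "(\<lambda>n. sqrt (l2_norm2 M (\<lambda>y. \<phi> n y - \<psi> n y))) \<longlonglongrightarrow> 0"
    from tendsto_power[OF this, of 2] show "(\<lambda>n. l2_norm2 M (\<lambda>y. \<phi> n y - \<psi> n y)) \<longlonglongrightarrow> 0" by simp
  next
    assume "(\<lambda>n. l2_norm2 M (\<lambda>y. \<phi> n y - \<psi> n y)) \<longlonglongrightarrow> 0"
    from tendsto_real_sqrt[OF this] show "(\<lambda>n. sqrt (l2_norm2 M (\<lambda>y. \<phi> n y - \<psi> n y))) \<longlonglongrightarrow> 0" by simp
  qed
  show ?thesis
  proof
    assume "(u, v) \<in> null_rel V ip"
    then show "l2_tendsto M \<psi> \<Phi>"
      unfolding null_rel_def using eq by (auto intro: l2_tendsto_close[OF lim sq])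
  next
    assume t: "l2_tendsto M \<psi> \<Phi>"
    then have "v \<in> cauchy_seqs V ip" unfolding cauchy_seqs_iff[OF v] by (rule l2_tendsto_cauchy)
    then show "(u, v) \<in> null_rel V ip"
      unfolding null_rel_def using uc eq l2_tendsto_diff_0[OF lim t] by auto
  qed
qed

text \<open>The L2 picture of an element of the completion: \<Phi> is the limit of the feature
  combinations of any sequence in the class \<open>A\<close>, and is determined up to null
  sets.\<close>

definition represents :: "(nat \<Rightarrow> real^'d \<Rightarrow> real) set \<Rightarrow> ('a \<Rightarrow> complex) \<Rightarrow> bool" where
  "represents A \<Phi> \<longleftrightarrow> \<Phi> \<in> square_integrable M \<and>
     (\<exists>u \<phi>. (\<forall>n. rep (u n) (\<phi> n)) \<and> l2_tendsto M \<phi> \<Phi> \<and> A = null_rel V ip `` {u})"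

lemma represents_iff:
  assumes A: "represents A \<Phi>" and v: "\<And>n. rep (v n) (\<psi> n)"
  shows "v \<in> A \<longleftrightarrow> l2_tendsto M \<psi> \<Phi>"
proof -
  obtain u \<phi> where u: "\<And>n. rep (u n) (\<phi> n)" "l2_tendsto M \<phi> \<Phi>" "A = null_rel V ip `` {u}"
    using A unfolding represents_def by blast
  show ?thesis using null_rel_iff[of u \<phi> \<Phi> v \<psi>, OF u(1,2) v] u(3) by auto
qed

lemma represents_mem:
  assumes "represents A \<Phi>" "v \<in> A"
  shows "\<exists>\<psi>. (\<forall>n. rep (v n) (\<psi> n)) \<and> l2_tendsto M \<psi> \<Phi>"
proof -
  have "v \<in> cauchy_seqs V ip"
    using assms unfolding represents_def null_rel_def by auto
  then obtain \<psi> where "\<And>n. rep (v n) (\<psi> n)" using cauchy_seqs_rep by blast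
  then show ?thesis using represents_iff[OF assms(1)] assms(2) by blast
qed

lemma represents_ex_mem:
  assumes "represents A \<Phi>"
  shows "\<exists>v\<in>A. \<exists>\<psi>. (\<forall>n. rep (v n) (\<psi> n)) \<and> l2_tendsto M \<psi> \<Phi>"
  using assms represents_iff[OF assms] unfolding represents_def by blast

lemma represents_intro:
  assumes "\<And>n. rep (u n) (\<phi> n)" "l2_tendsto M \<phi> \<Phi>"
  shows "represents (null_rel V ip `` {u}) \<Phi>" "null_rel V ip `` {u} \<in> kernel_completion 0 G"
proof -
  show "represents (null_rel V ip `` {u}) \<Phi>"
    unfolding represents_def using assms l2_tendstoD(2)[OF assms(2)] by blast
  have "u \<in> cauchy_seqs V ip"
    unfolding cauchy_seqs_iff[OF assms(1)] by (rule l2_tendsto_cauchy[OF assms(2)])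
  then show "null_rel V ip `` {u} \<in> kernel_completion 0 G"
    unfolding completion_def by (rule quotientI)
qed

lemma completion_represents:
  assumes "A \<in> kernel_completion 0 G"
  shows "\<exists>\<Phi>. represents A \<Phi>"
proof -
  obtain u where u: "u \<in> cauchy_seqs V ip" "A = null_rel V ip `` {u}"
    using assms unfolding completion_def by (auto elim: quotientE)
  obtain \<phi> where \<phi>: "\<And>n. rep (u n) (\<phi> n)" using cauchy_seqs_rep[OF u(1)] by blast
  obtain \<Phi> where "l2_tendsto M \<phi> \<Phi>"
    using u(1) l2_complete unfolding cauchy_seqs_iff[OF \<phi>] by blast
  then show ?thesis using represents_intro(1)[of u \<phi> \<Phi>, OF \<phi>] u(2) by blast
qed

lemma represents_inner:
  assumes A: "represents A \<Phi>" and B: "represents B \<Psi>"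
  shows "complex_of_real (completion_inner ip A B) = l2_inner M \<Phi> \<Psi>"
proof -
  have lim: "(\<lambda>n. complex_of_real (ip (u n) (v n))) \<longlonglongrightarrow> l2_inner M \<Phi> \<Psi>" if "u \<in> A" "v \<in> B" for u v
  proof -
    obtain \<phi> where \<phi>: "\<And>n. rep (u n) (\<phi> n)" "l2_tendsto M \<phi> \<Phi>" using represents_mem[OF A \<open>u \<in> A\<close>] by blast
    obtain \<psi> where \<psi>: "\<And>n. rep (v n) (\<psi> n)" "l2_tendsto M \<psi> \<Psi>" using represents_mem[OF B \<open>v \<in> B\<close>] by blast
    show ?thesis
      using l2_tendsto_inner[OF \<phi>(2) \<psi>(2)] by (simp add: rep_inner[OF \<phi>(1) \<psi>(1)])
  qed
  have limR: "(\<lambda>n. ip (u n) (v n)) \<longlonglongrightarrow> Re (l2_inner M \<Phi> \<Psi>)" if "u \<in> A" "v \<in> B" for u v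
    using tendsto_Re[OF lim[OF that]] by simp
  obtain u v where uv: "u \<in> A" "v \<in> B" using represents_ex_mem[OF A] represents_ex_mem[OF B] by blast
  have "completion_inner ip A B = Re (l2_inner M \<Phi> \<Psi>)"
    unfolding completion_inner_def
  proof (rule the_equality)
    show "\<exists>u\<in>A. \<exists>v\<in>B. (\<lambda>n. ip (u n) (v n)) \<longlonglongrightarrow> Re (l2_inner M \<Phi> \<Psi>)"
      using uv limR by blast
    show "l = Re (l2_inner M \<Phi> \<Psi>)" if "\<exists>u\<in>A. \<exists>v\<in>B. (\<lambda>n. ip (u n) (v n)) \<longlonglongrightarrow> l" for l
      using that limR LIMSEQ_unique by blast
  qed
  moreover have "Im (l2_inner M \<Phi> \<Psi>) = 0"
    using LIMSEQ_unique[OF tendsto_Im[OF lim[OF uv]]] by simp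
  ultimately show ?thesis by (simp add: complex_eq_iff)
qed

text \<open>The reproducing property in L2: \<open>E x\<close> represents the class of the translate
  \<open>G (y - x)\<close>, and the correction sum over the empty point set vanishes.\<close>

lemma native_map_eval:
  assumes A: "represents A \<Phi>"
  shows "complex_of_real (native_map 0 G {} A x) = l2_inner M \<Phi> (E x)"
proof -
  have r: "rep (\<lambda>y. G (y - x)) (E x)"
    unfolding rep_def
    by (intro exI[of _ "{x}"] exI[of _ "\<lambda>_. 1"]) (auto simp: kernel_comb_def comb_def)
  have "represents (to_completion V ip (\<lambda>y. G (y - x))) (E x)"
    unfolding to_completion_def
    by (rule represents_intro(1)) (auto intro: r l2_tendsto_const E)
  from represents_inner[OF A this] show ?thesis by (simp add: native_map_def)
qed

text \<open>The difference of \<Phi> and \<Psi> is orthogonal to every feature, hence to all feature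
  combinations. Both functions are limits of such combinations, so the difference is orthogonal to
  itself.\<close>

lemma represents_unique:
  assumes A: "represents A \<Phi>" and B: "represents B \<Psi>"
    and eq: "\<And>x. l2_inner M \<Phi> (E x) = l2_inner M \<Psi> (E x)"
  shows "A = B"
proof -
  obtain u \<phi> where u: "\<And>n. rep (u n) (\<phi> n)" "l2_tendsto M \<phi> \<Phi>" "A = null_rel V ip `` {u}"
    using A unfolding represents_def by blast
  obtain v \<psi> where v: "\<And>n. rep (v n) (\<psi> n)" "l2_tendsto M \<psi> \<Psi>" "B = null_rel V ip `` {v}"
    using B unfolding represents_def by blast
  let ?d = "\<lambda>y. \<Phi> y - \<Psi> y"
  note \<Phi> = l2_tendstoD(2)[OF u(2)] and \<Psi> = l2_tendstoD(2)[OF v(2)]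
  have d: "?d \<in> square_integrable M" by (intro square_integrable_diff \<Phi> \<Psi>)
  have orthE: "l2_inner M ?d (E x) = 0" for x
    using eq[of x] by (simp add: l2_inner_diff_left[OF \<Phi> \<Psi> E])
  have orth: "l2_inner M ?d \<omega> = 0" if r: "rep f \<omega>" for f \<omega>
  proof -
    obtain X c where X: "finite X" "\<omega> = comb X c" using r by (auto simp: rep_def)
    show ?thesis unfolding X(2) comb_def using X(1)
      by (subst l2_inner_sum_right) (auto simp: l2_inner_scale_right orthE square_integrable_scale E d)
  qed
  have "(\<lambda>n. l2_inner M ?d (\<phi> n)) \<longlonglongrightarrow> l2_inner M ?d \<Phi>" "(\<lambda>n. l2_inner M ?d (\<psi> n)) \<longlonglongrightarrow> l2_inner M ?d \<Psi>"
    by (intro l2_tendsto_inner l2_tendsto_const d u(2) v(2))+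
  then have "l2_inner M ?d \<Phi> = 0" "l2_inner M ?d \<Psi> = 0"
    using LIMSEQ_unique[OF _ tendsto_const] by (auto simp: orth[OF u(1)] orth[OF v(1)])
  then have "l2_inner M ?d ?d = 0" by (simp add: l2_inner_diff_right[OF \<Phi> \<Psi> d])
  then have 0: "l2_norm2 M (\<lambda>y. \<Psi> y - \<Phi> y) = 0"
    by (simp add: l2_inner_self l2_norm2_minus_commute[of M \<Psi>])
  have tend: "l2_tendsto M \<omega> \<Phi> \<longleftrightarrow> l2_tendsto M \<omega> \<Psi>" for \<omega>
  proof -
    have "l2_norm2 M (\<lambda>y. \<omega> n y - \<Phi> y) = l2_norm2 M (\<lambda>y. \<omega> n y - \<Psi> y)" if "\<omega> n \<in> square_integrable M" for n
    proof -
      have ae: "AE y in M. \<Psi> y - \<Phi> y = 0"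
        by (rule l2_norm2_eq_0[OF square_integrable_diff[OF \<Psi> \<Phi>] 0])
      note [measurable] = square_integrableD(1)[OF that] square_integrableD(1)[OF \<Phi>] square_integrableD(1)[OF \<Psi>]
      show ?thesis unfolding l2_norm2_def
        by (intro integral_cong_AE) (use ae in auto)
    qed
    then show ?thesis unfolding l2_tendsto_def using \<Phi> \<Psi> by auto
  qed
  show ?thesis
  proof (intro set_eqI iffI)
    fix w assume w: "w \<in> A"
    obtain \<omega> where "\<And>n. rep (w n) (\<omega> n)" "l2_tendsto M \<omega> \<Phi>" using represents_mem[OF A w] by blast
    then show "w \<in> B" using represents_iff[OF B] tend by blast
  next
    fix w assume w: "w \<in> B"
    obtain \<omega> where "\<And>n. rep (w n) (\<omega> n)" "l2_tendsto M \<omega> \<Psi>" using represents_mem[OF B w] by blast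
    then show "w \<in> A" using represents_iff[OF A] tend by blast
  qed
qed

lemma inj_native_map: "inj_on (native_map 0 G {}) (kernel_completion 0 G)"
proof (rule inj_onI)
  fix A B assume A: "A \<in> kernel_completion 0 G" and B: "B \<in> kernel_completion 0 G"
    and eq: "native_map 0 G {} A = native_map 0 G {} B"
  obtain \<Phi> \<Psi> where r: "represents A \<Phi>" "represents B \<Psi>"
    using completion_represents[OF A] completion_represents[OF B] by blast
  show "A = B"
    using represents_unique[OF r] native_map_eval[OF r(1)] native_map_eval[OF r(2)] eq by metis
qed

lemma native_space_iff:
  "f \<in> native_space 0 G {} \<longleftrightarrow> (\<exists>A\<in>kernel_completion 0 G. f = native_map 0 G {} A)"
  by (auto simp: native_space_def poly_space_0)

lemma native_inner_eq:
  assumes A: "represents A \<Phi>" "A \<in> kernel_completion 0 G" and B: "represents B \<Psi>" "B \<in> kernel_completion 0 G"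
  shows "complex_of_real (native_inner 0 G {} (native_map 0 G {} A) (native_map 0 G {} B)) = l2_inner M \<Phi> \<Psi>"
proof -
  have "f - interpolant 0 {} f = f" for f :: "real^'d \<Rightarrow> real"
    by (simp add: interpolant_empty fun_diff_def)
  then show ?thesis
    using represents_inner[OF A(1) B(1)] inv_into_f_f[OF inj_native_map A(2)] inv_into_f_f[OF inj_native_map B(2)]
    by (simp add: native_inner_def)
qed

text \<open>An arbitrary \<open>h\<close> need not be a limit of feature combinations. Its
  projection onto their closure is one, and the remainder has zero real inner product with each
  \<open>E x\<close>; the imaginary part is not controlled because the coefficients are
  real.\<close>

lemma native_projection:
  assumes h: "h \<in> square_integrable M"
  shows "\<exists>A\<in>kernel_completion 0 G. \<forall>x. native_map 0 G {} A x = Re (l2_inner M h (E x))"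
proof -
  let ?V = "{\<phi>. \<exists>f. rep f \<phi>}"
  have "\<exists>u f. (\<forall>n. u n \<in> ?V) \<and> l2_tendsto M u f \<and> (\<forall>v\<in>?V. Re (l2_inner M (\<lambda>x. h x - f x) v) = 0)"
  proof (rule l2_projection[OF _ _ _ h])
    show "?V \<subseteq> square_integrable M" using rep_sq by blast
    have "rep (kernel_comb G {} (\<lambda>_. 0)) (\<lambda>x. 0)"
      unfolding rep_def by (intro exI[of _ "{}"] exI[of _ "\<lambda>_. 0"]) (auto simp: comb_def)
    then show "(\<lambda>x. 0) \<in> ?V" by blast
    fix \<phi> \<psi> and a b :: real assume "\<phi> \<in> ?V" "\<psi> \<in> ?V"
    then obtain f g where fg: "rep f \<phi>" "rep g \<psi>" by blast
    have scale: "\<exists>f. rep f (\<lambda>y. complex_of_real a * \<phi> y)" if r: "rep f \<phi>" for a f \<phi>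
    proof -
      obtain X c where X: "finite X" "\<phi> = comb X c" using r by (auto simp: rep_def)
      have "(\<lambda>y. complex_of_real a * \<phi> y) = comb X (\<lambda>x. a * c x)"
        by (simp add: X comb_def sum_distrib_left mult.assoc)
      then show ?thesis using X(1) unfolding rep_def by blast
    qed
    obtain f' g' where "rep f' (\<lambda>y. complex_of_real a * \<phi> y)" "rep g' (\<lambda>y. complex_of_real (- b) * \<psi> y)"
      using scale[OF fg(1)] scale[OF fg(2)] by blast
    from rep_diff[OF this] show "(\<lambda>x. complex_of_real a * \<phi> x + complex_of_real b * \<psi> x) \<in> ?V"
      by auto
  qed
  then obtain \<phi> \<Phi> where \<phi>: "\<And>n. \<phi> n \<in> ?V" "l2_tendsto M \<phi> \<Phi>"
    and orth: "\<And>v. v \<in> ?V \<Longrightarrow> Re (l2_inner M (\<lambda>x. h x - \<Phi> x) v) = 0" by blast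
  have "\<forall>n. \<exists>f. rep f (\<phi> n)" using \<phi>(1) by blast
  from choice[OF this] obtain u where u: "\<And>n. rep (u n) (\<phi> n)" by blast
  note A = represents_intro[of u \<phi> \<Phi>, OF u \<phi>(2)]
  have "native_map 0 G {} (null_rel V ip `` {u}) x = Re (l2_inner M h (E x))" for x
  proof -
    have "rep (\<lambda>y. G (y - x)) (E x)"
      unfolding rep_def
      by (intro exI[of _ "{x}"] exI[of _ "\<lambda>_. 1"]) (auto simp: kernel_comb_def comb_def)
    then have "Re (l2_inner M (\<lambda>x. h x - \<Phi> x) (E x)) = 0" by (intro orth) blast
    then have "Re (l2_inner M h (E x)) = Re (l2_inner M \<Phi> (E x))"
      by (simp add: l2_inner_diff_left[OF h l2_tendstoD(2)[OF \<phi>(2)] E])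
    then show ?thesis using native_map_eval[OF A(1), of x] by (metis Re_complex_of_real)
  qed
  with A(2) show ?thesis by blast
qed

end

subsection \<open>Operators on tempered distributions\<close>

lemma tempered_linear:
  "T \<in> tempered \<Longrightarrow> \<gamma> \<in> schwartz \<Longrightarrow> \<eta> \<in> schwartz \<Longrightarrow>
   T (\<lambda>x. a * \<gamma> x + b * \<eta> x) = a * T \<gamma> + b * T \<eta>"
  unfolding tempered_def by blast

lemma schwartz_sum:
  "finite A \<Longrightarrow> (\<And>a. a \<in> A \<Longrightarrow> \<gamma> a \<in> schwartz) \<Longrightarrow> (\<lambda>x. \<Sum>a\<in>A. \<gamma> a x) \<in> schwartz"
  by (induction rule: finite_induct) (simp_all add: schwartz_zero schwartz_add)

lemma tempered_sum:
  assumes T: "T \<in> tempered" and "finite A" "\<And>a. a \<in> A \<Longrightarrow> \<gamma> a \<in> schwartz"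
  shows "T (\<lambda>x. \<Sum>a\<in>A. \<gamma> a x) = (\<Sum>a\<in>A. T (\<gamma> a))"
  using assms(2,3)
proof (induction rule: finite_induct)
  case empty
  show ?case using tempered_linear[OF T schwartz_zero schwartz_zero, of 0 0] by simp
next
  case (insert a A)
  then have "T (\<lambda>x. 1 * \<gamma> a x + 1 * (\<Sum>a\<in>A. \<gamma> a x)) = 1 * T (\<gamma> a) + 1 * T (\<lambda>x. \<Sum>a\<in>A. \<gamma> a x)"
    by (intro tempered_linear T schwartz_sum) auto
  then show ?case using insert by simp
qed

lemma fourier_sum:
  assumes "finite A" "\<And>a. a \<in> A \<Longrightarrow> \<gamma> a \<in> schwartz"
  shows "fourier (\<lambda>x. \<Sum>a\<in>A. \<gamma> a x) = (\<lambda>x. \<Sum>a\<in>A. fourier (\<gamma> a) x)"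
  using assms
proof (induction rule: finite_induct)
  case empty
  show ?case by (simp add: fourier_def)
next
  case (insert a A)
  then show ?case
    by (simp add: fourier_add schwartz_integrable schwartz_sum)
qed

text \<open>Every Schwartz function is a Fourier transform. Testing on transforms is convenient
  because there the operators act by multiplication with their symbols.\<close>

lemma tempered_eqI:
  assumes T: "T \<in> tempered" "U \<in> tempered" and eq: "\<And>\<eta>. \<eta> \<in> schwartz \<Longrightarrow> T (fourier \<eta>) = U (fourier \<eta>)"
  shows "T = U"
proof (rule extensionalityI[where A = schwartz])
  show "T \<in> extensional schwartz" "U \<in> extensional schwartz" using T by (auto simp: tempered_def)
  fix \<gamma> :: "real^'a \<Rightarrow> complex" assume "\<gamma> \<in> schwartz"
  then show "T \<gamma> = U \<gamma>"
    using eq[OF inverse_fourier_schwartz[of \<gamma>]] by (simp add: fourier_inverse_fourier)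
qed

lemma distr_of_apply: "\<eta> \<in> schwartz \<Longrightarrow> distr_of f \<eta> = (LINT x|lebesgue. f x * \<eta> x)"
  by (simp add: distr_of_def)

lemma operator_fourier:
  assumes "has_distr_fourier P p" "T \<in> tempered" "\<eta> \<in> schwartz"
  shows "P T (fourier \<eta>) = T (fourier (\<lambda>x. p x * \<eta> x))"
proof -
  have "fourier_distr (P T) \<eta> = fourier_distr T (\<lambda>x. p x * \<eta> x)" and p: "p \<in> FT"
    using assms by (auto simp: has_distr_fourier_def)
  then show ?thesis
    using assms(3) FT_mult_schwartz[OF p assms(3)] by (simp add: fourier_distr_def)
qed

text \<open>The operator is a Fourier multiplier on Schwartz functions: both sides are compared as
  distributions by moving transforms with the multiplication formula, and injectivity of
  \<open>distr_of\<close> then identifies the functions.\<close>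

lemma restrict_schwartz_eq:
  assumes P: "distributional_operator P P'" and p: "has_distr_fourier P p" and \<gamma>: "\<gamma> \<in> schwartz"
  shows "restrict_schwartz P \<gamma> = inverse_fourier (\<lambda>x. p x * fourier \<gamma> x)"
proof -
  let ?z = "inverse_fourier (\<lambda>x. p x * fourier \<gamma> x)"
  have pF: "p \<in> FT" using p by (simp add: has_distr_fourier_def)
  have S: "(\<lambda>x. p x * fourier \<gamma> x) \<in> schwartz" by (intro FT_mult_schwartz pF fourier_schwartz \<gamma>)
  have z: "?z \<in> schwartz" by (rule inverse_fourier_schwartz[OF S])
  have t: "distr_of \<gamma> \<in> tempered" by (intro distr_of_tempered moderate_schwartz \<gamma>)
  have "P (distr_of \<gamma>) = distr_of ?z"
  proof (rule tempered_eqI)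
    show "P (distr_of \<gamma>) \<in> tempered"
      using P t unfolding distributional_operator_def linear_distr_operator_def by blast
    show "distr_of ?z \<in> tempered" by (intro distr_of_tempered moderate_schwartz z)
    fix \<eta> :: "real^'a \<Rightarrow> complex" assume \<eta>: "\<eta> \<in> schwartz"
    have p\<eta>: "(\<lambda>x. p x * \<eta> x) \<in> schwartz" by (intro FT_mult_schwartz pF \<eta>)
    have "P (distr_of \<gamma>) (fourier \<eta>) = (LINT x|lebesgue. \<gamma> x * fourier (\<lambda>x. p x * \<eta> x) x)"
      by (simp add: operator_fourier[OF p t \<eta>] distr_of_apply fourier_schwartz p\<eta>)
    also have "\<dots> = (LINT x|lebesgue. fourier \<gamma> x * (p x * \<eta> x))"
      by (rule schwartz_multiplication_formula[OF \<gamma> p\<eta>])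
    also have "\<dots> = (LINT x|lebesgue. (p x * fourier \<gamma> x) * \<eta> x)" by (simp only: mult_ac)
    also have "\<dots> = (LINT x|lebesgue. fourier ?z x * \<eta> x)" by (simp only: fourier_inverse_fourier[OF S])
    also have "\<dots> = (LINT x|lebesgue. ?z x * fourier \<eta> x)"
      by (rule schwartz_multiplication_formula[OF z \<eta>, symmetric])
    also have "\<dots> = distr_of ?z (fourier \<eta>)"
      by (simp add: distr_of_apply fourier_schwartz \<eta>)
    finally show "P (distr_of \<gamma>) (fourier \<eta>) = distr_of ?z (fourier \<eta>)" .
  qed
  then show ?thesis
    unfolding restrict_schwartz_def by (simp add: inv_into_f_f[OF inj_distr_of z])
qed

lemma fourier_inject:
  assumes "f \<in> schwartz" "g \<in> schwartz" "fourier f = fourier g"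
  shows "f = g"
  using inverse_fourier_fourier assms by metis

text \<open>A complex-adjoint invariant operator maps real functions to real functions. Applied to
  the real transform of a Gaussian, this makes the inverse transform of \<open>p\<close> times the
  Gaussian real, hence that product Hermitian; the even, nowhere vanishing Gaussian cancels.\<close>

lemma symbol_reflect:
  assumes P: "distributional_operator P P'" and p: "has_distr_fourier P p" and c: "complex_adjoint_invariant P"
  shows "p (- x) = cnj (p (x :: real^'d::finite))"
proof -
  let ?g = "\<lambda>x::real^'d. complex_of_real (gaussian 1 x)"
  have pF: "p \<in> FT" using p by (simp add: has_distr_fourier_def)
  have g: "?g \<in> schwartz" by (rule gaussian_schwartz) simp
  have pg: "(\<lambda>x. p x * ?g x) \<in> schwartz" by (rule FT_mult_schwartz[OF pF g])
  let ?\<gamma> = "fourier ?g"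
  have \<gamma>: "?\<gamma> \<in> schwartz" by (rule fourier_schwartz[OF g])
  \<comment> \<open>Evenness of the Gaussian makes its transform even, and with that also
    real.\<close>
  have refl: "fourier ?g (- x) = fourier ?g x" for x
    using fourier_reflect[OF schwartz_borel[OF g], of x] by simp
  have cnj\<gamma>: "(\<lambda>x. cnj (?\<gamma> x)) = ?\<gamma>"
    by (auto simp: cnj_fourier inverse_fourier_def refl)
  have r: "restrict_schwartz P ?\<gamma> = inverse_fourier (\<lambda>x. p x * ?g x)"
    by (simp add: restrict_schwartz_eq[OF P p \<gamma>] fourier_fourier[OF g])
  have "(\<lambda>x. cnj (restrict_schwartz P ?\<gamma> x)) = restrict_schwartz P ?\<gamma>"
    using c \<gamma> cnj\<gamma> unfolding complex_adjoint_invariant_def by metis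
  then have eq: "cnj (inverse_fourier (\<lambda>x. p x * ?g x) x) = inverse_fourier (\<lambda>x. p x * ?g x) x" for x
    unfolding r by metis
  have "fourier (\<lambda>y. cnj (p y * ?g y)) = fourier (\<lambda>y. p (- y) * ?g (- y))"
  proof
    fix x
    have "fourier (\<lambda>y. cnj (p y * ?g y)) x = cnj (inverse_fourier (\<lambda>x. p x * ?g x) x)"
      by (simp add: inverse_fourier_def cnj_fourier)
    also have "\<dots> = fourier (\<lambda>x. p x * ?g x) (- x)" unfolding eq by (simp add: inverse_fourier_def)
    also have "\<dots> = fourier (\<lambda>y. p (- y) * ?g (- y)) x"
      by (rule fourier_reflect[OF schwartz_borel[OF pg], symmetric])
    finally show "fourier (\<lambda>y. cnj (p y * ?g y)) x = fourier (\<lambda>y. p (- y) * ?g (- y)) x" .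
  qed
  then have "(\<lambda>y. cnj (p y * ?g y)) = (\<lambda>y. p (- y) * ?g (- y))"
    by (rule fourier_inject[OF schwartz_cnj[OF pg] schwartz_reflect[OF pg]])
  from fun_cong[OF this, of x] show ?thesis by simp
qed

section \<open>Membership in function classes, almost everywhere equality, inverse transforms of
  integrable functions\<close>

lemma moderate_continuous:
  fixes f :: "real^'d::finite \<Rightarrow> complex"
  assumes "continuous_on UNIV f" "poly_bounded f"
  shows "moderate f"
proof -
  obtain N C where C: "\<And>x. norm (f x) \<le> C * weight x ^ N" "0 \<le> C" using assms(2) by (elim poly_boundedE) blast
  have m: "f \<in> borel_measurable lebesgue"
    by (rule measurable_completion) (simp add: borel_measurable_continuous_UNIV assms(1))
  have "integrable lebesgue (\<lambda>x. f x / complex_of_real (weight x ^ (N + CARD('d))))"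
  proof (rule Bochner_Integration.integrable_bound[OF integrable_mult_right[OF integrable_inverse_weight_lebesgue, of C]])
    show "(\<lambda>x. f x / complex_of_real (weight x ^ (N + CARD('d)))) \<in> borel_measurable lebesgue"
      by (intro borel_measurable_divide m weight_power_measurable)
    show "AE x in lebesgue. norm (f x / complex_of_real (weight x ^ (N + CARD('d)))) \<le>
        norm (C * inverse (weight x ^ CARD('d)))"
    proof (rule AE_I2)
      fix x :: "real^'d"
      have "norm (f x) / weight x ^ (N + CARD('d)) \<le> (C * weight x ^ N) / weight x ^ (N + CARD('d))"
        by (intro divide_right_mono C) auto
      also have "\<dots> = C * inverse (weight x ^ CARD('d))" by (simp add: power_add field_simps)
      finally show "norm (f x / complex_of_real (weight x ^ (N + CARD('d)))) \<le> norm (C * inverse (weight x ^ CARD('d)))"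
        using C(2) by (simp add: norm_divide norm_power norm_mult abs_mult)
    qed
  qed
  with m show ?thesis unfolding moderate_def by blast
qed

lemma L1loc_continuous:
  fixes f :: "real^'d::finite \<Rightarrow> real"
  assumes "continuous_on UNIV f"
  shows "f \<in> L1loc"
  unfolding L1loc_def
proof (intro CollectI allI impI)
  fix K :: "(real^'d) set" assume K: "compact K"
  have m: "(\<lambda>x. indicator K x *\<^sub>R f x) \<in> borel_measurable borel"
    using borel_compact[OF K] borel_measurable_continuous_UNIV[OF assms] by measurable
  have "integrable lborel (\<lambda>x. indicator K x *\<^sub>R f x)"
    by (intro borel_integrable_compact K continuous_on_subset[OF assms]) auto
  then show "set_integrable lebesgue K f"
    unfolding set_integrable_def lebesgue_integrable_eq_lborel[OF m] .
qed

lemma measurable_lebesgue_cong_AE: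
  fixes f g :: "'a::euclidean_space \<Rightarrow> 'b::topological_space"
  assumes g: "g \<in> borel_measurable lebesgue" and ae: "AE x in lebesgue. f x = g x"
  shows "f \<in> borel_measurable lebesgue"
proof (rule measurableI)
  fix U :: "'b set" assume U: "U \<in> sets borel"
  show "f -` U \<inter> space lebesgue \<in> sets lebesgue"
  proof (rule completion.in_sets_AE)
    show "AE x in lebesgue. x \<in> g -` U \<inter> space lebesgue \<longleftrightarrow> x \<in> f -` U \<inter> space lebesgue"
      using ae by eventually_elim simp
    show "g -` U \<inter> space lebesgue \<in> sets lebesgue" using g U by (rule measurable_sets)
  qed auto
qed simp

lemma sobolev_space_cong_AE:
  assumes g: "g \<in> sobolev_space P" and ae: "AE x in lebesgue. f x = g x"
  shows "f \<in> sobolev_space P"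
proof -
  have gL: "g \<in> L1loc" and gS: "g \<in> SI"
    and gP: "\<And>j. \<exists>h\<in>L2. P j (distr_of (\<lambda>x. complex_of_real (g x))) = distr_of h"
    using g by (auto simp: sobolev_space_def)
  have gm: "g \<in> borel_measurable lebesgue" by (rule L1loc_measurable[OF gL])
  have fm: "f \<in> borel_measurable lebesgue" by (rule measurable_lebesgue_cong_AE[OF gm ae])
  have "f \<in> L1loc" unfolding L1loc_def
  proof (intro CollectI allI impI)
    fix K :: "(real^'a) set" assume K: "compact K"
    have Km: "K \<in> sets lebesgue" using K borel_compact by (metis sets_completionI_sets sets_lborel)
    have "integrable lebesgue (\<lambda>x. indicator K x *\<^sub>R g x)"
      using gL K by (auto simp: L1loc_def set_integrable_def)
    then have "integrable lebesgue (\<lambda>x. indicator K x *\<^sub>R f x)"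
    proof (rule integrable_cong_AE_imp)
      show "(\<lambda>x. indicator K x *\<^sub>R f x) \<in> borel_measurable lebesgue" using fm Km by measurable
      show "AE x in lebesgue. indicator K x *\<^sub>R g x = indicator K x *\<^sub>R f x"
        using ae by eventually_elim simp
    qed
    then show "set_integrable lebesgue K f" by (simp add: set_integrable_def)
  qed
  moreover have "f \<in> SI"
  proof -
    obtain k C R where "AE x in lebesgue. R \<le> norm x \<longrightarrow> norm (g x) \<le> C * norm x ^ k"
      using gS unfolding SI_def by blast
    then have "AE x in lebesgue. R \<le> norm x \<longrightarrow> norm (f x) \<le> C * norm x ^ k"
      using ae by eventually_elim simp
    then show ?thesis unfolding SI_def by blast
  qed
  moreover have "distr_of (\<lambda>x. complex_of_real (f x)) = distr_of (\<lambda>x. complex_of_real (g x))"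
    using fm gm ae by (intro distr_of_cong_AE) auto
  ultimately show ?thesis using gP by (simp add: sobolev_space_def)
qed

lemma L2_complex: "(L2 :: (real^'d::finite \<Rightarrow> complex) set) = square_integrable lebesgue"
  by (simp add: L2_def square_integrable_def)

lemma fourier_cong_AE:
  fixes u v :: "real^'d::finite \<Rightarrow> complex"
  assumes "u \<in> borel_measurable lebesgue" "v \<in> borel_measurable lebesgue" "AE x in lebesgue. u x = v x"
  shows "fourier u = fourier v"
proof
  fix x :: "real^'d"
  have e: "(\<lambda>y. exp (- \<i> * complex_of_real (x \<bullet> y))) \<in> borel_measurable lebesgue"
    by (rule measurable_completion) (simp only: measurable_lborel2 exp_inner_borel)
  have "(LINT y|lebesgue. u y * exp (- \<i> * complex_of_real (x \<bullet> y))) =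
      (LINT y|lebesgue. v y * exp (- \<i> * complex_of_real (x \<bullet> y)))"
  proof (rule integral_cong_AE)
    show "AE y in lebesgue. u y * exp (- \<i> * complex_of_real (x \<bullet> y)) = v y * exp (- \<i> * complex_of_real (x \<bullet> y))"
      using assms(3) by eventually_elim simp
  qed (intro borel_measurable_times e assms)+
  then show "fourier u x = fourier v x" by (simp only: fourier_def)
qed

lemma lebesgue_integrable_ex_borel:
  fixes u :: "real^'d::finite \<Rightarrow> complex"
  assumes u: "integrable lebesgue u"
  shows "\<exists>v. integrable lborel v \<and> (AE x in lebesgue. u x = v x) \<and> fourier u = fourier v"
proof -
  note um = borel_measurable_integrable[OF u]
  obtain v where v: "v \<in> borel_measurable borel" "AE x in lborel. u x = v x"
    using lebesgue_ex_borel_complex[OF um] by blast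
  have ae: "AE x in lebesgue. u x = v x" by (rule AE_completion[OF v(2)])
  have vm: "v \<in> borel_measurable lebesgue" by (rule measurable_completion) (simp add: v(1))
  have "integrable lebesgue v" by (rule integrable_cong_AE_imp[OF u vm ae])
  then have "integrable lborel v" unfolding lebesgue_integrable_eq_lborel[OF v(1)] .
  with ae fourier_cong_AE[OF um vm ae] show ?thesis by blast
qed

text \<open>The function \<open>u\<close> is merely Lebesgue measurable, so a Borel function equal
  to it almost everywhere takes its place without changing the transform. Duality is then the
  multiplication formula after a reflection.\<close>

lemma
  fixes u :: "real^'d::finite \<Rightarrow> complex"
  assumes u: "integrable lebesgue u"
  shows continuous_inverse_fourier: "continuous_on UNIV (inverse_fourier u)"
    and poly_bounded_inverse_fourier: "poly_bounded (inverse_fourier u)"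
    and inverse_fourier_duality: "\<zeta> \<in> schwartz \<Longrightarrow>
      (LINT x|lebesgue. inverse_fourier u x * fourier \<zeta> x) = (LINT x|lebesgue. u x * \<zeta> x)"
proof -
  obtain v where v: "integrable lborel v" and ae: "AE x in lebesgue. u x = v x" and F: "fourier u = fourier v"
    using lebesgue_integrable_ex_borel[OF u] by blast
  have vb: "v \<in> borel_measurable borel" using borel_measurable_integrable[OF v] by simp
  have vm: "v \<in> borel_measurable lebesgue" by (rule measurable_completion) (simp add: vb)
  have iu: "inverse_fourier u = (\<lambda>x. fourier v (- x))" by (simp add: inverse_fourier_def[abs_def] F)
  have c: "continuous_on UNIV (fourier v)" by (rule fourier_continuous[OF v])
  show ci: "continuous_on UNIV (inverse_fourier u)" unfolding iu
    by (rule continuous_on_compose2[OF c continuous_on_minus[OF continuous_on_id]]) auto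
  obtain C where "\<And>x. norm (fourier v x) \<le> C" using fourier_bounded[OF v] by blast
  then show "poly_bounded (inverse_fourier u)"
    unfolding iu by (intro poly_boundedI[of _ C 0]) simp
  assume \<zeta>: "\<zeta> \<in> schwartz"
  have F\<zeta>: "fourier \<zeta> \<in> borel_measurable borel" by (intro schwartz_borel fourier_schwartz \<zeta>)
  have b: "fourier v \<in> borel_measurable borel" by (rule borel_measurable_continuous_UNIV[OF c])
  have "(LINT x|lebesgue. inverse_fourier u x * fourier \<zeta> x) = (LINT x|lborel. inverse_fourier u x * fourier \<zeta> x)"
    by (intro lebesgue_integral_eq_lborel borel_measurable_times F\<zeta> borel_measurable_continuous_UNIV ci)
  also have "\<dots> = (LINT x|lborel. fourier v (- x) * inverse_fourier \<zeta> (- x))"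
    unfolding iu by (simp add: inverse_fourier_def)
  also have "\<dots> = (LINT x|lborel. fourier v x * inverse_fourier \<zeta> x)"
    by (rule lborel_integral_reflect) (intro borel_measurable_times b schwartz_borel inverse_fourier_schwartz \<zeta>)
  also have "\<dots> = (LINT x|lborel. v x * fourier (inverse_fourier \<zeta>) x)"
    by (intro fourier_multiplication_formula[symmetric] v schwartz_integrable inverse_fourier_schwartz \<zeta>)
  also have "\<dots> = (LINT x|lborel. v x * \<zeta> x)" by (simp only: fourier_inverse_fourier[OF \<zeta>])
  also have "\<dots> = (LINT x|lebesgue. v x * \<zeta> x)"
    by (intro lebesgue_integral_eq_lborel[symmetric] borel_measurable_times vb schwartz_borel \<zeta>)
  also have "\<dots> = (LINT x|lebesgue. u x * \<zeta> x)"
  proof (rule integral_cong_AE)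
    show "AE x in lebesgue. v x * \<zeta> x = u x * \<zeta> x" using ae by eventually_elim simp
  qed (intro borel_measurable_times vm borel_measurable_integrable[OF u] schwartz_lebesgue_measurable \<zeta>)+
  finally show "(LINT x|lebesgue. inverse_fourier u x * fourier \<zeta> x) = (LINT x|lebesgue. u x * \<zeta> x)" .
qed

lemma square_integrable_bounded_mult:
  assumes f: "f \<in> square_integrable M" and b: "b \<in> borel_measurable M" "\<And>x. norm (b x) \<le> 1"
  shows "(\<lambda>x. b x * f x) \<in> square_integrable M"
proof -
  note [measurable] = square_integrableD(1)[OF f] b(1)
  have "integrable M (\<lambda>x. (norm (b x * f x))\<^sup>2)"
  proof (rule Bochner_Integration.integrable_bound[OF square_integrableD(2)[OF f]])
    show "AE x in M. norm ((norm (b x * f x))\<^sup>2) \<le> norm ((norm (f x))\<^sup>2)"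
      using b(2) by (intro AE_I2) (auto simp: norm_mult intro!: power_mono mult_left_le_one_le)
  qed measurable
  then show ?thesis by (simp add: square_integrable_def)
qed

subsection \<open>The generalized Sobolev space and its Green function\<close>

lemma unisolvent_0: "unisolvent 0 \<Xi> \<longleftrightarrow> \<Xi> = {}"
  by (auto simp: unisolvent_def poly_space_0)

lemma const_notin_L2: "(\<lambda>_::real^'d::finite. 1::real) \<notin> L2"
proof
  assume "(\<lambda>_::real^'d. 1::real) \<in> L2"
  then have "integrable lebesgue (\<lambda>_::real^'d. 1::real)" by (simp add: L2_def)
  then have "integrable lborel (\<lambda>_::real^'d. 1::real)"
    by (subst (asm) lebesgue_integrable_eq_lborel) auto
  then show False by (simp add: integrable_iff_bounded emeasure_lborel_UNIV)
qed

locale sobolev_setting =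
  fixes P P' :: "'n::finite \<Rightarrow> 'd::finite distr_operator"
    and p :: "real^'d \<Rightarrow> complex^'n"
    and m :: nat
    and G :: "real^'d \<Rightarrow> real"
  assumes dop: "\<And>j. distributional_operator (P j) (P' j)"
    and cai: "\<And>j. complex_adjoint_invariant (P j)"
    and hdf: "\<And>j. has_distr_fourier (P j) (\<lambda>x. p x $ j)"
    and p_nz: "\<And>x. x \<noteq> 0 \<Longrightarrow> p x \<noteq> 0"
    and p_SI: "(\<lambda>x. inverse (norm (p x))) \<in> SI"
    and p_Theta: "(\<lambda>x. norm (p x)) \<in> \<Theta>[at 0](\<lambda>x. norm x ^ m)"
    and G_cont: "continuous_on UNIV G"
    and G_SI: "G \<in> SI"
    and G_even: "\<And>x. G (- x) = G x"
    and G_green: "green_function (normal_operator P' P) (distr_of (\<lambda>x. complex_of_real (G x)))"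
    and sob_L2: "sobolev_space P \<subseteq> L2"
begin

section \<open>The order m and the zeros of the symbol\<close>

lemma symbol_FT: "(\<lambda>x. p x $ j) \<in> FT"
  using hdf[of j] by (simp add: has_distr_fourier_def)

lemma p_continuous: "continuous_on UNIV p"
proof -
  have "continuous_on UNIV (\<lambda>x. \<chi> j. p x $ j)"
    by (intro continuous_on_vec_lambda FT_continuous symbol_FT)
  then show ?thesis by simp
qed

lemma norm_p_sum: "complex_of_real ((norm (p x))\<^sup>2) = (\<Sum>j\<in>UNIV. p x $ j * cnj (p x $ j))"
proof -
  have "(norm (p x))\<^sup>2 = (\<Sum>j\<in>UNIV. (norm (p x $ j))\<^sup>2)"
    by (simp add: norm_vec_def L2_set_def sum_nonneg)
  then show ?thesis by (simp only: of_real_sum complex_norm_square)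
qed

lemma tendsto_norm_p: "((\<lambda>x. norm (p x)) \<longlongrightarrow> norm (p 0)) (at 0)"
  using p_continuous by (intro tendsto_norm) (simp add: continuous_on_def)

text \<open>Reduces the computation of \<open>P j\<close> on a function to an identity between
  integrals on the Fourier side.\<close>

lemma operator_distr_eqI:
  assumes f: "moderate f" and h: "moderate h"
    and eq: "\<And>\<eta>. \<eta> \<in> schwartz \<Longrightarrow>
      (LINT x|lebesgue. f x * fourier (\<lambda>x. p x $ j * \<eta> x) x) = (LINT x|lebesgue. h x * fourier \<eta> x)"
  shows "P j (distr_of f) = distr_of h"
proof (rule tempered_eqI)
  have t: "distr_of f \<in> tempered" by (rule distr_of_tempered[OF f])
  show "P j (distr_of f) \<in> tempered"
    using dop[of j] t unfolding distributional_operator_def linear_distr_operator_def by blast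
  show "distr_of h \<in> tempered" by (rule distr_of_tempered[OF h])
  fix \<eta> :: "real^'d \<Rightarrow> complex" assume \<eta>: "\<eta> \<in> schwartz"
  show "P j (distr_of f) (fourier \<eta>) = distr_of h (fourier \<eta>)"
    unfolding operator_fourier[OF hdf t \<eta>]
    using eq[OF \<eta>] by (simp add: distr_of_apply fourier_schwartz \<eta> FT_mult_schwartz symbol_FT)
qed

lemma m_eq_0: "m = 0"
proof (rule ccontr)
  assume m: "m \<noteq> 0"
  obtain c where "\<forall>\<^sub>F x in at 0. norm (norm (p x)) \<le> c * norm (norm x ^ m)"
    using bigthetaD1[OF p_Theta] by (elim landau_o.bigE)
  then have c: "\<forall>\<^sub>F x in at 0. norm (p x) \<le> c * norm x ^ m" by simp
  have "((\<lambda>x::real^'d. c * norm x ^ m) \<longlongrightarrow> c * norm (0::real^'d) ^ m) (at 0)"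
    by (intro tendsto_intros)
  then have lim: "((\<lambda>x::real^'d. c * norm x ^ m) \<longlongrightarrow> 0) (at 0)" using m by (simp add: power_0_left)
  have "((\<lambda>x. norm (p x)) \<longlongrightarrow> 0) (at 0)"
    by (rule tendsto_sandwich[OF _ c tendsto_const lim]) auto
  then have "norm (p 0) = 0" by (rule tendsto_unique[OF _ tendsto_norm_p, rotated]) simp
  then have p0: "p 0 $ j = 0" for j by simp
  let ?one = "\<lambda>_::real^'d. complex_of_real 1"
  have one: "moderate ?one"
    by (intro moderate_continuous poly_bounded_const continuous_intros)
  have z: "P j (distr_of ?one) = distr_of (\<lambda>_. 0)" for j
  proof (rule operator_distr_eqI[OF one])
    show "moderate (\<lambda>_::real^'d. 0)" by (intro moderate_continuous poly_bounded_const continuous_intros)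
    fix \<eta> :: "real^'d \<Rightarrow> complex" assume \<eta>: "\<eta> \<in> schwartz"
    have S: "(\<lambda>x. p x $ j * \<eta> x) \<in> schwartz" by (intro FT_mult_schwartz symbol_FT \<eta>)
    \<comment> \<open>Inversion at the origin: up to a constant, the pairing of 1 with the transform
      of p_j \<eta> is the value of p_j \<eta> at 0.\<close>
    have "fourier (fourier (\<lambda>x. p x $ j * \<eta> x)) 0 = 0" by (simp add: fourier_fourier[OF S] p0)
    then have "(LINT x|lebesgue. fourier (\<lambda>x. p x $ j * \<eta> x) x) = 0"
      by (subst (asm) fourier_def) simp
    then show "(LINT x|lebesgue. ?one x * fourier (\<lambda>x. p x $ j * \<eta> x) x) = (LINT x|lebesgue. 0 * fourier \<eta> x)"
      by simp
  qed
  have "(\<lambda>_. 1) \<in> sobolev_space P"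
    unfolding sobolev_space_def
  proof (intro CollectI conjI IntI allI)
    show "(\<lambda>_::real^'d. 1::real) \<in> L1loc" by (intro L1loc_continuous continuous_intros)
    show "(\<lambda>_::real^'d. 1::real) \<in> SI" by (intro poly_bounded_imp_SI poly_bounded_const)
    have "(\<lambda>_::real^'d. 0::complex) \<in> L2" by (simp add: L2_def)
    then show "\<exists>h\<in>L2. P j (distr_of (\<lambda>x::real^'d. complex_of_real 1)) = distr_of h" for j
      using z by blast
  qed
  then show False using sob_L2 const_notin_L2 by blast
qed

text \<open>At the origin the lower bound contained in \<Theta> is a positive constant once m = 0,
  and it passes to the limit by continuity.\<close>

lemma p_nonzero: "p x \<noteq> 0"
proof (cases "x = 0")
  case True
  obtain c where c: "c > 0" "\<forall>\<^sub>F x in at 0. norm (norm (p x)) \<ge> c * norm (norm x ^ m)"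
    using bigthetaD2[OF p_Theta] by (elim landau_omega.bigE)
  then have "\<forall>\<^sub>F x in at 0. c \<le> norm (p x)" by (simp add: m_eq_0)
  then have "c \<le> norm (p 0)" by (rule tendsto_lowerbound[OF tendsto_norm_p]) simp
  then show ?thesis using c(1) True by auto
qed (rule p_nz)

section \<open>The reciprocal of the symbol norm and the action of the normal operator\<close>

definition q :: "real^'d \<Rightarrow> real" where
  "q x = inverse (norm (p x))"

lemma q_pos: "0 < q x"
  by (simp add: q_def p_nonzero)

lemma q_continuous: "continuous_on UNIV q"
  unfolding q_def using p_continuous p_nonzero by (intro continuous_intros) auto

lemma q_poly_bounded: "poly_bounded q"
  using SI_imp_poly_bounded[OF p_SI] q_continuous by (simp add: q_def[abs_def])

lemma norm_p_q: "norm (p x) * q x = 1"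
  by (simp add: q_def p_nonzero)

lemma symbol_q_le: "norm (p x $ j * complex_of_real (q x)) \<le> 1"
proof -
  have "norm (p x $ j) * q x \<le> norm (p x) * q x"
    using q_pos[of x] by (intro mult_right_mono Finite_Cartesian_Product.norm_nth_le) auto
  then show ?thesis using q_pos[of x] by (simp add: norm_mult norm_p_q)
qed

text \<open>The square of \<open>q\<close> is the reciprocal of the sum of p_j cnj p_j, a nowhere
  vanishing member of \<open>FT\<close>; the growth of this reciprocal is controlled by
  \<open>p_SI\<close>.\<close>

lemma q2_FT: "(\<lambda>x. complex_of_real ((q x)\<^sup>2)) \<in> FT"
proof -
  have "(\<lambda>x. \<Sum>j\<in>UNIV. p x $ j * cnj (p x $ j)) \<in> FT"
    by (intro FT_sum FT_mult FT_cnj symbol_FT) auto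
  then have w: "(\<lambda>x. complex_of_real ((norm (p x))\<^sup>2)) \<in> FT" by (simp only: norm_p_sum)
  have eq: "inverse (complex_of_real ((norm (p x))\<^sup>2)) = complex_of_real ((q x)\<^sup>2)" for x
    by (simp add: q_def power_inverse)
  have "poly_bounded (\<lambda>x. q x * q x)" by (intro poly_bounded_mult q_poly_bounded)
  then have "poly_bounded (\<lambda>x. inverse (complex_of_real ((norm (p x))\<^sup>2)))"
    unfolding eq by (simp add: poly_bounded_def power2_eq_square norm_mult)
  from FT_inverse[OF w _ this] show ?thesis unfolding eq by (simp add: p_nonzero)
qed

lemma sum_symbol_q2: "(\<Sum>j\<in>UNIV. p x $ j * cnj (p x $ j)) * complex_of_real ((q x)\<^sup>2) = 1"
proof -
  have "(norm (p x))\<^sup>2 * (q x)\<^sup>2 = 1"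
    using norm_p_q[of x] by (simp add: power_mult_distrib[symmetric])
  then show ?thesis unfolding norm_p_sum[symmetric] of_real_mult[symmetric] by simp
qed

text \<open>Through the adjoint relation \<open>P' j\<close> acts by the reflected symbol of
  \<open>P j\<close>, which complex-adjoint invariance identifies with the conjugate symbol.\<close>

lemma normal_operator_fourier:
  assumes T: "T \<in> tempered" and \<zeta>: "\<zeta> \<in> schwartz"
  shows "normal_operator P' P T (fourier \<zeta>) = T (fourier (\<lambda>x. (\<Sum>j\<in>UNIV. p x $ j * cnj (p x $ j)) * \<zeta> x))"
proof -
  have j: "P' j (P j T) (fourier \<zeta>) = T (fourier (\<lambda>x. p x $ j * (cnj (p x $ j) * \<zeta> x)))" for j
  proof -
    let ?\<xi> = "\<lambda>x. cnj (p x $ j) * \<zeta> x"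
    have \<xi>: "?\<xi> \<in> schwartz" by (intro FT_mult_schwartz FT_cnj symbol_FT \<zeta>)
    have PT: "P j T \<in> tempered"
      using dop[of j] T unfolding distributional_operator_def linear_distr_operator_def by blast
    have "P' j (P j T) (fourier \<zeta>) = P j T (restrict_schwartz (P j) (fourier \<zeta>))"
      using dop[of j] PT fourier_schwartz[OF \<zeta>] unfolding distributional_operator_def by blast
    also have "restrict_schwartz (P j) (fourier \<zeta>) = inverse_fourier (\<lambda>x. p x $ j * fourier (fourier \<zeta>) x)"
      by (rule restrict_schwartz_eq[OF dop hdf fourier_schwartz[OF \<zeta>]])
    also have "(\<lambda>x. p x $ j * fourier (fourier \<zeta>) x) = (\<lambda>x. ?\<xi> (- x))"
      using symbol_reflect[OF dop[of j] hdf cai] by (auto simp: fourier_fourier[OF \<zeta>])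
    also have "inverse_fourier (\<lambda>x. ?\<xi> (- x)) = fourier ?\<xi>"
      unfolding inverse_fourier_def[abs_def] fourier_reflect[OF schwartz_borel[OF \<xi>]] by simp
    also have "P j T (fourier ?\<xi>) = T (fourier (\<lambda>x. p x $ j * ?\<xi> x))"
      by (rule operator_fourier[OF hdf T \<xi>])
    finally show ?thesis .
  qed
  have S: "(\<lambda>x. p x $ j * (cnj (p x $ j) * \<zeta> x)) \<in> schwartz" for j
    by (intro FT_mult_schwartz FT_cnj symbol_FT \<zeta>)
  have "normal_operator P' P T (fourier \<zeta>) = (\<Sum>j\<in>UNIV. T (fourier (\<lambda>x. p x $ j * (cnj (p x $ j) * \<zeta> x))))"
    using fourier_schwartz[OF \<zeta>] by (simp add: normal_operator_def j)
  also have "\<dots> = T (\<lambda>x. \<Sum>j\<in>UNIV. fourier (\<lambda>x. p x $ j * (cnj (p x $ j) * \<zeta> x)) x)"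
    by (intro tempered_sum[symmetric] T fourier_schwartz S) auto
  also have "(\<lambda>x. \<Sum>j\<in>UNIV. fourier (\<lambda>x. p x $ j * (cnj (p x $ j) * \<zeta> x)) x) =
      fourier (\<lambda>x. \<Sum>j\<in>UNIV. p x $ j * (cnj (p x $ j) * \<zeta> x))"
    by (intro fourier_sum[symmetric] S) auto
  finally show ?thesis by (simp only: sum_distrib_right mult.assoc)
qed

section \<open>The Green function as a Fourier integral\<close>

abbreviation "Gc \<equiv> \<lambda>x. complex_of_real (G x)"

lemma Gc_continuous: "continuous_on UNIV Gc"
  by (intro continuous_intros G_cont)

lemma Gc_poly_bounded: "poly_bounded Gc"
  using SI_imp_poly_bounded[OF G_SI G_cont] by (simp add: poly_bounded_def)

lemma Gc_borel: "Gc \<in> borel_measurable borel"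
  by (rule borel_measurable_continuous_UNIV[OF Gc_continuous])

text \<open>Testing the Green equation with the transform of \<open>q\<close> squared times \<xi>
  cancels the symbol of the normal operator; the Dirac distribution evaluates that transform at 0,
  which is a plain integral.\<close>

lemma green_identity:
  assumes \<xi>: "\<xi> \<in> schwartz"
  shows "(LINT x|lborel. Gc x * fourier \<xi> x) = fourier_scale TYPE('d) *\<^sub>R (LINT x|lborel. complex_of_real ((q x)\<^sup>2) * \<xi> x)"
proof -
  let ?\<zeta> = "\<lambda>x. complex_of_real ((q x)\<^sup>2) * \<xi> x"
  have \<zeta>: "?\<zeta> \<in> schwartz" by (intro FT_mult_schwartz q2_FT \<xi>)
  have T: "distr_of Gc \<in> tempered" by (intro distr_of_tempered moderate_continuous Gc_continuous Gc_poly_bounded)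
  have "(\<lambda>x. (\<Sum>j\<in>UNIV. p x $ j * cnj (p x $ j)) * ?\<zeta> x) = \<xi>"
    unfolding mult.assoc[symmetric] sum_symbol_q2 by simp
  then have "normal_operator P' P (distr_of Gc) (fourier ?\<zeta>) = distr_of Gc (fourier \<xi>)"
    by (simp only: normal_operator_fourier[OF T \<zeta>])
  moreover have "normal_operator P' P (distr_of Gc) = dirac" using G_green by (simp add: green_function_def)
  ultimately have "distr_of Gc (fourier \<xi>) = fourier ?\<zeta> 0"
    using fourier_schwartz[OF \<zeta>] by (simp add: dirac_def)
  moreover have "distr_of Gc (fourier \<xi>) = (LINT x|lborel. Gc x * fourier \<xi> x)"
    unfolding distr_of_apply[OF fourier_schwartz[OF \<xi>]]
    by (intro lebesgue_integral_eq_lborel borel_measurable_times Gc_borel schwartz_borel fourier_schwartz \<xi>)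
  moreover have "fourier ?\<zeta> 0 = fourier_scale TYPE('d) *\<^sub>R (LINT x|lborel. ?\<zeta> x)"
    unfolding fourier_lborel[OF schwartz_borel[OF \<zeta>]] by simp
  ultimately show ?thesis by simp
qed

text \<open>For damped characters the transform concentrates at -x, so the left-hand side of the
  Green identity tends to a multiple of G(-x) = G(x). One inverse scale factor comes from that
  identity, the other from the Gaussian mass.\<close>

lemma green_limit:
  "(\<lambda>n. LINT y|lborel. complex_of_real ((q y)\<^sup>2) * modulated_gaussian (inverse (real (Suc n))) x y)
    \<longlonglongrightarrow> complex_of_real (G x * (inverse (fourier_scale TYPE('d)))\<^sup>2)"
proof -
  have "(\<lambda>n. inverse (fourier_scale TYPE('d)) *\<^sub>R (LINT z|lborel. Gc z * fourier (modulated_gaussian (inverse (real (Suc n))) x) z))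
      \<longlonglongrightarrow> inverse (fourier_scale TYPE('d)) *\<^sub>R (Gc (- x) * complex_of_real (inverse (fourier_scale TYPE('d))))"
    by (intro tendsto_scaleR tendsto_const fourier_gaussian_limit Gc_continuous Gc_poly_bounded)
  moreover have "inverse (fourier_scale TYPE('d)) *\<^sub>R (LINT z|lborel. Gc z * fourier (modulated_gaussian (inverse (real (Suc n))) x) z) =
      (LINT y|lborel. complex_of_real ((q y)\<^sup>2) * modulated_gaussian (inverse (real (Suc n))) x y)" for n
  proof -
    have e: "0 < inverse (real (Suc n))" by simp
    show ?thesis
      unfolding green_identity[OF modulated_gaussian_schwartz[OF e]]
      by (simp only: scaleR_scaleR left_inverse[OF fourier_scale_nz] scaleR_one)
  qed
  moreover have "inverse (fourier_scale TYPE('d)) *\<^sub>R (Gc (- x) * complex_of_real (inverse (fourier_scale TYPE('d)))) = complex_of_real (G x * (inverse (fourier_scale TYPE('d)))\<^sup>2)"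
    by (simp add: G_even scaleR_conv_of_real power2_eq_square mult_ac)
  ultimately show ?thesis by (simp only:)
qed

lemma q_borel [measurable]: "q \<in> borel_measurable borel"
  by (rule borel_measurable_continuous_UNIV[OF q_continuous])

text \<open>Fatou's lemma bounds \<open>\<integral> q\<^sup>2\<close> by the limit at \<open>0\<close> of the regularised integrals.\<close>
lemma q2_integrable: "integrable lborel (\<lambda>y. (q y)\<^sup>2)"
proof (rule integrableI_bounded)
  let ?g = "\<lambda>n (y::real^'d). gaussian ((inverse (real (Suc n)))\<^sup>2 / 2) y"
  have gb [measurable]: "?g n \<in> borel_measurable borel" for n
    by (intro borel_measurable_continuous_UNIV continuous_intros)
  have mg: "modulated_gaussian (inverse (real (Suc n))) 0 y = complex_of_real (?g n y)" for n y
    by (simp add: modulated_gaussian_def)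
  have S: "(\<lambda>y. complex_of_real ((q y)\<^sup>2) * modulated_gaussian (inverse (real (Suc n))) 0 y) \<in> schwartz" for n
    by (intro FT_mult_schwartz q2_FT modulated_gaussian_schwartz) simp
  have i: "integrable lborel (\<lambda>y. (q y)\<^sup>2 * ?g n y)" for n
    using integrable_Re[OF schwartz_integrable[OF S[of n]]]
    unfolding mg of_real_mult[symmetric] Re_complex_of_real .
  have "(\<lambda>n. complex_of_real (LINT y|lborel. (q y)\<^sup>2 * ?g n y)) \<longlonglongrightarrow> complex_of_real (G 0 * (inverse (fourier_scale TYPE('d)))\<^sup>2)"
    using green_limit[of 0] unfolding mg of_real_mult[symmetric] integral_complex_of_real .
  then have lim: "(\<lambda>n. LINT y|lborel. (q y)\<^sup>2 * ?g n y) \<longlonglongrightarrow> G 0 * (inverse (fourier_scale TYPE('d)))\<^sup>2"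
    by (simp only: tendsto_of_real_iff)
  have "(\<integral>\<^sup>+ y. ennreal (norm ((q y)\<^sup>2)) \<partial>lborel) = (\<integral>\<^sup>+ y. liminf (\<lambda>n. ennreal ((q y)\<^sup>2 * ?g n y)) \<partial>lborel)"
  proof (rule nn_integral_cong)
    fix y :: "real^'d"
    have "(\<lambda>n. ?g n y) \<longlonglongrightarrow> gaussian (0\<^sup>2 / 2) y"
      unfolding gaussian_def by (intro tendsto_intros LIMSEQ_inverse_real_of_nat) simp
    then have "(\<lambda>n. ennreal ((q y)\<^sup>2 * ?g n y)) \<longlonglongrightarrow> ennreal ((q y)\<^sup>2 * gaussian (0\<^sup>2 / 2) y)"
      by (intro tendsto_ennrealI tendsto_mult tendsto_const)
    then have "liminf (\<lambda>n. ennreal ((q y)\<^sup>2 * ?g n y)) = ennreal ((q y)\<^sup>2 * gaussian (0\<^sup>2 / 2) y)"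
      by (intro lim_imp_Liminf) auto
    then show "ennreal (norm ((q y)\<^sup>2)) = liminf (\<lambda>n. ennreal ((q y)\<^sup>2 * ?g n y))"
      by (simp add: gaussian_def)
  qed
  also have "\<dots> \<le> liminf (\<lambda>n. \<integral>\<^sup>+ y. ennreal ((q y)\<^sup>2 * ?g n y) \<partial>lborel)"
    by (intro nn_integral_liminf) measurable
  also have "\<dots> = liminf (\<lambda>n. ennreal (LINT y|lborel. (q y)\<^sup>2 * ?g n y))"
    using nn_integral_eq_integral[OF i] by (simp add: less_imp_le)
  also have "\<dots> = ennreal (G 0 * (inverse (fourier_scale TYPE('d)))\<^sup>2)"
    by (intro lim_imp_Liminf tendsto_ennrealI lim) simp
  also have "\<dots> < \<infinity>" by simp
  finally show "(\<integral>\<^sup>+ y. ennreal (norm ((q y)\<^sup>2)) \<partial>lborel) < \<infinity>" .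
qed measurable

text \<open>Once \<open>q\<close> squared is integrable, dominated convergence identifies the limit
  of the damped integrals with the undamped one.\<close>

lemma G_eq_integral:
  "complex_of_real (G x) = (fourier_scale TYPE('d))\<^sup>2 *\<^sub>R (LINT y|lborel. complex_of_real ((q y)\<^sup>2) * exp (- \<i> * complex_of_real (x \<bullet> y)))"
proof -
  have "integrable lborel (\<lambda>y. complex_of_real ((q y)\<^sup>2))"
    by (rule integrable_of_real[OF q2_integrable])
  from LIMSEQ_unique[OF fourier_modulated_limit[OF this] green_limit]
  have "(LINT y|lborel. complex_of_real ((q y)\<^sup>2) * exp (- \<i> * complex_of_real (x \<bullet> y))) =
      complex_of_real (G x * (inverse (fourier_scale TYPE('d)))\<^sup>2)" .
  moreover have "(fourier_scale TYPE('d))\<^sup>2 * (G x * (inverse (fourier_scale TYPE('d)))\<^sup>2) = G x"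
    by (simp add: power2_eq_square field_simps)
  ultimately show ?thesis by (simp only: scaleR_conv_of_real of_real_mult[symmetric])
qed

text \<open>The single scale factor is chosen so that two features together produce the squared
  factor in the integral formula for \<open>G\<close>, and so that pairing with \<open>E x\<close>
  is exactly the inverse Fourier transform of \<open>q\<close> times the function.\<close>

definition E :: "real^'d \<Rightarrow> real^'d \<Rightarrow> complex" where
  "E x y = complex_of_real (fourier_scale TYPE('d) * q y) * exp (- \<i> * complex_of_real (x \<bullet> y))"

lemma E_borel: "E x \<in> borel_measurable borel"
  unfolding E_def[abs_def] by (intro borel_measurable_continuous_UNIV continuous_intros q_continuous)

lemma E_square_integrable: "E x \<in> square_integrable lebesgue"
proof -
  have n: "(norm (E x y))\<^sup>2 = (fourier_scale TYPE('d))\<^sup>2 * (q y)\<^sup>2" for y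
    using q_pos[of y] by (simp add: E_def norm_mult power_mult_distrib)
  have "integrable lborel (\<lambda>y. (norm (E x y))\<^sup>2)"
    unfolding n by (intro integrable_mult_right q2_integrable)
  then have "integrable lebesgue (\<lambda>y. (norm (E x y))\<^sup>2)"
    using E_borel by (subst lebesgue_integrable_eq_lborel) auto
  moreover have "E x \<in> borel_measurable lebesgue"
    by (rule measurable_completion) (simp add: E_borel)
  ultimately show ?thesis by (simp add: square_integrable_def)
qed

lemma inner_E: "l2_inner lebesgue (E x) (E z) = complex_of_real (G (x - z))"
proof -
  have e: "E x y * cnj (E z y) = complex_of_real ((fourier_scale TYPE('d))\<^sup>2) * (complex_of_real ((q y)\<^sup>2) * exp (- \<i> * complex_of_real ((x - z) \<bullet> y)))" for y
  proof -
    have "exp (- \<i> * complex_of_real (x \<bullet> y)) * cnj (exp (- \<i> * complex_of_real (z \<bullet> y))) =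
        exp (- \<i> * complex_of_real ((x - z) \<bullet> y))"
      unfolding exp_cnj mult_exp_exp by (simp add: inner_diff_left algebra_simps)
    then show ?thesis
      unfolding E_def complex_cnj_mult complex_cnj_complex_of_real
      by (simp add: power2_eq_square mult_ac)
  qed
  have b: "(\<lambda>y. E x y * cnj (E z y)) \<in> borel_measurable borel"
    using E_borel by measurable
  have "l2_inner lebesgue (E x) (E z) = (LINT y|lborel. E x y * cnj (E z y))"
    unfolding l2_inner_def by (rule lebesgue_integral_eq_lborel[OF b])
  also have "\<dots> = complex_of_real ((fourier_scale TYPE('d))\<^sup>2) *
      (LINT y|lborel. complex_of_real ((q y)\<^sup>2) * exp (- \<i> * complex_of_real ((x - z) \<bullet> y)))"
    unfolding e by (rule integral_mult_right_zero)
  finally show ?thesis unfolding G_eq_integral scaleR_conv_of_real .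
qed

sublocale feature_map lebesgue E G
  by unfold_locales (rule E_square_integrable, rule inner_E)

section \<open>Strict positive definiteness\<close>

lemma gaussian_shrink_tendsto:
  "(\<lambda>n. gaussian (1 / (2 * (inverse (real (Suc n)))\<^sup>2)) z) \<longlonglongrightarrow> (if z = 0 then 1 else 0)"
proof (cases "z = 0")
  case True
  then show ?thesis by (simp add: gaussian_def)
next
  case False
  define r where "r = (norm z)\<^sup>2 / 2"
  have r: "r > 0" using False by (simp add: r_def)
  have "(\<lambda>n. exp (- r * (real (Suc n))\<^sup>2)) \<longlonglongrightarrow> 0" using r by real_asymp
  moreover have "gaussian (1 / (2 * (inverse (real (Suc n)))\<^sup>2)) z = exp (- r * (real (Suc n))\<^sup>2)" for n
    by (simp add: gaussian_def r_def field_simps)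
  ultimately show ?thesis using False by simp
qed

text \<open>
  If the combination of characters vanishes, then pairing it with a Schwartz function \<open>\<eta>\<close> shows
  that \<open>\<Sum>\<^sub>x c\<^sub>x (fourier \<eta>) x = 0\<close>; Gaussians concentrating at a point isolate a single coefficient.
\<close>
lemma comb_independent:
  assumes X: "finite X" and ae: "AE y in lebesgue. comb X c y = 0" and z: "z \<in> X"
  shows "c z = 0"
proof -
  have char: "AE y in lborel. (\<Sum>x\<in>X. complex_of_real (c x) * exp (- \<i> * complex_of_real (x \<bullet> y))) = 0"
  proof -
    have "AE y in lebesgue. (\<Sum>x\<in>X. complex_of_real (c x) * exp (- \<i> * complex_of_real (x \<bullet> y))) = 0"
      using ae
    proof eventually_elim
      case (elim y)
      have "comb X c y = complex_of_real (fourier_scale TYPE('d) * q y) * (\<Sum>x\<in>X. complex_of_real (c x) * exp (- \<i> * complex_of_real (x \<bullet> y)))"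
        by (simp only: comb_def E_def sum_distrib_left mult.left_commute)
      moreover have "fourier_scale TYPE('d) * q y \<noteq> 0" using q_pos[of y] by simp
      ultimately show ?case using elim by (simp only: mult_eq_0_iff of_real_eq_0_iff) simp
    qed
    then show ?thesis by (simp only: AE_completion_iff)
  qed
  have sum0: "(\<Sum>x\<in>X. complex_of_real (c x) * fourier \<eta> x) = 0" if \<eta>: "\<eta> \<in> schwartz" for \<eta>
  proof -
    have i: "integrable lborel (\<lambda>y. \<eta> y * exp (- \<i> * complex_of_real (x \<bullet> y)))" for x
      by (intro integrable_mult_exp_inner schwartz_integrable \<eta>) simp
    have "(\<Sum>x\<in>X. complex_of_real (c x) * fourier \<eta> x) =
        fourier_scale TYPE('d) *\<^sub>R (\<Sum>x\<in>X. complex_of_real (c x) * (LINT y|lborel. \<eta> y * exp (- \<i> * complex_of_real (x \<bullet> y))))"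
      unfolding fourier_lborel[OF schwartz_borel[OF \<eta>]] scaleR_sum_right by simp
    also have "(\<Sum>x\<in>X. complex_of_real (c x) * (LINT y|lborel. \<eta> y * exp (- \<i> * complex_of_real (x \<bullet> y)))) =
        (LINT y|lborel. (\<Sum>x\<in>X. complex_of_real (c x) * (\<eta> y * exp (- \<i> * complex_of_real (x \<bullet> y)))))"
      unfolding integral_mult_right_zero[symmetric]
      by (intro Bochner_Integration.integral_sum[symmetric] integrable_mult_right i)
    also have "\<dots> = 0"
    proof (rule integral_eq_zero_AE)
      show "AE y in lborel. (\<Sum>x\<in>X. complex_of_real (c x) * (\<eta> y * exp (- \<i> * complex_of_real (x \<bullet> y)))) = 0"
        using char
      proof eventually_elim
        case (elim y)
        have "(\<Sum>x\<in>X. complex_of_real (c x) * (\<eta> y * exp (- \<i> * complex_of_real (x \<bullet> y)))) =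
            \<eta> y * (\<Sum>x\<in>X. complex_of_real (c x) * exp (- \<i> * complex_of_real (x \<bullet> y)))"
          by (simp only: sum_distrib_left mult.left_commute)
        then show ?case by (simp only: elim mult_zero_right)
      qed
    qed
    finally show ?thesis by simp
  qed
  have z0: "(\<Sum>x\<in>X. c x * gaussian (1 / (2 * (inverse (real (Suc n)))\<^sup>2)) (x - z)) = 0" for n
  proof -
    let ?e = "inverse (real (Suc n))"
    have e: "0 < ?e" by simp
    \<comment> \<open>With modulation by -z the transform is a Gaussian centred at z.\<close>
    have "0 = (\<Sum>x\<in>X. complex_of_real (c x) * fourier (modulated_gaussian ?e (- z)) x)"
      by (rule sum0[OF modulated_gaussian_schwartz[OF e], symmetric])
    also have "\<dots> = complex_of_real (\<Sum>x\<in>X. c x * (gaussian (1 / (2 * ?e\<^sup>2)) (- z + x) / ?e ^ CARD('d)))"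
      by (simp only: fourier_modulated_gaussian[OF e] of_real_sum of_real_mult)
    finally have "complex_of_real (\<Sum>x\<in>X. c x * (gaussian (1 / (2 * ?e\<^sup>2)) (- z + x) / ?e ^ CARD('d))) = 0"
      by (rule sym)
    then have "(\<Sum>x\<in>X. c x * (gaussian (1 / (2 * ?e\<^sup>2)) (- z + x) / ?e ^ CARD('d))) = 0"
      by (rule of_real_eq_0_iff[THEN iffD1])
    then have "(\<Sum>x\<in>X. c x * gaussian (1 / (2 * ?e\<^sup>2)) (x - z)) / ?e ^ CARD('d) = 0"
      by (simp only: sum_divide_distrib times_divide_eq_right uminus_add_conv_diff)
    moreover have "?e ^ CARD('d) \<noteq> 0" by simp
    ultimately show ?thesis unfolding divide_eq_0_iff by blast
  qed
  have "(\<lambda>n. \<Sum>x\<in>X. c x * gaussian (1 / (2 * (inverse (real (Suc n)))\<^sup>2)) (x - z)) \<longlonglongrightarrow>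
      (\<Sum>x\<in>X. c x * (if x - z = 0 then 1 else 0))"
    by (intro tendsto_sum tendsto_mult tendsto_const gaussian_shrink_tendsto)
  then have "(\<Sum>x\<in>X. c x * (if x - z = 0 then 1 else 0)) = 0"
    unfolding z0 by (rule LIMSEQ_unique[OF _ tendsto_const])
  moreover have "(\<Sum>x\<in>X. c x * (if x - z = 0 then 1 else 0)) = (\<Sum>x\<in>X. if x = z then c x else 0)"
    by (intro sum.cong) auto
  ultimately show ?thesis using X z by simp
qed

text \<open>The quadratic form is the squared L2 norm of the feature combination, which vanishes
  only if the combination is zero almost everywhere; independence of the characters excludes
  this.\<close>

lemma G_pos_def: "pos_def G"
  unfolding cond_pos_def_def
proof (intro conjI allI impI G_cont G_even)
  fix X :: "(real^'d) set" and c :: "real^'d \<Rightarrow> real"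
  assume "finite X \<and> (\<exists>x\<in>X. c x \<noteq> 0) \<and> annihilates 0 X c"
  then obtain z where X: "finite X" and z: "z \<in> X" "c z \<noteq> 0" by blast
  have "complex_of_real (l2_norm2 lebesgue (comb X c)) = complex_of_real (\<Sum>x\<in>X. \<Sum>y\<in>X. c x * c y * G (x - y))"
    unfolding l2_inner_self[symmetric] by (rule inner_comb[OF X X])
  then have eq: "(\<Sum>x\<in>X. \<Sum>y\<in>X. c x * c y * G (x - y)) = l2_norm2 lebesgue (comb X c)"
    by (simp only: of_real_eq_iff)
  have "l2_norm2 lebesgue (comb X c) \<noteq> 0"
    using l2_norm2_eq_0[OF comb_sq[OF X]] comb_independent[OF X _ z(1)] z(2) by blast
  then show "0 < (\<Sum>x\<in>X. \<Sum>y\<in>X. c x * c y * G (x - y))"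
    unfolding eq using l2_norm2_nonneg[of lebesgue "comb X c"] by linarith
qed

section \<open>Identification of the native space with the Sobolev space\<close>

lemma q_square_integrable: "(\<lambda>y. complex_of_real (q y)) \<in> square_integrable lebesgue"
proof -
  have "integrable lebesgue (\<lambda>y. (q y)\<^sup>2)"
    using q2_integrable by (subst lebesgue_integrable_eq_lborel) auto
  moreover have "(\<lambda>y. complex_of_real (q y)) \<in> borel_measurable lebesgue"
    by (rule measurable_completion) simp
  ultimately show ?thesis by (simp add: square_integrable_def)
qed

lemma l2_inner_E: "l2_inner lebesgue \<Phi> (E x) = inverse_fourier (\<lambda>y. complex_of_real (q y) * \<Phi> y) x"
proof -
  have "\<Phi> y * cnj (E x y) = complex_of_real (fourier_scale TYPE('d)) * ((complex_of_real (q y) * \<Phi> y) * exp (- \<i> * complex_of_real ((- x) \<bullet> y)))" for y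
    by (simp add: E_def exp_cnj mult_ac)
  then show ?thesis
    unfolding l2_inner_def inverse_fourier_def fourier_def fourier_scale_def[of "TYPE('d)", symmetric]
    by (simp only: integral_mult_right_zero)
qed

lemma inverse_fourier_moderate:
  assumes \<Phi>: "\<Phi> \<in> square_integrable lebesgue"
  shows "integrable lebesgue (\<lambda>y. complex_of_real (q y) * \<Phi> y)"
    and "moderate (\<lambda>x. l2_inner lebesgue \<Phi> (E x))"
    and "\<zeta> \<in> schwartz \<Longrightarrow> (LINT x|lebesgue. l2_inner lebesgue \<Phi> (E x) * fourier \<zeta> x) =
      (LINT y|lebesgue. complex_of_real (q y) * \<Phi> y * \<zeta> y)"
proof -
  show i: "integrable lebesgue (\<lambda>y. complex_of_real (q y) * \<Phi> y)"
    by (rule l2_integrable(1)[OF q_square_integrable \<Phi>])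
  show "moderate (\<lambda>x. l2_inner lebesgue \<Phi> (E x))"
    unfolding l2_inner_E
    by (intro moderate_continuous continuous_inverse_fourier poly_bounded_inverse_fourier i)
  show "\<zeta> \<in> schwartz \<Longrightarrow> (LINT x|lebesgue. l2_inner lebesgue \<Phi> (E x) * fourier \<zeta> x) =
      (LINT y|lebesgue. complex_of_real (q y) * \<Phi> y * \<zeta> y)"
    unfolding l2_inner_E by (rule inverse_fourier_duality[OF i])
qed

text \<open>If f is the function induced by \<Phi>, its transform is \<open>q\<close> times \<Phi>,
  and this is the transform of \<open>P j\<close> applied to f. As the squares of |p_j q| sum to 1,
  the components of \<Phi> form an isometric image of it.\<close>

definition component :: "'n \<Rightarrow> (real^'d \<Rightarrow> complex) \<Rightarrow> real^'d \<Rightarrow> complex" where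
  "component j \<Phi> y = p y $ j * complex_of_real (q y) * \<Phi> y"

lemma symbol_q_measurable: "(\<lambda>y. p y $ j * complex_of_real (q y)) \<in> borel_measurable lebesgue"
proof (rule measurable_completion)
  have "(\<lambda>y. p y $ j * complex_of_real (q y)) \<in> borel_measurable borel"
    by (intro borel_measurable_continuous_UNIV continuous_intros FT_continuous symbol_FT q_continuous)
  then show "(\<lambda>y. p y $ j * complex_of_real (q y)) \<in> borel_measurable lborel" by simp
qed

lemma component_square_integrable:
  "\<Phi> \<in> square_integrable lebesgue \<Longrightarrow> component j \<Phi> \<in> square_integrable lebesgue"
  unfolding component_def[abs_def]
  by (intro square_integrable_bounded_mult symbol_q_measurable symbol_q_le)

lemma sum_component_inner:
  assumes \<Phi>: "\<Phi> \<in> square_integrable lebesgue" and \<Psi>: "\<Psi> \<in> square_integrable lebesgue"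
  shows "(\<Sum>j\<in>UNIV. l2_inner lebesgue (component j \<Phi>) (component j \<Psi>)) = l2_inner lebesgue \<Phi> \<Psi>"
proof -
  have "(\<Sum>j\<in>UNIV. l2_inner lebesgue (component j \<Phi>) (component j \<Psi>)) =
      (LINT y|lebesgue. (\<Sum>j\<in>UNIV. component j \<Phi> y * cnj (component j \<Psi> y)))"
    unfolding l2_inner_def
    by (intro Bochner_Integration.integral_sum[symmetric] l2_integrable(2) component_square_integrable \<Phi> \<Psi>)
  moreover have "(\<Sum>j\<in>UNIV. component j \<Phi> y * cnj (component j \<Psi> y)) = \<Phi> y * cnj (\<Psi> y)" for y
  proof -
    have "component j \<Phi> y * cnj (component j \<Psi> y) =
        (p y $ j * cnj (p y $ j)) * (complex_of_real ((q y)\<^sup>2) * (\<Phi> y * cnj (\<Psi> y)))" for j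
      by (simp add: component_def power2_eq_square mult_ac)
    then have "(\<Sum>j\<in>UNIV. component j \<Phi> y * cnj (component j \<Psi> y)) =
        ((\<Sum>j\<in>UNIV. p y $ j * cnj (p y $ j)) * complex_of_real ((q y)\<^sup>2)) * (\<Phi> y * cnj (\<Psi> y))"
      by (simp only: sum_distrib_right mult.assoc)
    then show ?thesis by (simp only: sum_symbol_q2 mult_1_left)
  qed
  ultimately show ?thesis by (simp only: l2_inner_def[of _ \<Phi> \<Psi>])
qed

text \<open>Duality for the integrable function \<open>q\<close> times \<Phi> moves the pairing to
  the Fourier side, where \<open>P j\<close> multiplies by p_j; Plancherel duality moves the
  resulting component back to \<open>h\<close>.\<close>

lemma native_map_operator:
  assumes A: "represents A \<Phi>" and h: "plancherel_pair h (component j \<Phi>)"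
  shows "P j (distr_of (\<lambda>x. complex_of_real (native_map 0 G {} A x))) = distr_of h"
  unfolding native_map_eval[OF A]
proof (rule operator_distr_eqI)
  have \<Phi>: "\<Phi> \<in> square_integrable lebesgue" using A by (simp add: represents_def)
  show "moderate (\<lambda>x. l2_inner lebesgue \<Phi> (E x))" by (rule inverse_fourier_moderate(2)[OF \<Phi>])
  show "moderate h" by (rule moderate_square_integrable[OF plancherel_sq(1)[OF h]])
  fix \<eta> :: "real^'d \<Rightarrow> complex" assume \<eta>: "\<eta> \<in> schwartz"
  have S: "(\<lambda>x. p x $ j * \<eta> x) \<in> schwartz" by (intro FT_mult_schwartz symbol_FT \<eta>)
  have "(LINT x|lebesgue. l2_inner lebesgue \<Phi> (E x) * fourier (\<lambda>x. p x $ j * \<eta> x) x) =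
      (LINT y|lebesgue. complex_of_real (q y) * \<Phi> y * (p y $ j * \<eta> y))"
    by (rule inverse_fourier_moderate(3)[OF \<Phi> S])
  also have "\<dots> = (LINT y|lebesgue. component j \<Phi> y * \<eta> y)"
    by (simp only: component_def mult_ac)
  also have "\<dots> = (LINT x|lebesgue. h x * fourier \<eta> x)"
    by (rule plancherel_duality[OF h \<eta>, symmetric])
  finally show "(LINT x|lebesgue. l2_inner lebesgue \<Phi> (E x) * fourier (\<lambda>x. p x $ j * \<eta> x) x) =
      (LINT x|lebesgue. h x * fourier \<eta> x)" .
qed

lemma native_map_sobolev:
  assumes A: "represents A \<Phi>"
  shows "native_map 0 G {} A \<in> sobolev_space P"
  unfolding sobolev_space_def
proof (intro CollectI conjI IntI allI)
  have \<Phi>: "\<Phi> \<in> square_integrable lebesgue" using A by (simp add: represents_def)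
  note i = inverse_fourier_moderate(1)[OF \<Phi>]
  let ?f = "native_map 0 G {} A"
  have f: "?f x = Re (inverse_fourier (\<lambda>y. complex_of_real (q y) * \<Phi> y) x)" for x
    unfolding l2_inner_E[symmetric] native_map_eval[OF A, symmetric] by simp
  have c: "continuous_on UNIV ?f"
    unfolding f[abs_def] by (intro continuous_on_Re continuous_inverse_fourier i)
  then show "?f \<in> L1loc" by (rule L1loc_continuous)
  obtain N C where "\<And>x. norm (inverse_fourier (\<lambda>y. complex_of_real (q y) * \<Phi> y) x) \<le> C * weight x ^ N"
    using poly_bounded_inverse_fourier[OF i] by (elim poly_boundedE) blast
  then have "norm (?f x) \<le> C * weight x ^ N" for x
    unfolding f real_norm_def by (rule order_trans[OF abs_Re_le_cmod])
  then show "?f \<in> SI" by (intro poly_bounded_imp_SI poly_boundedI)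
  fix j
  obtain h where h: "plancherel_pair h (component j \<Phi>)"
    using plancherel_ex_left[OF component_square_integrable[OF \<Phi>]] by blast
  show "\<exists>h\<in>L2. P j (distr_of (\<lambda>x. complex_of_real (?f x))) = distr_of h"
    unfolding L2_complex using native_map_operator[OF A h] plancherel_sq(1)[OF h] by blast
qed

text \<open>The choice made by \<open>SOME\<close> is immaterial, since a moderate function is
  determined almost everywhere by its distribution.\<close>

lemma L2_representative_eq:
  assumes "h \<in> square_integrable lebesgue"
  shows "L2_representative (distr_of h) \<in> square_integrable lebesgue"
    and "AE x in lebesgue. L2_representative (distr_of h) x = h x"
proof -
  have "\<exists>k. k \<in> L2 \<and> distr_of h = distr_of k" using assms unfolding L2_complex by blast
  then have *: "L2_representative (distr_of h) \<in> L2 \<and> distr_of h = distr_of (L2_representative (distr_of h))"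
    unfolding L2_representative_def by (rule someI_ex)
  then show s: "L2_representative (distr_of h) \<in> square_integrable lebesgue" by (simp add: L2_complex)
  show "AE x in lebesgue. L2_representative (distr_of h) x = h x"
    using * by (intro distr_of_eqD moderate_square_integrable s assms) simp
qed

text \<open>Plancherel's theorem turns each summand into an inner product of components, and these
  add up to the inner product of \<Phi> and \<Psi>.\<close>

lemma sobolev_inner_native_map:
  assumes A: "represents A \<Phi>" and B: "represents B \<Psi>"
  shows "sobolev_inner P (native_map 0 G {} A) (native_map 0 G {} B) = l2_inner lebesgue \<Phi> \<Psi>"
proof -
  have \<Phi>: "\<Phi> \<in> square_integrable lebesgue" and \<Psi>: "\<Psi> \<in> square_integrable lebesgue"
    using A B by (simp_all add: represents_def)
  have "(LINT x|lebesgue. L2_representative (P j (distr_of (\<lambda>y. complex_of_real (native_map 0 G {} A y)))) x *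
      cnj (L2_representative (P j (distr_of (\<lambda>y. complex_of_real (native_map 0 G {} B y)))) x)) =
      l2_inner lebesgue (component j \<Phi>) (component j \<Psi>)" for j
  proof -
    obtain h where h: "plancherel_pair h (component j \<Phi>)"
      using plancherel_ex_left[OF component_square_integrable[OF \<Phi>]] by blast
    obtain k where k: "plancherel_pair k (component j \<Psi>)"
      using plancherel_ex_left[OF component_square_integrable[OF \<Psi>]] by blast
    note hs = plancherel_sq(1)[OF h] and ks = plancherel_sq(1)[OF k]
    note H = L2_representative_eq[OF hs] and K = L2_representative_eq[OF ks]
    note [measurable] = square_integrableD(1)[OF hs] square_integrableD(1)[OF ks]
      square_integrableD(1)[OF H(1)] square_integrableD(1)[OF K(1)]
    have "(LINT x|lebesgue. L2_representative (distr_of h) x * cnj (L2_representative (distr_of k) x)) =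
        (LINT x|lebesgue. h x * cnj (k x))"
    proof (rule integral_cong_AE)
      show "AE x in lebesgue. L2_representative (distr_of h) x * cnj (L2_representative (distr_of k) x) = h x * cnj (k x)"
        using H(2) K(2) by eventually_elim simp
    qed measurable
    then show ?thesis
      unfolding native_map_operator[OF A h] native_map_operator[OF B k] plancherel_inner[OF h k, symmetric]
      by (simp only: l2_inner_def)
  qed
  then show ?thesis
    unfolding sobolev_inner_def by (simp only: sum_component_inner[OF \<Phi> \<Psi>])
qed

text \<open>
  If \<open>h\<^sub>j\<close> represents \<open>P\<^sub>j f\<close> and \<open>k\<^sub>j\<close> is its Fourier transform, then \<open>p\<^sub>j (fourier f) = k\<^sub>j\<close>, so that
  \<open>fourier f = q\<^sup>2 \<Sum>\<^sub>j cnj p\<^sub>j k\<^sub>j = q \<Phi>\<close>.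
\<close>
lemma sobolev_inversion:
  assumes f: "f \<in> sobolev_space P"
  shows "\<exists>\<Phi>\<in>square_integrable lebesgue. AE x in lebesgue. complex_of_real (f x) = l2_inner lebesgue \<Phi> (E x)"
proof -
  let ?f = "\<lambda>x. complex_of_real (f x)"
  have fm: "moderate ?f" using f by (intro moderate_L1loc_SI) (auto simp: sobolev_space_def)
  have "\<forall>j. \<exists>k. k \<in> square_integrable lebesgue \<and>
      (\<forall>\<eta>\<in>schwartz. (LINT x|lebesgue. ?f x * fourier (\<lambda>x. p x $ j * \<eta> x) x) = (LINT x|lebesgue. k x * \<eta> x))"
  proof
    fix j
    obtain h where h: "h \<in> square_integrable lebesgue" "P j (distr_of ?f) = distr_of h"
      using f by (auto simp: sobolev_space_def L2_complex)
    obtain k where k: "plancherel_pair h k" using plancherel_ex_right[OF h(1)] by blast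
    have "(LINT x|lebesgue. ?f x * fourier (\<lambda>x. p x $ j * \<eta> x) x) = (LINT x|lebesgue. k x * \<eta> x)"
      if \<eta>: "\<eta> \<in> schwartz" for \<eta>
    proof -
      have "(\<lambda>x. p x $ j * \<eta> x) \<in> schwartz" by (intro FT_mult_schwartz symbol_FT \<eta>)
      then have "(LINT x|lebesgue. ?f x * fourier (\<lambda>x. p x $ j * \<eta> x) x) = distr_of h (fourier \<eta>)"
        unfolding h(2)[symmetric] operator_fourier[OF hdf distr_of_tempered[OF fm] \<eta>]
        by (simp only: distr_of_apply fourier_schwartz)
      then show ?thesis
        by (simp only: distr_of_apply fourier_schwartz \<eta> plancherel_duality[OF k \<eta>])
    qed
    then show "\<exists>k. k \<in> square_integrable lebesgue \<and>
      (\<forall>\<eta>\<in>schwartz. (LINT x|lebesgue. ?f x * fourier (\<lambda>x. p x $ j * \<eta> x) x) = (LINT x|lebesgue. k x * \<eta> x))"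
      using plancherel_sq(2)[OF k] by blast
  qed
  from choice[OF this] obtain k where k: "\<And>j. k j \<in> square_integrable lebesgue"
    and kf: "\<And>j \<eta>. \<eta> \<in> schwartz \<Longrightarrow>
      (LINT x|lebesgue. ?f x * fourier (\<lambda>x. p x $ j * \<eta> x) x) = (LINT x|lebesgue. k j x * \<eta> x)"
    by blast
  \<comment> \<open>The adjoint of the component isometry applied to the family \<open>k\<close>: if
    k_j were p_j F, this would be F / q.\<close>
  define \<Phi> where "\<Phi> y = (\<Sum>j\<in>UNIV. cnj (p y $ j * complex_of_real (q y)) * k j y)" for y
  have \<Phi>: "\<Phi> \<in> square_integrable lebesgue"
    unfolding \<Phi>_def[abs_def]
  proof (intro square_integrable_sum square_integrable_bounded_mult k)
    show "(\<lambda>y. cnj (p y $ j * complex_of_real (q y))) \<in> borel_measurable lebesgue" for j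
      by (rule borel_measurable_cnj[OF symbol_q_measurable])
    show "norm (cnj (p y $ j * complex_of_real (q y))) \<le> 1" for j y
      unfolding complex_mod_cnj by (rule symbol_q_le)
  qed simp
  have "AE x in lebesgue. ?f x = l2_inner lebesgue \<Phi> (E x)"
  proof (rule moderate_unique[OF fm inverse_fourier_moderate(2)[OF \<Phi>]])
    fix \<gamma> :: "real^'d \<Rightarrow> complex" assume \<gamma>: "\<gamma> \<in> schwartz"
    define \<zeta> where "\<zeta> = inverse_fourier \<gamma>"
    have \<zeta>: "\<zeta> \<in> schwartz" "fourier \<zeta> = \<gamma>"
      by (simp_all add: \<zeta>_def inverse_fourier_schwartz fourier_inverse_fourier \<gamma>)
    \<comment> \<open>Pairings of f are known only against transforms of p_j times a test function.
      Splitting \<zeta> as the sum of p_j \<eta>_j reduces an arbitrary test function to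
      these.\<close>
    define \<eta> where "\<eta> j y = cnj (p y $ j) * (complex_of_real ((q y)\<^sup>2) * \<zeta> y)" for j y
    have \<eta>: "\<eta> j \<in> schwartz" for j
      unfolding \<eta>_def[abs_def] by (intro FT_mult_schwartz FT_cnj symbol_FT q2_FT \<zeta>)
    have S: "(\<lambda>x. p x $ j * \<eta> j x) \<in> schwartz" for j by (intro FT_mult_schwartz symbol_FT \<eta>)
    have z: "\<zeta> = (\<lambda>x. \<Sum>j\<in>UNIV. p x $ j * \<eta> j x)"
    proof
      fix x
      have "(\<Sum>j\<in>UNIV. p x $ j * \<eta> j x) = ((\<Sum>j\<in>UNIV. p x $ j * cnj (p x $ j)) * complex_of_real ((q x)\<^sup>2)) * \<zeta> x"
        by (simp only: \<eta>_def sum_distrib_right mult.assoc)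
      then show "\<zeta> x = (\<Sum>j\<in>UNIV. p x $ j * \<eta> j x)" by (simp only: sum_symbol_q2 mult_1_left)
    qed
    have \<gamma>_eq: "\<gamma> x = (\<Sum>j\<in>UNIV. fourier (\<lambda>x. p x $ j * \<eta> j x) x)" for x
      using fun_cong[OF trans[OF arg_cong[OF z, of fourier] fourier_sum[OF finite S]], of x]
      unfolding \<zeta>(2) .
    have "(LINT x|lebesgue. ?f x * \<gamma> x) = (LINT x|lebesgue. (\<Sum>j\<in>UNIV. ?f x * fourier (\<lambda>x. p x $ j * \<eta> j x) x))"
      by (simp only: \<gamma>_eq sum_distrib_left)
    also have "\<dots> = (\<Sum>j\<in>UNIV. LINT x|lebesgue. ?f x * fourier (\<lambda>x. p x $ j * \<eta> j x) x)"
      by (intro Bochner_Integration.integral_sum moderate_pairing_integrable fm fourier_schwartz S)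
    also have "\<dots> = (\<Sum>j\<in>UNIV. LINT x|lebesgue. k j x * \<eta> j x)" by (simp only: kf \<eta>)
    also have "\<dots> = (LINT x|lebesgue. (\<Sum>j\<in>UNIV. k j x * \<eta> j x))"
      by (intro Bochner_Integration.integral_sum[symmetric] moderate_pairing_integrable moderate_square_integrable k \<eta>)
    also have "\<dots> = (LINT y|lebesgue. complex_of_real (q y) * \<Phi> y * \<zeta> y)"
    proof (rule Bochner_Integration.integral_cong[OF refl])
      fix y
      have "k j y * \<eta> j y = complex_of_real (q y) * ((cnj (p y $ j * complex_of_real (q y)) * k j y) * \<zeta> y)" for j
        by (simp add: \<eta>_def power2_eq_square mult_ac)
      then show "(\<Sum>j\<in>UNIV. k j y * \<eta> j y) = complex_of_real (q y) * \<Phi> y * \<zeta> y"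
        by (simp only: \<Phi>_def sum_distrib_left sum_distrib_right mult.assoc)
    qed
    also have "\<dots> = (LINT x|lebesgue. l2_inner lebesgue \<Phi> (E x) * fourier \<zeta> x)"
      by (rule inverse_fourier_moderate(3)[OF \<Phi> \<zeta>(1), symmetric])
    finally show "(LINT x|lebesgue. ?f x * \<gamma> x) = (LINT x|lebesgue. l2_inner lebesgue \<Phi> (E x) * \<gamma> x)"
      unfolding \<zeta>(2) .
  qed
  with \<Phi> show ?thesis by blast
qed

text \<open>The native space consists of continuous functions, whereas the Sobolev space is stable
  under changes on null sets; the saturation accounts for exactly this.\<close>

lemma native_eq_sobolev: "ae_saturation (native_space 0 G {}) = sobolev_space P"
proof (intro equalityI subsetI)
  fix f assume "f \<in> ae_saturation (native_space 0 G {})"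
  then obtain g where "g \<in> native_space 0 G {}" and ae: "AE x in lebesgue. f x = g x"
    by (auto simp: ae_saturation_def)
  then obtain A where A: "A \<in> kernel_completion 0 G" "g = native_map 0 G {} A"
    by (auto simp: native_space_iff)
  obtain \<Phi> where "represents A \<Phi>" using completion_represents[OF A(1)] by blast
  from native_map_sobolev[OF this] show "f \<in> sobolev_space P"
    unfolding A(2)[symmetric] by (rule sobolev_space_cong_AE[OF _ ae])
next
  fix f assume "f \<in> sobolev_space P"
  then obtain \<Phi> where \<Phi>: "\<Phi> \<in> square_integrable lebesgue"
    and ae: "AE x in lebesgue. complex_of_real (f x) = l2_inner lebesgue \<Phi> (E x)"
    using sobolev_inversion by blast
  obtain A where A: "A \<in> kernel_completion 0 G" "\<And>x. native_map 0 G {} A x = Re (l2_inner lebesgue \<Phi> (E x))"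
    using native_projection[OF \<Phi>] by blast
  have "AE x in lebesgue. f x = native_map 0 G {} A x"
    using ae by eventually_elim (metis A(2) Re_complex_of_real)
  then show "f \<in> ae_saturation (native_space 0 G {})"
    unfolding ae_saturation_def using A(1) native_space_iff by blast
qed

lemma native_inner_eq_sobolev_inner:
  assumes "f \<in> native_space 0 G {}" "g \<in> native_space 0 G {}"
  shows "complex_of_real (native_inner 0 G {} f g) = sobolev_inner P f g"
proof -
  obtain A B where A: "A \<in> kernel_completion 0 G" "f = native_map 0 G {} A"
    and B: "B \<in> kernel_completion 0 G" "g = native_map 0 G {} B"
    using assms by (auto simp: native_space_iff)
  obtain \<Phi> \<Psi> where r: "represents A \<Phi>" "represents B \<Psi>"
    using completion_represents[OF A(1)] completion_represents[OF B(1)] by blast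
  show ?thesis
    unfolding A(2) B(2) sobolev_inner_native_map[OF r] by (rule native_inner_eq[OF r(1) A(1) r(2) B(1)])
qed

end

theorem theorem4p6:
  fixes P P' :: "'n::finite \<Rightarrow> 'd::finite distr_operator"
    and p :: "real^'d \<Rightarrow> complex^'n"
    and m :: nat
    and G :: "real^'d \<Rightarrow> real"
  assumes "\<And>j. distributional_operator (P j) (P' j)"
    and "\<And>j. complex_adjoint_invariant (P j)"
    and "\<And>j. has_distr_fourier (P j) (\<lambda>x. p x $ j)"
    and "\<And>x. x \<noteq> 0 \<Longrightarrow> p x \<noteq> 0"
    and "(\<lambda>x. inverse (norm (p x))) \<in> SI"
    and "(\<lambda>x. norm (p x)) \<in> \<Theta>[at 0](\<lambda>x. norm x ^ m)"
    and "continuous_on UNIV G"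
    and "G \<in> SI"
    and "\<And>x. G (- x) = G x"
    and "green_function (normal_operator P' P) (distr_of (\<lambda>x. complex_of_real (G x)))"
    and "sobolev_space P \<subseteq> L2"
  shows "pos_def G \<and> m = 0 \<and>
    (\<forall>\<Xi>. unisolvent m \<Xi> \<longrightarrow>
       ae_saturation (native_space m G \<Xi>) = sobolev_space P \<and>
       (\<forall>f\<in>native_space m G \<Xi>. \<forall>g\<in>native_space m G \<Xi>.
          complex_of_real (native_inner m G \<Xi> f g) = sobolev_inner P f g))"
proof -
  interpret sobolev_setting P P' p m G
    by unfold_locales (fact assms)+
  \<comment> \<open>For m = 0 the only unisolvent set is empty, so the statement for all \<Xi> is
    the one proved for \<open>{}\<close>.\<close>
  show ?thesis
    using G_pos_def m_eq_0 native_eq_sobolev native_inner_eq_sobolev_inner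
    by (auto simp: unisolvent_0)
qed

end
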